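(* Let $m\in C_c^\infty(\mathbb R^2;\mathbb R)$, $T>\tau_h/2$, and $V_m(t,\boldsymbol x)=\eta_{\tau_h}(t-T)m(\boldsymbol x)$ with $1+V_m\ge\kappa_0>0$ for all $t,\boldsymbol x$. Let $\boldsymbol w_0\in\mathcal H_{\rm v}$. Let $\boldsymbol W$ be the solution of the modulated system $A_V(t)\partial_t\boldsymbol W+\Lambda\boldsymbol W+B_V(t)\boldsymbol W=0$ with $\boldsymbol W(0)=\boldsymbol w_0$, and let $E_z^m$ be its third component. Let $\boldsymbol W_0(t)=U_0(t)\boldsymbol w_0$ be the background (unmodulated) solution and $E_z^0$ its third component. Let $\boldsymbol\Upsilon_0:=\partial_t\boldsymbol W_0(0)=-A_0^{-1}(\Lambda+B_0)\boldsymbol w_0$, let $M_m$ be multiplication by $m$, and let $\Gamma:=\mathrm{diag}(-1,-1,1,1)$. For $t\ge T+\tau_h/2$ define $$\boldsymbol w_R^m(t):=\frac12\int_0^t\eta_{\tau_h}(r-T)\,U_0(t-r)M_m\Gamma\,\partial_r\boldsymbol W_0(r)\,dr.$$ Then the solution has the exact form $$\boldsymbol W(t)=\boldsymbol W_0(t)+\boldsymbol w_R^m(t)+\boldsymbol N_m(t),$$ where $$\begin{aligned}\boldsymbol N_m(t):=&-\frac12\int_0^tU_0(t-r)V_m(r)\partial_r\boldsymbol W_0(r)\,dr+\frac1\mu\int_0^t\eta_{\tau_h}(r-T)U_0(t-r)\begin{pmatrix}(\partial_{x_2}m)E_z^0(r)\\-(\partial_{x_1}m)E_z^0(r)\\0\\0\end{pmatrix}dr\\&+\int_0^tU_0(t-r)A_0^{-1}\boldsymbol{\mathcal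 F}_m[E_z^m-E_z^0](r)\,dr.\end{aligned}$$ At time $2T$, the reversed component is $$\boldsymbol w_R^m(2T)=\frac12\int_{-\tau_h/2}^{\tau_h/2}\eta_{\tau_h}(s)\,U_0(T-s)M_m\Gamma U_0(T+s)\boldsymbol\Upsilon_0\,ds,$$ and the operator $\boldsymbol\Upsilon_0\mapsto\boldsymbol w_R^m(2T)$ given by this formula is denoted $K_{m,\tau_h}$, i.e. $K_{m,\tau_h}\boldsymbol\Upsilon_0:=\boldsymbol w_R^m(2T)$.
   Context: $\mu,\epsilon_0>0$ are constants; $\epsilon_\infty,\Delta\epsilon,\tau_D,\sigma$ are real smooth functions on $\mathbb R^2$, constant outside a bounded set, with $\epsilon_\infty\ge c_->0$, $\Delta\epsilon\ge\delta_->0$, $0<\tau_-\le\tau_D\le\tau_+$, $0\le\sigma\le\sigma_+$. $\eta\in C_c^\infty((-\frac12,\frac12))$, $\tau_h=\nu h$ with $\nu>0$ fixed and $0<h\ll1$, and $\eta_{\tau_h}(t)=\tau_h^{-1}\eta(t/\tau_h)$. The unknown is $\boldsymbol W=(H_x,H_y,E_z,P)^\top$, a $\mathbb C^4$-valued function of $t$ and $\boldsymbol x\in\mathbb R^2$. With $\epsilon_\Delta=\epsilon_0\Delta\epsilon(1+V_m)$, $$\Lambda=\begin{pmatrix}0&0&\partial_{x_2}&0\\0&0&-\partial_{x_1}&0\\ \partial_{x_2}&-\partial_{x_1}&0&0\\0&0&0&0\end{pmatrix},\quad A_V=\mathrm{diag}\Big(\mu,\mu,\epsilon_0\epsilon_\infty(1+V_m),\frac1{\epsilon_\Delta}\Big),$$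 $$B_V=\begin{pmatrix}0&0&0&0\\0&0&0&0\\0&0&\sigma(1+V_m)+\epsilon_0\epsilon_\infty\partial_tV_m+\frac{\epsilon_\Delta}{\tau_D}&-\frac1{\tau_D}\\0&0&-\frac1{\tau_D}&\frac1{\epsilon_\Delta\tau_D}\end{pmatrix},$$ and $A_0,B_0$ denote $A_V,B_V$ with $V_m=0$. $U_0(t)$ is the evolution group on $\mathcal H_{\rm v}=L^2(\mathbb R^2;\mathbb C^4)$ of the background equation $A_0\partial_t\boldsymbol W+\Lambda\boldsymbol W+B_0\boldsymbol W=0$. With $q_0=\frac{\sigma}{\epsilon_0\epsilon_\infty}+\frac{\Delta\epsilon}{\epsilon_\infty\tau_D}$, $\boldsymbol e_3=(0,0,1,0)^\top$, $\boldsymbol e_4=(0,0,0,1)^\top$, for a scalar function $u(t,\boldsymbol x)$, $$\boldsymbol{\mathcal F}_m[u]:=-\epsilon_0\epsilon_\infty\big[\partial_t(V_mu)+q_0V_mu\big]\boldsymbol e_3+\frac1{\tau_D}V_mu\,\boldsymbol e_4 .$$ *)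

theory Defs
  imports "HOL-Analysis.Analysis"
begin

(* Solutions with data in L2 are in general only differentiable in time with values in the
   extrapolation space H_{-1} of the background generator G = -A_0^{-1}(Lambda + B_0), that is, the
   dual of D(Lambda) = D(G) = D(G^T).  Everything below is therefore expressed in H_{-1}: its
   elements are functionals phi |-> <F, phi> on D(Lambda), an L2 field f being identified with
   phi |-> integral of f . phi.  The pairing is bilinear (no complex conjugation), as usual for
   distributions.  Where the objects are L2 valued (e.g. for data in D(Lambda)), an identity of
   functionals on the dense subspace D(Lambda) is an identity in L2. *)

subsection \<open>Smooth functions\<close>

definition pd :: "'a::euclidean_space \<Rightarrow> ('a \<Rightarrow> 'b::real_normed_vector) \<Rightarrow> 'a \<Rightarrow> 'b" where
  "pd b f x = frechet_derivative f (at x) b"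

definition Cinf :: "('a::euclidean_space \<Rightarrow> 'b::real_normed_vector) \<Rightarrow> bool" where
  "Cinf f \<longleftrightarrow> (\<forall>bs \<in> lists Basis. foldr pd bs f differentiable_on UNIV)"

abbreviation D1 :: "(real^2 \<Rightarrow> 'b::real_normed_vector) \<Rightarrow> real^2 \<Rightarrow> 'b" where
  "D1 \<equiv> pd (axis 1 1)"

abbreviation D2 :: "(real^2 \<Rightarrow> 'b::real_normed_vector) \<Rightarrow> real^2 \<Rightarrow> 'b" where
  "D2 \<equiv> pd (axis 2 1)"

subsection \<open>Square integrable fields and functionals\<close>

type_synonym field = "real^2 \<Rightarrow> complex^4"
type_synonym functional = "field \<Rightarrow> complex"

definition L2 :: "field set" where
  "L2 = {f. f \<in> borel_measurable lborel \<and> integrable lborel (\<lambda>x. (norm (f x))\<^sup>2)}"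

definition L2norm :: "field \<Rightarrow> real" where
  "L2norm f = sqrt (\<integral>x. (norm (f x))\<^sup>2 \<partial>lborel)"

definition pairing :: "field \<Rightarrow> functional" where
  "pairing f \<phi> = (\<integral>x. (\<Sum>i\<in>UNIV. f x $ i * \<phi> x $ i) \<partial>lborel)"

definition app :: "(real^2 \<Rightarrow> real^4^4) \<Rightarrow> field \<Rightarrow> field" where
  "app M f x = (\<chi> i j. complex_of_real (M x $ i $ j)) *v f x"

definition app_fun :: "(real^2 \<Rightarrow> real^4^4) \<Rightarrow> functional \<Rightarrow> functional" where
  "app_fun M F \<phi> = F (app (\<lambda>x. transpose (M x)) \<phi>)"

definition diag :: "real^4 \<Rightarrow> real^4^4" where
  "diag v = (\<chi> i j. if i = j then v $ i else 0)"

subsection \<open>The operator $\Lambda$\<close>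

definition Lam :: "field \<Rightarrow> field" where
  "Lam \<phi> x = vector
     [D2 (\<lambda>y. \<phi> y $ 3) x,
      - D1 (\<lambda>y. \<phi> y $ 3) x,
      D2 (\<lambda>y. \<phi> y $ 1) x - D1 (\<lambda>y. \<phi> y $ 2) x,
      0]"

definition weak_Lam :: "field \<Rightarrow> field \<Rightarrow> bool" where
  "weak_Lam f g \<longleftrightarrow> f \<in> L2 \<and> g \<in> L2 \<and>
     (\<forall>\<phi>. Cinf \<phi> \<and> bounded {x. \<phi> x \<noteq> 0} \<longrightarrow> pairing f (Lam \<phi>) = - pairing g \<phi>)"

definition dom_Lam :: "field set" where
  "dom_Lam = {f. \<exists>g. weak_Lam f g}"

definition Lam_dom :: "field \<Rightarrow> field" where
  "Lam_dom f = (SOME g. weak_Lam f g)"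

text \<open>The continuous extension of $\Lambda$ to a map from $L^2$ to functionals
  ($\Lambda$ is antisymmetric for the bilinear pairing).\<close>

definition Lam_ext :: "field \<Rightarrow> functional" where
  "Lam_ext f \<phi> = - pairing f (Lam_dom \<phi>)"

subsection \<open>Functional-valued calculus and extended operators\<close>

text \<open>Time derivatives are taken on $[0,\infty)$, hence one-sided at time 0.\<close>

definition dt_exists :: "(real \<Rightarrow> field) \<Rightarrow> real \<Rightarrow> bool" where
  "dt_exists X t \<longleftrightarrow>
     (\<forall>\<phi>\<in>dom_Lam. (\<lambda>s. pairing (X s) \<phi>) differentiable (at t within {0..}))"

definition dt :: "(real \<Rightarrow> field) \<Rightarrow> real \<Rightarrow> functional" where
  "dt X t \<phi> = vector_derivative (\<lambda>s. pairing (X s) \<phi>) (at t within {0..})"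

definition wint_exists :: "real \<Rightarrow> real \<Rightarrow> (real \<Rightarrow> functional) \<Rightarrow> bool" where
  "wint_exists a b F \<longleftrightarrow> (\<forall>\<phi>\<in>dom_Lam. (\<lambda>r. F r \<phi>) integrable_on {a..b})"

definition wint :: "real \<Rightarrow> real \<Rightarrow> (real \<Rightarrow> functional) \<Rightarrow> functional" where
  "wint a b F \<phi> = integral {a..b} (\<lambda>r. F r \<phi>)"

text \<open>The transpose of a bounded operator on $L^2$ with respect to the bilinear pairing, and the
  extension by duality of the operator to functionals.\<close>

definition transp :: "(field \<Rightarrow> field) \<Rightarrow> field \<Rightarrow> field" where
  "transp L \<phi> = (SOME \<psi>. \<psi> \<in> L2 \<and> (\<forall>f\<in>L2. pairing (L f) \<phi> = pairing f \<psi>))"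

definition ext :: "(field \<Rightarrow> field) \<Rightarrow> functional \<Rightarrow> functional" where
  "ext L F \<phi> = F (transp L \<phi>)"

subsection \<open>The medium, the modulation and the equation\<close>

record medium =
  mu :: real
  eps0 :: real
  eps_inf :: "real^2 \<Rightarrow> real"
  d_eps :: "real^2 \<Rightarrow> real"
  tau_D :: "real^2 \<Rightarrow> real"
  sigma :: "real^2 \<Rightarrow> real"

definition coefficient :: "(real^2 \<Rightarrow> real) \<Rightarrow> bool" where
  "coefficient f \<longleftrightarrow> Cinf f \<and> (\<exists>S c. bounded S \<and> (\<forall>x. x \<notin> S \<longrightarrow> f x = c))"

definition admissible_medium :: "medium \<Rightarrow> bool" where
  "admissible_medium M \<longleftrightarrow> mu M > 0 \<and> eps0 M > 0 \<and>
     coefficient (eps_inf M) \<and> coefficient (d_eps M) \<and>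
     coefficient (tau_D M) \<and> coefficient (sigma M) \<and>
     (\<exists>c>0. \<forall>x. c \<le> eps_inf M x) \<and>
     (\<exists>\<delta>>0. \<forall>x. \<delta> \<le> d_eps M x) \<and>
     (\<exists>a>0. \<exists>b. \<forall>x. a \<le> tau_D M x \<and> tau_D M x \<le> b) \<and>
     (\<exists>b. \<forall>x. 0 \<le> sigma M x \<and> sigma M x \<le> b)"

type_synonym modulation = "real \<Rightarrow> real^2 \<Rightarrow> real"

definition eps_D :: "medium \<Rightarrow> modulation \<Rightarrow> real \<Rightarrow> real^2 \<Rightarrow> real" where
  "eps_D M V t x = eps0 M * d_eps M x * (1 + V t x)"

definition A_mod :: "medium \<Rightarrow> modulation \<Rightarrow> real \<Rightarrow> real^2 \<Rightarrow> real^4^4" where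
  "A_mod M V t x =
     diag (vector [mu M, mu M, eps0 M * eps_inf M x * (1 + V t x), 1 / eps_D M V t x])"

definition B_mod :: "medium \<Rightarrow> modulation \<Rightarrow> real \<Rightarrow> real^2 \<Rightarrow> real^4^4" where
  "B_mod M V t x = vector
     [vector [0, 0, 0, 0],
      vector [0, 0, 0, 0],
      vector [0, 0,
              sigma M x * (1 + V t x) + eps0 M * eps_inf M x * deriv (\<lambda>s. V s x) t
                + eps_D M V t x / tau_D M x,
              - 1 / tau_D M x],
      vector [0, 0, - 1 / tau_D M x, 1 / (eps_D M V t x * tau_D M x)]]"

abbreviation no_mod :: modulation where
  "no_mod \<equiv> \<lambda>t x. 0"

definition A0 :: "medium \<Rightarrow> real^2 \<Rightarrow> real^4^4" where
  "A0 M = A_mod M no_mod 0"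

definition B0 :: "medium \<Rightarrow> real^2 \<Rightarrow> real^4^4" where
  "B0 M = B_mod M no_mod 0"

definition A0_inv :: "medium \<Rightarrow> real^2 \<Rightarrow> real^4^4" where
  "A0_inv M x = matrix_inv (A0 M x)"

text \<open>Solutions in $C([0,\infty);L^2)$: the equation $A\,\partial_t W+\Lambda W+BW=0$ holds at every
  time $t\ge 0$ as an identity of functionals on the domain of $\Lambda$.\<close>

definition solution ::
  "(real \<Rightarrow> real^2 \<Rightarrow> real^4^4) \<Rightarrow> (real \<Rightarrow> real^2 \<Rightarrow> real^4^4) \<Rightarrow> field \<Rightarrow> (real \<Rightarrow> field) \<Rightarrow> bool"
where
  "solution A B w0 W \<longleftrightarrow>
     (AE x in lborel. W 0 x = w0 x) \<and>
     (\<forall>t\<ge>0. W t \<in> L2 \<and> ((\<lambda>s. L2norm (\<lambda>x. W s x - W t x)) \<longlongrightarrow> 0) (at t within {0..})) \<and>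
     (\<forall>t\<ge>0. dt_exists W t \<and>
       (\<forall>\<phi>\<in>dom_Lam.
          app_fun (A t) (dt W t) \<phi> + Lam_ext (W t) \<phi> + pairing (app (B t) (W t)) \<phi> = 0))"

text \<open>Strongly continuous groups on $L^2$ whose orbits solve the background equation.  Strong
  continuity is part of \<open>solution\<close>; the group law carries it, and the equation, over to negative
  times.  The locally uniform bound is the usual consequence of the uniform boundedness principle.
  Operators act on representatives, so the algebraic laws hold almost everywhere.\<close>

definition background_group :: "medium \<Rightarrow> (real \<Rightarrow> field \<Rightarrow> field) \<Rightarrow> bool" where
  "background_group M U \<longleftrightarrow>
     (\<forall>t. \<forall>f\<in>L2. U t f \<in> L2) \<and>
     (\<forall>t. \<forall>f\<in>L2. \<forall>g\<in>L2. \<forall>c. AE x in lborel. U t (\<lambda>y. c *s f y + g y) x = c *s U t f x + U t g x) \<and>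
     (\<forall>R. \<exists>C. \<forall>t. \<bar>t\<bar> \<le> R \<longrightarrow> (\<forall>f\<in>L2. L2norm (U t f) \<le> C * L2norm f)) \<and>
     (\<forall>s t. \<forall>f\<in>L2. AE x in lborel. U (s + t) f x = U s (U t f) x) \<and>
     (\<forall>f\<in>L2. solution (\<lambda>t. A0 M) (\<lambda>t. B0 M) f (\<lambda>t. U t f))"

subsection \<open>Time reversal\<close>

definition eta_sc :: "(real \<Rightarrow> real) \<Rightarrow> real \<Rightarrow> real \<Rightarrow> real" where
  "eta_sc \<eta> \<tau> t = \<eta> (t / \<tau>) / \<tau>"

definition V_mod :: "(real \<Rightarrow> real) \<Rightarrow> real \<Rightarrow> real \<Rightarrow> (real^2 \<Rightarrow> real) \<Rightarrow> modulation" where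
  "V_mod \<eta> \<tau> T m t x = eta_sc \<eta> \<tau> (t - T) * m x"

definition Gam :: "real^4^4" where
  "Gam = diag (vector [-1, -1, 1, 1])"

definition q0 :: "medium \<Rightarrow> real^2 \<Rightarrow> real" where
  "q0 M x = sigma M x / (eps0 M * eps_inf M x) + d_eps M x / (eps_inf M x * tau_D M x)"

definition Vu_e3 :: "modulation \<Rightarrow> (real \<Rightarrow> real^2 \<Rightarrow> complex) \<Rightarrow> real \<Rightarrow> field" where
  "Vu_e3 V u t x = axis 3 (complex_of_real (V t x) * u t x)"

definition F_mod ::
  "medium \<Rightarrow> modulation \<Rightarrow> (real \<Rightarrow> real^2 \<Rightarrow> complex) \<Rightarrow> real \<Rightarrow> functional" where
  "F_mod M V u t \<phi> =
     - app_fun (\<lambda>x. mat (eps0 M * eps_inf M x))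
         (\<lambda>\<psi>. dt (Vu_e3 V u) t \<psi> + pairing (\<lambda>x. complex_of_real (q0 M x) *s Vu_e3 V u t x) \<psi>) \<phi>
     + pairing (\<lambda>x. axis 4 (complex_of_real (V t x / tau_D M x) * u t x)) \<phi>"

definition rev_integrand ::
  "(real \<Rightarrow> field \<Rightarrow> field) \<Rightarrow> (real \<Rightarrow> real) \<Rightarrow> real \<Rightarrow> real \<Rightarrow> (real^2 \<Rightarrow> real) \<Rightarrow> (real \<Rightarrow> field)
    \<Rightarrow> real \<Rightarrow> real \<Rightarrow> functional" where
  "rev_integrand U \<eta> \<tau> T m W0 t r \<phi> =
     eta_sc \<eta> \<tau> (r - T) * ext (U (t - r)) (app_fun (\<lambda>x. m x *\<^sub>R Gam) (dt W0 r)) \<phi>"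

definition w_rev ::
  "(real \<Rightarrow> field \<Rightarrow> field) \<Rightarrow> (real \<Rightarrow> real) \<Rightarrow> real \<Rightarrow> real \<Rightarrow> (real^2 \<Rightarrow> real) \<Rightarrow> (real \<Rightarrow> field)
    \<Rightarrow> real \<Rightarrow> functional" where
  "w_rev U \<eta> \<tau> T m W0 t \<phi> = 1/2 * wint 0 t (rev_integrand U \<eta> \<tau> T m W0 t) \<phi>"

definition N_integrand1 ::
  "(real \<Rightarrow> field \<Rightarrow> field) \<Rightarrow> modulation \<Rightarrow> (real \<Rightarrow> field) \<Rightarrow> real \<Rightarrow> real \<Rightarrow> functional" where
  "N_integrand1 U V W0 t r = ext (U (t - r)) (app_fun (\<lambda>x. mat (V r x)) (dt W0 r))"

definition N_integrand2 ::
  "(real \<Rightarrow> field \<Rightarrow> field) \<Rightarrow> (real \<Rightarrow> real) \<Rightarrow> real \<Rightarrow> real \<Rightarrow> (real^2 \<Rightarrow> real)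
    \<Rightarrow> (real \<Rightarrow> real^2 \<Rightarrow> complex) \<Rightarrow> real \<Rightarrow> real \<Rightarrow> functional" where
  "N_integrand2 U \<eta> \<tau> T m E0 t r \<phi> =
     eta_sc \<eta> \<tau> (r - T) *
     pairing (U (t - r)
       (\<lambda>x. vector [complex_of_real (D2 m x) * E0 r x, - (complex_of_real (D1 m x) * E0 r x), 0, 0])) \<phi>"

definition N_integrand3 ::
  "medium \<Rightarrow> (real \<Rightarrow> field \<Rightarrow> field) \<Rightarrow> modulation \<Rightarrow> (real \<Rightarrow> real^2 \<Rightarrow> complex)
    \<Rightarrow> real \<Rightarrow> real \<Rightarrow> functional" where
  "N_integrand3 M U V u t r = ext (U (t - r)) (app_fun (A0_inv M) (F_mod M V u r))"

definition N_rem ::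
  "medium \<Rightarrow> (real \<Rightarrow> field \<Rightarrow> field) \<Rightarrow> (real \<Rightarrow> real) \<Rightarrow> real \<Rightarrow> real \<Rightarrow> (real^2 \<Rightarrow> real)
    \<Rightarrow> (real \<Rightarrow> field) \<Rightarrow> (real \<Rightarrow> field) \<Rightarrow> real \<Rightarrow> functional" where
  "N_rem M U \<eta> \<tau> T m W0 W t \<phi> =
     - 1/2 * wint 0 t (N_integrand1 U (V_mod \<eta> \<tau> T m) W0 t) \<phi>
     + 1 / complex_of_real (mu M) * wint 0 t (N_integrand2 U \<eta> \<tau> T m (\<lambda>r x. W0 r x $ 3) t) \<phi>
     + wint 0 t
         (N_integrand3 M U (V_mod \<eta> \<tau> T m) (\<lambda>r x. W r x $ 3 - W0 r x $ 3) t) \<phi>"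

definition K_integrand ::
  "(real \<Rightarrow> field \<Rightarrow> field) \<Rightarrow> (real \<Rightarrow> real) \<Rightarrow> real \<Rightarrow> real \<Rightarrow> (real^2 \<Rightarrow> real) \<Rightarrow> functional
    \<Rightarrow> real \<Rightarrow> functional" where
  "K_integrand U \<eta> \<tau> T m Y s \<phi> =
     eta_sc \<eta> \<tau> s * ext (U (T - s)) (app_fun (\<lambda>x. m x *\<^sub>R Gam) (ext (U (T + s)) Y)) \<phi>"

definition K_op ::
  "(real \<Rightarrow> field \<Rightarrow> field) \<Rightarrow> (real \<Rightarrow> real) \<Rightarrow> real \<Rightarrow> real \<Rightarrow> (real^2 \<Rightarrow> real) \<Rightarrow> functional \<Rightarrow> functional"
where
  "K_op U \<eta> \<tau> T m Y \<phi> = 1/2 * wint (- \<tau>/2) (\<tau>/2) (K_integrand U \<eta> \<tau> T m Y) \<phi>"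

end

theory Submission
  imports Defs
begin

text \<open>The transpose of the background group with respect to the bilinear pairing is explicit: \<open>\<Gamma>\<close>
  anticommutes with \<open>\<Lambda>\<close> and commutes with \<open>A\<^sub>0\<close> and \<open>B\<^sub>0\<close>, so \<open>U\<^sub>0(t)\<^sup>T = A\<^sub>0 \<Gamma> U\<^sub>0(t) \<Gamma> A\<^sub>0\<^sup>-\<^sup>1\<close>.
  Hence \<open>U\<^sub>0(t)\<^sup>T\<close> preserves the domain of \<open>\<Lambda>\<close> and is strongly differentiable there, with derivative
  \<open>H U\<^sub>0(t)\<^sup>T\<close>, \<open>H = \<Lambda> A\<^sub>0\<^sup>-\<^sup>1 - B\<^sub>0 A\<^sub>0\<^sup>-\<^sup>1\<close>. All identities are therefore tested with \<open>\<psi>(r) = U\<^sub>0(t - r)\<^sup>T \<phi>\<close>,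
  \<open>\<phi>\<close> in the domain of \<open>\<Lambda>\<close>.
  Differentiating \<open>\<langle>W(r) - W\<^sub>0(r), \<psi>(r)\<rangle>\<close> gives the Duhamel formula with source \<open>F\<^sub>m[E\<^sub>z\<^sup>m]\<close>, and
  differentiating \<open>\<langle>V\<^sub>m E\<^sub>z\<^sup>0 e\<^sub>3, \<psi>(r)\<rangle>\<close>, whose boundary terms vanish because \<open>V\<^sub>m\<close> vanishes at the times
  0 and \<open>t\<close>, replaces \<open>F\<^sub>m[E\<^sub>z\<^sup>0]\<close> by \<open>\<Lambda>(V\<^sub>m E\<^sub>z\<^sup>0 e\<^sub>3)\<close>. The magnetic rows of the background equation express
  the latter through \<open>\<partial>\<^sub>r W\<^sub>0\<close> and the gradient of \<open>m\<close>.\<close>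

section \<open>Smooth functions\<close>

text \<open>The obstacle is regularity. For data in L2 the solution and the background are in
  general differentiable in time only weakly, and two weakly differentiable paths have no product
  rule. One factor of every pairing must therefore be strongly differentiable, and transposed orbits
  of domain elements are. This has to be earned, since \<open>transp\<close> merely picks some
  transpose: a candidate is written down by conjugation with \<Gamma>, averaging shows that it is
  the transpose, and its regularity follows from duality. The quotient \<open>l2\<close> supplies
  the Banach space in which these derivatives and integrals live. The factor 1/2 and \<Gamma> have
  one origin: half of (m \<Gamma> - m) \<partial>_r W_0 keeps only the magnetic components of - m
  \<partial>_r W_0. By the magnetic rows these are m times derivatives of E_z^0, divided by \<mu>,
  and the gradient term of N_m completes them to derivatives of m E_z^0, that is, to A_0^{-1}
  \<Lambda> (m E_z^0 e_3).\<close>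

primrec Cn :: "nat \<Rightarrow> ('a::euclidean_space \<Rightarrow> 'b::real_normed_vector) \<Rightarrow> bool" where
  "Cn 0 f \<longleftrightarrow> f differentiable_on UNIV"
| "Cn (Suc n) f \<longleftrightarrow> f differentiable_on UNIV \<and> (\<forall>b\<in>Basis. Cn n (pd b f))"

text \<open>Grading \<open>Cinf\<close> by order opens the closure properties to induction: the
  derivative of a product, an inverse or an exponential is built from terms one level lower. Level
  \<open>n\<close> permits \<open>n\<close> partial derivatives, each result still being
  differentiable.\<close>

lemma Cn_iff_foldr:
  "Cn n f \<longleftrightarrow> (\<forall>bs\<in>lists Basis. length bs \<le> n \<longrightarrow> foldr pd bs f differentiable_on UNIV)"
proof (induction n arbitrary: f)
  case 0
  then show ?case by auto
next
  case (Suc n)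
  show ?case
  proof
    assume L: "Cn (Suc n) f"
    show "\<forall>bs\<in>lists Basis. length bs \<le> Suc n \<longrightarrow> foldr pd bs f differentiable_on UNIV"
    proof (intro ballI impI)
      fix bs :: "'a list" assume bs: "bs \<in> lists Basis" "length bs \<le> Suc n"
      \<comment> \<open>\<open>foldr\<close> applies the last direction first, so the recursion of
        \<open>Cn\<close> strips the list from its end.\<close>
      show "foldr pd bs f differentiable_on UNIV"
        using bs L Suc by (cases bs rule: rev_cases) auto
    qed
  next
    assume R: "\<forall>bs\<in>lists Basis. length bs \<le> Suc n \<longrightarrow> foldr pd bs f differentiable_on UNIV"
    have "Cn n (pd b f)" if "b \<in> Basis" for b
      unfolding Suc
    proof (intro ballI impI)
      fix bs :: "'a list" assume "bs \<in> lists Basis" "length bs \<le> n"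
      then show "foldr pd bs (pd b f) differentiable_on UNIV"
        using R[rule_format, of "bs @ [b]"] that by auto
    qed
    moreover have "f differentiable_on UNIV" using R[rule_format, of "[]"] by simp
    ultimately show "Cn (Suc n) f" by simp
  qed
qed

lemma Cinf_iff_Cn: "Cinf f \<longleftrightarrow> (\<forall>n. Cn n f)"
  unfolding Cinf_def Cn_iff_foldr by blast

lemma Cn_differentiable_on: "Cn n f \<Longrightarrow> f differentiable_on UNIV"
  by (cases n) auto

lemma Cn_SucD: "Cn (Suc n) f \<Longrightarrow> Cn n f"
  by (auto simp: Cn_iff_foldr)

lemma Cinf_differentiable: "Cinf f \<Longrightarrow> f differentiable (at x)"
  using Cn_differentiable_on[of 0 f] by (simp add: Cinf_iff_Cn differentiable_on_def)

lemma Cinf_has_derivative: "Cinf f \<Longrightarrow> (f has_derivative (\<lambda>h. frechet_derivative f (at x) h)) (at x)"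
  using Cinf_differentiable frechet_derivative_works by auto

lemma Cinf_continuous_on: "Cinf f \<Longrightarrow> continuous_on S f"
  using Cinf_differentiable
  by (metis continuous_at_imp_continuous_on differentiable_imp_continuous_within)

lemma Cinf_measurable: "Cinf f \<Longrightarrow> f \<in> borel_measurable borel"
  by (intro borel_measurable_continuous_onI Cinf_continuous_on)

lemma Cinf_pd: "Cinf f \<Longrightarrow> b \<in> Basis \<Longrightarrow> Cinf (pd b f)"
  unfolding Cinf_iff_Cn using Cn.simps(2) by blast

lemma pd_eq: "(f has_derivative f') (at x) \<Longrightarrow> pd b f x = f' b"
  unfolding pd_def using frechet_derivative_at by metis

lemma Cn_has_derivative:
  "Cn n f \<Longrightarrow> (f has_derivative (\<lambda>h. frechet_derivative f (at x) h)) (at x)"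
  by (metis Cn_differentiable_on UNIV_I differentiable_on_def frechet_derivative_works eta_contract_eq)

lemma Cn_const [simp]: "Cn n (\<lambda>x. c)"
proof (induction n arbitrary: c)
  case (Suc n)
  have "pd b (\<lambda>x. c) = (\<lambda>x. 0)" for b :: 'a by (rule ext) (auto intro: pd_eq)
  with Suc show ?case by simp
qed simp

lemma Cn_linear:
  assumes "bounded_linear L"
  shows "Cn n f \<Longrightarrow> Cn n (\<lambda>x. L (f x))"
proof (induction n arbitrary: f)
  case 0
  show ?case
    using bounded_linear.has_derivative[OF assms Cn_has_derivative[OF 0]]
    by (auto simp: differentiable_on_def differentiable_def)
next
  case (Suc n)
  have "pd b (\<lambda>x. L (f x)) = (\<lambda>x. L (pd b f x))" for b
    using bounded_linear.has_derivative[OF assms Cn_has_derivative[OF Suc.prems]]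
    by (intro ext pd_eq[THEN trans]) (auto simp: pd_def)
  moreover have "(\<lambda>x. L (f x)) differentiable_on UNIV"
    using bounded_linear.has_derivative[OF assms Cn_has_derivative[OF Suc.prems]]
    by (auto simp: differentiable_on_def differentiable_def)
  ultimately show ?case using Suc by simp
qed

lemma Cn_add: "Cn n f \<Longrightarrow> Cn n g \<Longrightarrow> Cn n (\<lambda>x. f x + g x)"
proof (induction n arbitrary: f g)
  case 0
  then show ?case by (auto simp: differentiable_on_def)
next
  case (Suc n)
  note d = has_derivative_add[OF Cn_has_derivative[OF Suc.prems(1)] Cn_has_derivative[OF Suc.prems(2)]]
  have "pd b (\<lambda>x. f x + g x) = (\<lambda>x. pd b f x + pd b g x)" for b
    by (intro ext pd_eq[OF d, THEN trans]) (auto simp: pd_def)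
  moreover have "(\<lambda>x. f x + g x) differentiable_on UNIV"
    using d by (auto simp: differentiable_on_def differentiable_def)
  ultimately show ?case using Suc by simp
qed

lemma Cn_bilinear:
  assumes B: "bounded_bilinear B"
  shows "Cn n f \<Longrightarrow> Cn n g \<Longrightarrow> Cn n (\<lambda>x. B (f x) (g x))"
proof (induction n arbitrary: f g)
  case 0
  note d = bounded_bilinear.FDERIV[OF B Cn_has_derivative[OF 0(1)] Cn_has_derivative[OF 0(2)]]
  show ?case using d by (auto simp: differentiable_on_def differentiable_def)
next
  case (Suc n)
  note d = bounded_bilinear.FDERIV[OF B Cn_has_derivative[OF Suc.prems(1)] Cn_has_derivative[OF Suc.prems(2)]]
  have "pd b (\<lambda>x. B (f x) (g x)) = (\<lambda>x. B (f x) (pd b g x) + B (pd b f x) (g x))" for b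
    by (intro ext pd_eq[OF d, THEN trans]) (auto simp: pd_def)
  moreover have "(\<lambda>x. B (f x) (g x)) differentiable_on UNIV"
    using d by (auto simp: differentiable_on_def differentiable_def)
  ultimately show ?case using Suc.prems Suc.prems[THEN Cn_SucD]
    by (auto intro!: Cn_add Suc.IH)
qed

lemma Cn_inverse:
  fixes f :: "'a::euclidean_space \<Rightarrow> real"
  assumes nz: "\<And>x. f x \<noteq> 0"
  shows "Cn n f \<Longrightarrow> Cn n (\<lambda>x. inverse (f x))"
proof (induction n)
  case 0
  then show ?case using nz by (auto simp: differentiable_on_def)
next
  case (Suc n)
  note d = Deriv.has_derivative_inverse[OF nz Cn_has_derivative[OF Suc.prems]]
  have "pd b (\<lambda>x. inverse (f x)) = (\<lambda>x. - (inverse (f x) * pd b f x * inverse (f x)))" for b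
    by (intro ext pd_eq[OF d, THEN trans]) (auto simp: pd_def)
  moreover have "(\<lambda>x. inverse (f x)) differentiable_on UNIV"
    using d by (auto simp: differentiable_on_def differentiable_def)
  ultimately show ?case using Suc Suc.prems[THEN Cn_SucD]
    by (auto intro!: Cn_linear[OF bounded_linear_minus[OF bounded_linear_ident]]
        Cn_bilinear[OF bounded_bilinear_mult])
qed

lemma Cn_exp:
  fixes f :: "'a::euclidean_space \<Rightarrow> real"
  shows "Cn n f \<Longrightarrow> Cn n (\<lambda>x. exp (f x))"
proof (induction n)
  case 0
  note d = has_derivative_exp[OF Cn_has_derivative[OF 0]]
  show ?case using d by (auto simp: differentiable_on_def differentiable_def)
next
  case (Suc n)
  note d = has_derivative_exp[OF Cn_has_derivative[OF Suc.prems]]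
  have "pd b (\<lambda>x. exp (f x)) = (\<lambda>x. exp (f x) * pd b f x)" for b
    by (intro ext pd_eq[OF d, THEN trans]) (auto simp: pd_def)
  moreover have "(\<lambda>x. exp (f x)) differentiable_on UNIV"
    using d by (auto simp: differentiable_on_def differentiable_def)
  ultimately show ?case using Suc Suc.prems[THEN Cn_SucD]
    by (auto intro!: Cn_bilinear[OF bounded_bilinear_mult])
qed

lemma Cn_prod:
  fixes f :: "'i \<Rightarrow> 'a::euclidean_space \<Rightarrow> real"
  assumes "\<And>i. i \<in> I \<Longrightarrow> Cn n (f i)"
  shows "Cn n (\<lambda>x. \<Prod>i\<in>I. f i x)"
  using assms by (induction I rule: infinite_finite_induct)
    (auto intro!: Cn_bilinear[OF bounded_bilinear_mult])

lemma Cinf_const [simp]: "Cinf (\<lambda>x. c)"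
  by (simp add: Cinf_iff_Cn)

lemma Cinf_linear: "bounded_linear L \<Longrightarrow> Cinf f \<Longrightarrow> Cinf (\<lambda>x. L (f x))"
  by (simp add: Cinf_iff_Cn Cn_linear)

lemma Cinf_add: "Cinf f \<Longrightarrow> Cinf g \<Longrightarrow> Cinf (\<lambda>x. f x + g x)"
  by (simp add: Cinf_iff_Cn Cn_add)

lemma Cinf_bilinear: "bounded_bilinear B \<Longrightarrow> Cinf f \<Longrightarrow> Cinf g \<Longrightarrow> Cinf (\<lambda>x. B (f x) (g x))"
  by (simp add: Cinf_iff_Cn Cn_bilinear)

lemma Cinf_mult:
  fixes f :: "'a::euclidean_space \<Rightarrow> 'b::real_normed_algebra"
  shows "Cinf f \<Longrightarrow> Cinf g \<Longrightarrow> Cinf (\<lambda>x. f x * g x)"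
  by (rule Cinf_bilinear[OF bounded_bilinear_mult])

lemma Cinf_inverse:
  fixes f :: "'a::euclidean_space \<Rightarrow> real"
  shows "(\<And>x. f x \<noteq> 0) \<Longrightarrow> Cinf f \<Longrightarrow> Cinf (\<lambda>x. inverse (f x))"
  by (simp add: Cinf_iff_Cn Cn_inverse)

section \<open>Smooth bump functions\<close>

text \<open>The classical flat function \<open>exp (- 1 / x)\<close>, multiplied by powers of
  \<open>1 / x\<close> so that the family is closed under differentiation up to linear
  combinations.\<close>

definition flat :: "nat \<Rightarrow> real \<Rightarrow> real" where
  "flat k x = (if x > 0 then inverse x ^ k * exp (- inverse x) else 0)"

lemma flat_tendsto_0: "((\<lambda>x. flat k x) \<longlongrightarrow> 0) (at_right 0)"
proof -
  have "((\<lambda>y. y ^ k / exp y) \<longlongrightarrow> (0::real)) at_top" by (rule tendsto_power_div_exp_0)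
  then have "((\<lambda>x. inverse x ^ k / exp (inverse x)) \<longlongrightarrow> (0::real)) (at_right 0)"
    by (rule filterlim_compose) (rule filterlim_inverse_at_top_right)
  then show ?thesis
    by (rule Lim_transform_eventually)
      (auto simp: eventually_at_filter flat_def exp_minus field_simps)
qed

lemma flat_has_derivative:
  "(flat k has_real_derivative (flat (k + 2) x - real k * flat (k + 1) x)) (at x)"
proof -
  consider "x > 0" | "x < 0" | "x = 0" by linarith
  then show ?thesis
  proof cases
    case 1
    have "((\<lambda>x. inverse x ^ k * exp (- inverse x)) has_real_derivative
        (flat (k + 2) x - real k * flat (k + 1) x)) (at x)"
      using 1 by (auto intro!: derivative_eq_intros simp: flat_def)
        (cases k; simp add: field_simps power2_eq_square)
    then show ?thesis
      by (rule has_field_derivative_transform_within_open[where S="{0<..}"])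
        (use 1 in \<open>auto simp: flat_def\<close>)
  next
    case 2
    have "((\<lambda>x. 0) has_real_derivative (flat (k + 2) x - real k * flat (k + 1) x)) (at x)"
      using 2 by (auto simp: flat_def)
    then show ?thesis
      by (rule has_field_derivative_transform_within_open[where S="{..<0}"])
        (use 2 in \<open>auto simp: flat_def\<close>)
  next
    case 3
    have "((\<lambda>h. (flat k h - 0) / (h - 0)) \<longlongrightarrow> 0) (at 0)"
      unfolding filterlim_at_split
    proof
      show "((\<lambda>h. (flat k h - 0) / (h - 0)) \<longlongrightarrow> 0) (at_left 0)"
        by (rule Lim_transform_eventually[OF tendsto_const])
          (auto simp: eventually_at_filter flat_def)
      \<comment> \<open>For \<open>h > 0\<close> the quotient is
        \<open>flat (Suc k) h\<close>.\<close>
      show "((\<lambda>h. (flat k h - 0) / (h - 0)) \<longlongrightarrow> 0) (at_right 0)"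
        by (rule Lim_transform_eventually[OF flat_tendsto_0[of "Suc k"]])
          (auto simp: eventually_at_filter flat_def field_simps)
    qed
    then show ?thesis using 3
      by (simp add: has_field_derivative_iff flat_def)
  qed
qed

lemma Cn_flat_affine:
  fixes v :: "'a::euclidean_space"
  shows "Cn n (\<lambda>x. flat k (c + x \<bullet> v))"
proof (induction n arbitrary: k)
  case 0
  show ?case unfolding Cn.simps differentiable_on_def differentiable_def
    using has_derivative_compose[OF _ flat_has_derivative[unfolded has_field_derivative_def]]
    by (auto intro!: exI derivative_eq_intros has_derivative_compose[OF _ flat_has_derivative[unfolded has_field_derivative_def]])
next
  case (Suc n)
  have d: "((\<lambda>x. flat k (c + x \<bullet> v)) has_derivative
      (\<lambda>h. (flat (k + 2) (c + x \<bullet> v) - real k * flat (k + 1) (c + x \<bullet> v)) * (h \<bullet> v))) (at x)" for x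
    by (rule has_derivative_compose[OF _ flat_has_derivative[unfolded has_field_derivative_def]])
      (auto intro!: derivative_eq_intros)
  have "pd b (\<lambda>x. flat k (c + x \<bullet> v)) = (\<lambda>x. (b \<bullet> v) * flat (k + 2) (c + x \<bullet> v)
      + (- real k * (b \<bullet> v)) * flat (k + 1) (c + x \<bullet> v))" for b
    by (intro ext pd_eq[OF d, THEN trans]) (auto simp: algebra_simps)
  moreover have "(\<lambda>x. flat k (c + x \<bullet> v)) differentiable_on UNIV"
    using d by (auto simp: differentiable_on_def differentiable_def)
  ultimately show ?case
    by (simp only: Cn.simps) (intro conjI ballI Cn_add Cn_bilinear[OF bounded_bilinear_mult] Cn_const Suc; simp)
qed

text \<open>A product of flat functions of the distances to the faces of the box. Both arguments
  have the shape \<open>c + x \<bullet> v\<close> of \<open>Cn_flat_affine\<close>.\<close>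

definition bump :: "'a::euclidean_space \<Rightarrow> 'a \<Rightarrow> 'a \<Rightarrow> real" where
  "bump a b x = (\<Prod>i\<in>Basis. flat 0 (- (a \<bullet> i) + x \<bullet> i) * flat 0 (b \<bullet> i + x \<bullet> (- i)))"

lemma Cinf_bump: "Cinf (bump a b)"
  unfolding Cinf_iff_Cn bump_def[abs_def]
  by (intro allI Cn_prod Cn_bilinear[OF bounded_bilinear_mult] Cn_flat_affine)

lemma bump_pos: "x \<in> box a b \<Longrightarrow> bump a b x > 0"
  unfolding bump_def by (intro prod_pos) (auto simp: box_def flat_def)

lemma bump_0: "x \<notin> box a b \<Longrightarrow> bump a b x = 0"
  unfolding bump_def by (subst prod_zero_iff) (auto simp: box_def flat_def)

lemma Cinf_bump_indicator:
  "Cinf (\<lambda>x. 1 - exp (- real k * bump a b x))"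
proof -
  have "Cinf (\<lambda>x. - exp (- real k * bump a b x))"
    using Cinf_bump[of a b] unfolding Cinf_iff_Cn
    by (auto intro!: Cn_linear[OF bounded_linear_minus[OF bounded_linear_ident]] Cn_exp
        Cn_bilinear[OF bounded_bilinear_mult])
  from Cinf_add[OF Cinf_const[of 1] this] show ?thesis by simp
qed

lemma bump_indicator_tendsto:
  "(\<lambda>k. 1 - exp (- real k * bump a b x)) \<longlonglongrightarrow> indicator (box a b) x"
proof (cases "x \<in> box a b")
  case True
  have "((\<lambda>k. exp (- bump a b x) ^ k) \<longlonglongrightarrow> 0)"
    using bump_pos[OF True] by (intro LIMSEQ_realpow_zero) auto
  then have "((\<lambda>k. exp (- real k * bump a b x)) \<longlonglongrightarrow> 0)"
    by (simp add: exp_of_nat_mult[symmetric])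
  from tendsto_diff[OF tendsto_const[of 1] this] True show ?thesis by simp
qed (simp add: bump_0)

lemma bump_indicator_bounds:
  "\<bar>1 - exp (- real k * bump a b x)\<bar> \<le> indicator (box a b) x"
proof (cases "x \<in> box a b")
  case True
  with bump_pos[OF True] show ?thesis by auto
qed (simp add: bump_0)

section \<open>Test functions\<close>

lemma pd_eq_0_open:
  assumes "open S" "x \<in> S" "\<And>y. y \<in> S \<Longrightarrow> f y = c"
  shows "pd b f x = 0"
proof -
  have "(f has_derivative (\<lambda>h. 0)) (at x)"
    by (rule has_derivative_transform_within_open[OF has_derivative_const assms(1,2)])
      (simp add: assms(3))
  from pd_eq[OF this] show ?thesis .
qed

lemma pd_eq_0_outside:
  fixes f :: "'a::euclidean_space \<Rightarrow> 'b::real_normed_vector"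
  assumes "\<And>y. norm y > R \<Longrightarrow> f y = c" "norm x > R"
  shows "pd b f x = 0"
  by (rule pd_eq_0_open[of "- cball 0 R"]) (use assms in auto)

lemma bounded_supportE:
  fixes f :: "'a::euclidean_space \<Rightarrow> 'b::zero"
  assumes "bounded {x. f x \<noteq> 0}"
  obtains R where "R > 0" "\<And>x. norm x > R \<Longrightarrow> f x = 0"
proof -
  from assms obtain R where "\<And>x. f x \<noteq> 0 \<Longrightarrow> norm x \<le> R" unfolding bounded_iff by blast
  then show ?thesis using that[of "max R 1"] by fastforce
qed

lemma bounded_supportI:
  fixes f :: "'a::euclidean_space \<Rightarrow> 'b::zero"
  assumes "\<And>x. norm x > R \<Longrightarrow> f x = 0"
  shows "bounded {x. f x \<noteq> 0}"
  unfolding bounded_iff using assms not_le by blast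

lemma compact_support_integrable:
  fixes f :: "'a::euclidean_space \<Rightarrow> 'b::{banach, second_countable_topology}"
  assumes "continuous_on UNIV f" "bounded {x. f x \<noteq> 0}"
  shows "integrable lborel f"
proof -
  obtain R where R: "\<And>x. norm x > R \<Longrightarrow> f x = 0" using bounded_supportE[OF assms(2)] by blast
  have "integrable lborel (\<lambda>x. indicator (cball 0 R) x *\<^sub>R f x)"
    using assms(1) by (intro borel_integrable_compact) (auto intro: continuous_on_subset)
  moreover have "(\<lambda>x. indicator (cball 0 R) x *\<^sub>R f x) = f"
    using R by (intro ext) (auto simp: indicator_def)
  ultimately show ?thesis by simp
qed

lemma compact_support_norm_bounded:
  fixes f :: "'a::euclidean_space \<Rightarrow> 'b::real_normed_vector"
  assumes "continuous_on UNIV f" "\<And>x. norm x > R \<Longrightarrow> f x = c"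
  obtains C where "C \<ge> 0" "\<And>x. norm (f x) \<le> C"
proof -
  have "compact (f ` cball 0 R)"
    using assms(1) by (intro compact_continuous_image) (auto intro: continuous_on_subset)
  then have "bounded (f ` cball 0 R)" by (rule compact_imp_bounded)
  then obtain C where C: "\<And>x. norm x \<le> R \<Longrightarrow> norm (f x) \<le> C"
    unfolding bounded_iff by (meson imageI mem_cball_0)
  have "norm (f x) \<le> max (max C (norm c)) 0" for x
    using C[of x] assms(2)[of x] by (cases "norm x \<le> R") auto
  then show ?thesis using that[of "max (max C (norm c)) 0"] by auto
qed

text \<open>Quotients are the form of the derivative that dominated convergence and the product rule
  with one weak factor can use. The set \<open>S\<close> allows one-sided derivatives at time
  0.\<close>

lemma has_vector_derivative_iff_quotient:
  "(f has_vector_derivative D) (at a within S) \<longleftrightarrow> ((\<lambda>t. (f t - f a) /\<^sub>R (t - a)) \<longlongrightarrow> D) (at a within S)"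
proof -
  have eq: "norm ((1 / norm (t - a)) *\<^sub>R (f t - (f a + (t - a) *\<^sub>R D))) = norm ((f t - f a) /\<^sub>R (t - a) - D)"
    if "t \<noteq> a" for t
  proof -
    have "(f t - f a) /\<^sub>R (t - a) - D = (f t - (f a + (t - a) *\<^sub>R D)) /\<^sub>R (t - a)"
      using that by (simp add: scaleR_right_diff_distrib scaleR_right_distrib)
    then show ?thesis by (simp only: norm_scaleR) (simp add: divide_inverse)
  qed
  have "(f has_vector_derivative D) (at a within S) \<longleftrightarrow>
      ((\<lambda>t. norm ((1 / norm (t - a)) *\<^sub>R (f t - (f a + (t - a) *\<^sub>R D)))) \<longlongrightarrow> 0) (at a within S)"
    unfolding has_vector_derivative_def has_derivative_within
    by (simp only: tendsto_norm_zero_iff bounded_linear_scaleR_left simp_thms)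
  also have "\<dots> \<longleftrightarrow> ((\<lambda>t. norm ((f t - f a) /\<^sub>R (t - a) - D)) \<longlongrightarrow> 0) (at a within S)"
    by (intro filterlim_cong refl) (use eq in \<open>auto simp only: eventually_at_filter intro!: always_eventually\<close>)
  also have "\<dots> \<longleftrightarrow> ((\<lambda>t. (f t - f a) /\<^sub>R (t - a)) \<longlongrightarrow> D) (at a within S)"
    by (simp only: tendsto_norm_zero_iff Lim_null[symmetric])
  finally show ?thesis .
qed

text \<open>The difference quotients in direction \<open>b\<close> have vanishing integral by translation invariance
  and are dominated because \<open>f\<close> is Lipschitz; this avoids Fubini.\<close>

lemma integral_pd_eq_0:
  fixes f :: "'a::euclidean_space \<Rightarrow> 'b::{banach, second_countable_topology}"
  assumes f: "Cinf f" "bounded {x. f x \<noteq> 0}" and b: "b \<in> Basis"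
  shows "(\<integral>x. pd b f x \<partial>lborel) = 0"
proof -
  obtain R where R: "R > 0" "\<And>x. norm x > R \<Longrightarrow> f x = 0" using bounded_supportE[OF f(2)] by blast
  have R': "pd b f x = 0" if "norm x > R" for x
    using pd_eq_0_outside[of R f 0] R that by blast
  obtain C where C: "C \<ge> 0" "\<And>x. norm (pd b f x) \<le> C"
    using compact_support_norm_bounded[OF Cinf_continuous_on[OF Cinf_pd[OF f(1) b]] R'] by blast
  have der: "((\<lambda>t. f (x + t *\<^sub>R b)) has_derivative (\<lambda>h. h *\<^sub>R pd b f (x + t *\<^sub>R b))) (at t within S)"
    for x t S
  proof -
    have "((\<lambda>t. f (x + t *\<^sub>R b)) has_derivative (\<lambda>h. frechet_derivative f (at (x + t *\<^sub>R b)) (h *\<^sub>R b)))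
        (at t within S)"
      by (rule has_derivative_compose[OF _ Cinf_has_derivative[OF f(1)]])
        (auto intro!: derivative_eq_intros)
    moreover have "frechet_derivative f (at y) (h *\<^sub>R b) = h *\<^sub>R pd b f y" for y h
      unfolding pd_def
      by (rule linear_scale) (use Cinf_has_derivative[OF f(1), of y] in \<open>auto dest: has_derivative_linear\<close>)
    ultimately show ?thesis by simp
  qed
  have lip: "norm (f (x + t *\<^sub>R b) - f x) \<le> C * t" if "t \<ge> 0" for x t
  proof -
    have "norm (f (x + t *\<^sub>R b) - f (x + 0 *\<^sub>R b)) \<le> C * norm (t - 0)"
    proof (rule differentiable_bound[OF _ der])
      show "convex (UNIV :: real set)" by simp
      show "onorm (\<lambda>h. h *\<^sub>R pd b f (x + s *\<^sub>R b)) \<le> C" for s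
        by (rule onorm_le) (simp add: C(2) mult_right_mono mult.commute[of _ "norm (pd b f (x + s *\<^sub>R b))"])
    qed auto
    then show ?thesis using that by simp
  qed
  have int: "integrable lborel f"
    using f by (intro compact_support_integrable Cinf_continuous_on)
  have intt: "integrable lborel (\<lambda>x. f (x + c))" "(\<integral>x. f (x + c) \<partial>lborel) = (\<integral>x. f x \<partial>lborel)" for c
  proof -
    have m: "(+) c \<in> measurable lborel borel" and fm: "f \<in> borel_measurable borel"
      using Cinf_measurable[OF f(1)] by auto
    show "integrable lborel (\<lambda>x. f (x + c))"
      using int integrable_distr_eq[OF m fm] lborel_distr_plus[of c] by (simp add: add.commute)
    show "(\<integral>x. f (x + c) \<partial>lborel) = (\<integral>x. f x \<partial>lborel)"
      using integral_distr[OF m fm] lborel_distr_plus[of c] by (simp add: add.commute)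
  qed
  define d where "d n x = real (Suc n) *\<^sub>R (f (x + inverse (real (Suc n)) *\<^sub>R b) - f x)" for n x
  have d0: "(\<integral>x. d n x \<partial>lborel) = 0" for n
    unfolding d_def using int intt by simp
  have "(\<lambda>n. \<integral>x. d n x \<partial>lborel) \<longlonglongrightarrow> (\<integral>x. pd b f x \<partial>lborel)"
  proof (rule integral_dominated_convergence)
    show "pd b f \<in> borel_measurable lborel"
      using Cinf_measurable[OF Cinf_pd[OF f(1) b]] by simp
    show "d n \<in> borel_measurable lborel" for n
      unfolding d_def using int intt(1)
      by (intro borel_measurable_scaleR borel_measurable_diff borel_measurable_integrable) auto
    \<comment> \<open>The increments \<open>inverse (Suc n)\<close> are at most 1, so every quotient
      vanishes outside the ball of radius \<open>R + 1\<close>.\<close>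
    show "integrable lborel (\<lambda>x. indicator (cball 0 (R + 1)) x *\<^sub>R C)"
      by (rule borel_integrable_compact) auto
    show "AE x in lborel. (\<lambda>n. d n x) \<longlonglongrightarrow> pd b f x"
    proof (rule AE_I2)
      fix x
      have "((\<lambda>t. f (x + t *\<^sub>R b)) has_vector_derivative pd b f x) (at 0)"
        using der[of x 0 UNIV] by (simp add: has_vector_derivative_def)
      then have "((\<lambda>t. (f (x + t *\<^sub>R b) - f x) /\<^sub>R t) \<longlongrightarrow> pd b f x) (at 0)"
        unfolding has_vector_derivative_iff_quotient by simp
      moreover have "filterlim (\<lambda>n. inverse (real (Suc n))) (at 0) sequentially"
        using LIMSEQ_inverse_real_of_nat by (auto simp: filterlim_at)
      ultimately have "(\<lambda>n. (f (x + inverse (real (Suc n)) *\<^sub>R b) - f x) /\<^sub>R inverse (real (Suc n)))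
          \<longlonglongrightarrow> pd b f x"
        by (rule filterlim_compose)
      then show "(\<lambda>n. d n x) \<longlonglongrightarrow> pd b f x" by (simp add: d_def)
    qed
    show "AE x in lborel. norm (d n x) \<le> indicator (cball 0 (R + 1)) x *\<^sub>R C" for n
    proof (rule AE_I2)
      fix x
      have le1: "inverse (real (Suc n)) \<le> 1" by (simp add: field_simps)
      show "norm (d n x) \<le> indicator (cball 0 (R + 1)) x *\<^sub>R C"
      proof (cases "norm x \<le> R + 1")
        case True
        have "real (Suc n) * norm (f (x + inverse (real (Suc n)) *\<^sub>R b) - f x)
            \<le> real (Suc n) * (C * inverse (real (Suc n)))"
          by (intro mult_left_mono lip) auto
        also have "\<dots> = C" by simp
        finally show ?thesis using True by (simp add: d_def)
      next
        case False
        have "norm x \<le> norm (x + inverse (real (Suc n)) *\<^sub>R b) + norm (inverse (real (Suc n)) *\<^sub>R b)"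
          using norm_triangle_ineq4[of "x + inverse (real (Suc n)) *\<^sub>R b" "inverse (real (Suc n)) *\<^sub>R b"]
          by simp
        then have "norm (x + inverse (real (Suc n)) *\<^sub>R b) > R"
          using False le1 b by simp
        then show ?thesis using False R by (simp add: d_def)
      qed
    qed
  qed
  with d0 show ?thesis by (simp add: LIMSEQ_const_iff)
qed

text \<open>The functions \<open>1 - exp (- k \<beta>)\<close>, with \<open>\<beta>\<close> a bump on a box, are test functions converging to
  the indicator of the box, and boxes generate the Borel sets.\<close>

lemma AE_eq_0_if_test_integrals_eq_0:
  fixes g :: "'a::euclidean_space \<Rightarrow> 'b::{banach, second_countable_topology}"
  assumes g: "\<And>a b. integrable lborel (\<lambda>x. indicator (box a b) x *\<^sub>R g x)"
    and z: "\<And>\<phi> :: 'a \<Rightarrow> real. Cinf \<phi> \<Longrightarrow> bounded {x. \<phi> x \<noteq> 0} \<Longrightarrow> (\<integral>x. \<phi> x *\<^sub>R g x \<partial>lborel) = 0"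
  shows "AE x in lborel. g x = 0"
proof -
  \<comment> \<open>Truncation makes the locally integrable \<open>g\<close> integrable, so that it
    suffices to show that its integrals over all Borel sets vanish.\<close>
  have box: "AE x in lborel. indicator (box c d) x *\<^sub>R g x = 0" for c d
  proof (rule sigma_finite_measure.density_zero[OF lborel.sigma_finite_measure_axioms g])
    let ?G = "\<lambda>x. indicator (box c d) x *\<^sub>R g x"
    have boxes: "(LINT x:box a b|lborel. ?G x) = 0" for a b
    proof -
      obtain p q where pq: "box a b \<inter> box c d = box p q" by (rule that, rule box_Int_box)
      define s where "s k x = 1 - exp (- real k * bump p q x)" for k x
      have s0: "(\<integral>x. s k x *\<^sub>R g x \<partial>lborel) = 0" for k
      proof (rule z)
        show "Cinf (s k)" unfolding s_def[abs_def] by (rule Cinf_bump_indicator)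
        have "{x. s k x \<noteq> 0} \<subseteq> box p q" using bump_0 by (auto simp: s_def)
        then show "bounded {x. s k x \<noteq> 0}" using bounded_box bounded_subset by blast
      qed
      have "(\<lambda>k. \<integral>x. s k x *\<^sub>R (indicator (box p q) x *\<^sub>R g x) \<partial>lborel)
          \<longlonglongrightarrow> (\<integral>x. indicator (box p q) x *\<^sub>R (indicator (box p q) x *\<^sub>R g x) \<partial>lborel)"
      proof (rule integral_dominated_convergence)
        show "integrable lborel (\<lambda>x. norm (indicator (box p q) x *\<^sub>R g x))"
          by (rule integrable_norm[OF g])
        have [measurable]: "(\<lambda>x. indicator (box p q) x *\<^sub>R g x) \<in> borel_measurable lborel"
          by (rule borel_measurable_integrable[OF g])
        have [measurable]: "s k \<in> borel_measurable lborel" for k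
          using Cinf_measurable[OF Cinf_bump_indicator[of k p q]] by (simp only: s_def[abs_def] measurable_lborel2)
        show "(\<lambda>x. s k x *\<^sub>R (indicator (box p q) x *\<^sub>R g x)) \<in> borel_measurable lborel" for k
          by measurable
        show "(\<lambda>x. indicator (box p q) x *\<^sub>R (indicator (box p q) x *\<^sub>R g x)) \<in> borel_measurable lborel"
          by measurable
        show "AE x in lborel. (\<lambda>k. s k x *\<^sub>R indicator (box p q) x *\<^sub>R g x)
            \<longlonglongrightarrow> indicator (box p q) x *\<^sub>R indicator (box p q) x *\<^sub>R g x"
          unfolding s_def by (intro AE_I2 tendsto_scaleR bump_indicator_tendsto tendsto_const)
        show "AE x in lborel. norm (s k x *\<^sub>R indicator (box p q) x *\<^sub>R g x)
            \<le> norm (indicator (box p q) x *\<^sub>R g x)" for k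
        proof (rule AE_I2)
          fix x
          have "\<bar>s k x\<bar> \<le> 1"
            using bump_indicator_bounds[of k p q x] unfolding s_def
            by (rule order_trans) (auto simp: indicator_def)
          then show "norm (s k x *\<^sub>R indicator (box p q) x *\<^sub>R g x) \<le> norm (indicator (box p q) x *\<^sub>R g x)"
            by (simp add: indicator_def mult_left_le_one_le)
        qed
      qed
      \<comment> \<open>The truncation was needed only for the dominating function;
        \<open>s k\<close> already vanishes off the box.\<close>
      moreover have "(\<lambda>x. s k x *\<^sub>R (indicator (box p q) x *\<^sub>R g x)) = (\<lambda>x. s k x *\<^sub>R g x)" for k
        by (intro ext, rename_tac x, case_tac "x \<in> box p q") (auto simp: s_def bump_0)
      ultimately have "(\<integral>x. indicator (box p q) x *\<^sub>R (indicator (box p q) x *\<^sub>R g x) \<partial>lborel) = 0"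
        by (simp add: s0 LIMSEQ_const_iff)
      moreover have "(\<lambda>x. indicator (box p q) x *\<^sub>R (indicator (box p q) x *\<^sub>R g x))
          = (\<lambda>x. indicator (box a b) x *\<^sub>R ?G x)"
        by (auto simp: pq[symmetric] indicator_def)
      ultimately show ?thesis by (simp add: set_lebesgue_integral_def)
    qed
    have si: "set_integrable lborel A ?G" if "A \<in> sets borel" for A
      unfolding set_integrable_def by (rule integrable_mult_indicator[OF _ g]) (use that in simp)
    show "(LINT x:A|lborel. ?G x) = 0" if "A \<in> sets lborel" for A
    proof -
      have "Int_stable (range (\<lambda>(a, b). box a b :: 'a set))"
        by (auto simp: Int_stable_def box_Int_box)
      moreover have "range (\<lambda>(a, b). box a b) \<subseteq> Pow (UNIV :: 'a set)" by auto
      moreover have "A \<in> sigma_sets UNIV (range (\<lambda>(a, b). box a b))"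
        using that by (simp add: borel_eq_box)
      ultimately show ?thesis
      proof (induction rule: sigma_sets_induct_disjoint)
        case (basic A)
        then show ?case using boxes by auto
      next
        case empty
        then show ?case by (simp add: set_lebesgue_integral_def)
      next
        case (compl A)
        have A: "A \<in> sets borel" using compl(1) by (simp add: borel_eq_box)
        \<comment> \<open>The whole space is not among the generating boxes, but \<open>?G\<close>
          lives on \<open>box c d\<close>, which is.\<close>
        have "(LINT x:UNIV|lborel. ?G x) = (LINT x:box c d|lborel. ?G x)"
          unfolding set_lebesgue_integral_def by (intro Bochner_Integration.integral_cong) (auto simp: indicator_def)
        moreover have "(LINT x:A \<union> (UNIV - A)|lborel. ?G x)
            = (LINT x:A|lborel. ?G x) + (LINT x:UNIV - A|lborel. ?G x)"
          by (intro set_integral_Un si) (use A in auto)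
        ultimately show ?case using compl(2) boxes by simp
      next
        case (union F)
        have F: "F i \<in> sets borel" for i using union(2) by (auto simp: borel_eq_box)
        have "(LINT x:(\<Union>i. F i)|lborel. ?G x) = (\<Sum>i. (LINT x:F i|lborel. ?G x))"
          using union(1) F by (intro lebesgue_integral_countable_add si)
            (auto simp: disjoint_family_on_def)
        then show ?case using union(3) by simp
      qed
    qed
  qed
  \<comment> \<open>Countably many boxes exhaust the space, so their null sets combine into
    one.\<close>
  have "AE x in lborel. \<forall>n::nat. indicator (box (- (real n *\<^sub>R One)) (real n *\<^sub>R One)) x *\<^sub>R g x = 0"
    unfolding AE_all_countable using box by blast
  then show ?thesis
  proof (rule AE_mp, intro AE_I2 impI)
    fix x assume *: "\<forall>n::nat. indicator (box (- (real n *\<^sub>R One)) (real n *\<^sub>R One)) x *\<^sub>R g x = 0"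
    obtain n where "x \<in> box (- (real n *\<^sub>R One)) (real n *\<^sub>R One)"
      using UN_box_eq_UNIV[where 'a='a] by blast
    with *[rule_format, of n] show "g x = 0" by simp
  qed
qed

section \<open>Coefficients\<close>

text \<open>With balls in place of bounded sets, two coefficients share an exceptional set by taking
  the larger radius, and the complement is open, so derivatives vanish there.\<close>

lemma coefficient_alt:
  "coefficient f \<longleftrightarrow> Cinf f \<and> (\<exists>R c. \<forall>x. norm x > R \<longrightarrow> f x = c)"
proof
  assume "coefficient f"
  then obtain S c where f: "Cinf f" "bounded S" "\<And>x. x \<notin> S \<Longrightarrow> f x = c"
    unfolding coefficient_def by blast
  then obtain R where "\<And>x. x \<in> S \<Longrightarrow> norm x \<le> R" unfolding bounded_iff by blast
  then have "\<forall>x. norm x > R \<longrightarrow> f x = c" using f(3) by (meson not_le)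
  with f(1) show "Cinf f \<and> (\<exists>R c. \<forall>x. norm x > R \<longrightarrow> f x = c)" by blast
next
  assume "Cinf f \<and> (\<exists>R c. \<forall>x. norm x > R \<longrightarrow> f x = c)"
  then obtain R c where "Cinf f" "\<And>x. norm x > R \<Longrightarrow> f x = c" by blast
  then show "coefficient f"
    unfolding coefficient_def by (intro conjI exI[of _ "cball 0 R"] exI[of _ c]) auto
qed

lemma coefficient_Cinf: "coefficient f \<Longrightarrow> Cinf f"
  by (simp add: coefficient_def)

lemma coefficient_bounded: "coefficient f \<Longrightarrow> bounded (range f)"
proof -
  assume "coefficient f"
  then obtain R c where f: "Cinf f" "\<And>x. norm x > R \<Longrightarrow> f x = c"
    unfolding coefficient_alt by blast
  obtain C where "\<And>x. norm (f x) \<le> C"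
    using compact_support_norm_bounded[OF Cinf_continuous_on[OF f(1)] f(2)] by blast
  then show ?thesis unfolding bounded_iff by blast
qed

lemma coefficient_pd:
  assumes "coefficient f" "b \<in> Basis"
  shows "coefficient (pd b f)"
proof -
  from assms obtain R c where f: "Cinf f" "\<And>x. norm x > R \<Longrightarrow> f x = c"
    unfolding coefficient_alt by blast
  have "\<forall>x. norm x > R \<longrightarrow> pd b f x = 0" using pd_eq_0_outside[of R f c] f(2) by blast
  with Cinf_pd[OF f(1) assms(2)] show ?thesis unfolding coefficient_alt by blast
qed

lemma coefficient_const: "coefficient (\<lambda>x. c)"
  unfolding coefficient_alt by auto

lemma coefficient_mult:
  assumes "coefficient f" "coefficient g"
  shows "coefficient (\<lambda>x. f x * g x)"
proof -
  from assms obtain R c R' c' where *: "Cinf f" "Cinf g"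
    "\<And>x. norm x > R \<Longrightarrow> f x = c" "\<And>x. norm x > R' \<Longrightarrow> g x = c'"
    unfolding coefficient_alt by blast
  then have "\<forall>x. norm x > max R R' \<longrightarrow> f x * g x = c * c'" by simp
  with Cinf_mult[OF *(1,2)] show ?thesis unfolding coefficient_alt by blast
qed

lemma coefficient_add:
  assumes "coefficient f" "coefficient g"
  shows "coefficient (\<lambda>x. f x + g x)"
proof -
  from assms obtain R c R' c' where *: "Cinf f" "Cinf g"
    "\<And>x. norm x > R \<Longrightarrow> f x = c" "\<And>x. norm x > R' \<Longrightarrow> g x = c'"
    unfolding coefficient_alt by blast
  then have "\<forall>x. norm x > max R R' \<longrightarrow> f x + g x = c + c'" by simp
  with Cinf_add[OF *(1,2)] show ?thesis unfolding coefficient_alt by blast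
qed

lemma coefficient_inverse:
  assumes "coefficient f" "\<And>x. f x \<noteq> 0"
  shows "coefficient (\<lambda>x. inverse (f x))"
proof -
  from assms(1) obtain R c where f: "Cinf f" "\<And>x. norm x > R \<Longrightarrow> f x = c"
    unfolding coefficient_alt by blast
  then have "\<forall>x. norm x > R \<longrightarrow> inverse (f x) = inverse c" by simp
  with Cinf_inverse[OF assms(2) f(1)] show ?thesis unfolding coefficient_alt by blast
qed

section \<open>The Hilbert space of square integrable fields\<close>

lemma L2_measurable: "f \<in> L2 \<Longrightarrow> f \<in> borel_measurable borel"
  by (simp add: L2_def)

lemma L2_integrable: "f \<in> L2 \<Longrightarrow> integrable lborel (\<lambda>x. (norm (f x))\<^sup>2)"
  by (simp add: L2_def)

lemma L2I:
  assumes "f \<in> borel_measurable lborel" "integrable lborel g" "\<And>x. (norm (f x))\<^sup>2 \<le> g x"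
  shows "f \<in> L2"
proof -
  have "integrable lborel (\<lambda>x. (norm (f x))\<^sup>2)"
    by (rule Bochner_Integration.integrable_bound[OF assms(2)])
      (use assms in \<open>auto intro!: AE_I2 order_trans[OF assms(3)]\<close>)
  with assms(1) show ?thesis by (simp add: L2_def)
qed

lemma L2_zero: "(\<lambda>x. 0) \<in> L2"
  by (simp add: L2_def)

lemma L2_scaleR:
  assumes "f \<in> L2"
  shows "(\<lambda>x. c *\<^sub>R f x) \<in> L2"
proof (rule L2I)
  show "(\<lambda>x. c *\<^sub>R f x) \<in> borel_measurable lborel"
    using L2_measurable[OF assms] by simp
  show "integrable lborel (\<lambda>x. c\<^sup>2 * (norm (f x))\<^sup>2)"
    by (rule integrable_mult_right) (rule L2_integrable[OF assms])
qed (simp add: power_mult_distrib)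

lemma L2_add:
  assumes "f \<in> L2" "g \<in> L2"
  shows "(\<lambda>x. f x + g x) \<in> L2"
proof (rule L2I)
  show "(\<lambda>x. f x + g x) \<in> borel_measurable lborel"
    using assms[THEN L2_measurable] by simp
  show "integrable lborel (\<lambda>x. 2 * (norm (f x))\<^sup>2 + 2 * (norm (g x))\<^sup>2)"
    using assms[THEN L2_integrable] by simp
  fix x
  have "(norm (f x + g x))\<^sup>2 \<le> (norm (f x) + norm (g x))\<^sup>2"
    by (intro power_mono norm_triangle_ineq) auto
  also have "\<dots> \<le> 2 * (norm (f x))\<^sup>2 + 2 * (norm (g x))\<^sup>2"
    using sum_squares_bound[of "norm (f x)" "norm (g x)"] by (simp add: power2_sum)
  finally show "(norm (f x + g x))\<^sup>2 \<le> 2 * (norm (f x))\<^sup>2 + 2 * (norm (g x))\<^sup>2" .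
qed

lemma L2_uminus: "f \<in> L2 \<Longrightarrow> (\<lambda>x. - f x) \<in> L2"
  using L2_scaleR[of f "-1"] by simp

lemma L2_diff: "f \<in> L2 \<Longrightarrow> g \<in> L2 \<Longrightarrow> (\<lambda>x. f x - g x) \<in> L2"
  using L2_add[OF _ L2_uminus] by fastforce

lemma L2_bounded_linear_image:
  assumes "f \<in> L2" "\<And>x. norm (g x) \<le> K * norm (f x)" "g \<in> borel_measurable lborel"
  shows "g \<in> L2"
proof (rule L2I[OF assms(3)])
  show "integrable lborel (\<lambda>x. K\<^sup>2 * (norm (f x))\<^sup>2)" using assms(1)[THEN L2_integrable] by simp
  show "(norm (g x))\<^sup>2 \<le> K\<^sup>2 * (norm (f x))\<^sup>2" for x
    using power_mono[OF assms(2)[of x], of 2] by (simp add: power_mult_distrib)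
qed

lemma L2_integrable_prod_bound:
  fixes p :: "real^2 \<Rightarrow> 'b::{banach, second_countable_topology}"
  assumes "f \<in> L2" "g \<in> L2" "p \<in> borel_measurable lborel"
    "\<And>x. norm (p x) \<le> K * (norm (f x) * norm (g x))"
  shows "integrable lborel p"
proof (rule Bochner_Integration.integrable_bound)
  show "integrable lborel (\<lambda>x. \<bar>K\<bar> * ((norm (f x))\<^sup>2 + (norm (g x))\<^sup>2))"
    using assms(1,2)[THEN L2_integrable] by simp
  show "AE x in lborel. norm (p x) \<le> norm (\<bar>K\<bar> * ((norm (f x))\<^sup>2 + (norm (g x))\<^sup>2))"
  proof (rule AE_I2)
    fix x
    have 1: "norm (f x) * norm (g x) \<le> (norm (f x))\<^sup>2 + (norm (g x))\<^sup>2"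
      using sum_squares_bound[of "norm (f x)" "norm (g x)"]
        mult_nonneg_nonneg[OF norm_ge_zero[of "f x"] norm_ge_zero[of "g x"]] by linarith
    have "norm (p x) \<le> \<bar>K\<bar> * (norm (f x) * norm (g x))"
      by (rule order_trans[OF assms(4)]) (intro mult_right_mono; simp)
    also have "\<dots> \<le> \<bar>K\<bar> * ((norm (f x))\<^sup>2 + (norm (g x))\<^sup>2)"
      using 1 by (intro mult_left_mono) auto
    finally show "norm (p x) \<le> norm (\<bar>K\<bar> * ((norm (f x))\<^sup>2 + (norm (g x))\<^sup>2))" by simp
  qed
qed fact

lemma L2_inner_integrable:
  assumes "f \<in> L2" "g \<in> L2"
  shows "integrable lborel (\<lambda>x. f x \<bullet> g x)"
  using assms by (intro L2_integrable_prod_bound[of f g _ 1])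
    (auto intro!: borel_measurable_inner L2_measurable Cauchy_Schwarz_ineq2)

text \<open>Operators act on representatives and their laws hold almost everywhere; a normed space
  needs classes. The relation is partial because fields outside \<open>L2\<close> have no
  class.\<close>

definition l2eq :: "field \<Rightarrow> field \<Rightarrow> bool" where
  "l2eq f g \<longleftrightarrow> f \<in> L2 \<and> g \<in> L2 \<and> (AE x in lborel. f x = g x)"

lemma l2eq_refl: "f \<in> L2 \<Longrightarrow> l2eq f f"
  by (simp add: l2eq_def)

quotient_type l2 = field / partial: l2eq
proof (rule part_equivpI)
  show "\<exists>f. l2eq f f" using l2eq_refl[OF L2_zero] by blast
  show "symp l2eq" by (auto simp: symp_def l2eq_def eq_commute)
  show "Relation.transp l2eq" unfolding Relation.transp_def l2eq_def by (auto elim: AE_mp)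
qed

lemma rep_l2_L2 [simp]: "rep_l2 F \<in> L2"
  using Quotient3_rep_reflp[OF Quotient3_l2, of F] by (simp add: l2eq_def)

lemma abs_l2_rep [simp]: "abs_l2 (rep_l2 F) = F"
  by (rule Quotient3_abs_rep[OF Quotient3_l2])

lemma abs_l2_eq_iff: "f \<in> L2 \<Longrightarrow> g \<in> L2 \<Longrightarrow> abs_l2 f = abs_l2 g \<longleftrightarrow> (AE x in lborel. f x = g x)"
  using Quotient3_rel[OF Quotient3_l2, of f g] by (auto simp: l2eq_def)

text \<open>The real part of the Hermitian product provides norm and topology. It differs from the
  complex bilinear pairing, which becomes the separate operation \<open>pr\<close>.\<close>

instantiation l2 :: real_inner
begin

lift_definition zero_l2 :: l2 is "\<lambda>x. 0" by (simp add: l2eq_def L2_zero)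

lift_definition plus_l2 :: "l2 \<Rightarrow> l2 \<Rightarrow> l2" is "\<lambda>f g x. f x + g x"
  unfolding l2eq_def by (auto intro: L2_add elim!: AE_mp)

lift_definition minus_l2 :: "l2 \<Rightarrow> l2 \<Rightarrow> l2" is "\<lambda>f g x. f x - g x"
  unfolding l2eq_def by (auto intro: L2_diff elim!: AE_mp)

lift_definition uminus_l2 :: "l2 \<Rightarrow> l2" is "\<lambda>f x. - f x"
  unfolding l2eq_def by (auto intro: L2_uminus elim!: AE_mp)

lift_definition scaleR_l2 :: "real \<Rightarrow> l2 \<Rightarrow> l2" is "\<lambda>c f x. c *\<^sub>R f x"
  unfolding l2eq_def by (auto intro: L2_scaleR elim!: AE_mp)

lift_definition inner_l2 :: "l2 \<Rightarrow> l2 \<Rightarrow> real" is "\<lambda>f g. \<integral>x. f x \<bullet> g x \<partial>lborel"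
  unfolding l2eq_def
  by (auto intro!: integral_cong_AE borel_measurable_inner elim!: AE_mp dest: L2_measurable)

definition norm_l2 :: "l2 \<Rightarrow> real" where "norm_l2 F = sqrt (inner F F)"
definition dist_l2 :: "l2 \<Rightarrow> l2 \<Rightarrow> real" where "dist_l2 F G = norm (F - G)"
definition sgn_l2 :: "l2 \<Rightarrow> l2" where "sgn_l2 F = inverse (norm F) *\<^sub>R F"
definition uniformity_l2 :: "(l2 \<times> l2) filter" where
  "uniformity_l2 = (INF e\<in>{0<..}. principal {(x, y). dist x y < e})"
definition open_l2 :: "l2 set \<Rightarrow> bool" where
  "open_l2 U \<longleftrightarrow> (\<forall>x\<in>U. eventually (\<lambda>(x', y). x' = x \<longrightarrow> y \<in> U) uniformity)"

instance
proof
  fix F G H :: l2 and a b :: real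
  show "F + G + H = F + (G + H)" by transfer (simp add: l2eq_def L2_add add.assoc)
  show "F + G = G + F" by transfer (simp add: l2eq_def L2_add add.commute)
  show "0 + F = F" by transfer (simp add: l2eq_def)
  show "- F + F = 0" by transfer (simp add: l2eq_def L2_zero)
  show "F - G = F + - G" by transfer (simp add: l2eq_def L2_diff)
  show "a *\<^sub>R (F + G) = a *\<^sub>R F + a *\<^sub>R G"
    by transfer (simp add: l2eq_def L2_scaleR L2_add scaleR_right_distrib)
  show "(a + b) *\<^sub>R F = a *\<^sub>R F + b *\<^sub>R F"
    by transfer (simp add: l2eq_def L2_scaleR L2_add scaleR_left_distrib)
  show "a *\<^sub>R b *\<^sub>R F = (a * b) *\<^sub>R F" by transfer (simp add: l2eq_def L2_scaleR)
  show "1 *\<^sub>R F = F" by transfer (simp add: l2eq_def)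
  show "dist F G = norm (F - G)" by (rule dist_l2_def)
  show "sgn F = inverse (norm F) *\<^sub>R F" by (rule sgn_l2_def)
  show "uniformity = (INF e\<in>{0<..}. principal {(x, y :: l2). dist x y < e})"
    by (rule uniformity_l2_def)
  show "open U \<longleftrightarrow> (\<forall>x\<in>U. eventually (\<lambda>(x', y). x' = x \<longrightarrow> y \<in> U) uniformity)" for U :: "l2 set"
    by (rule open_l2_def)
  show "inner F G = inner G F" by transfer (simp add: inner_commute)
  show "inner (F + G) H = inner F H + inner G H"
    by transfer (simp add: l2eq_def inner_add_left L2_inner_integrable)
  show "inner (a *\<^sub>R F) G = a * inner F G" by transfer simp
  show "0 \<le> inner F F" by transfer (simp add: integral_nonneg_AE)
  show "inner F F = 0 \<longleftrightarrow> F = 0"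
    by transfer (simp add: l2eq_def L2_zero L2_inner_integrable integral_nonneg_eq_0_iff_AE)
  show "norm F = sqrt (inner F F)" by (rule norm_l2_def)
qed

end

lemma abs_l2_0: "abs_l2 (\<lambda>x. 0) = 0"
  by (simp add: zero_l2.abs_eq)

lemma abs_l2_add: "f \<in> L2 \<Longrightarrow> g \<in> L2 \<Longrightarrow> abs_l2 (\<lambda>x. f x + g x) = abs_l2 f + abs_l2 g"
  by (simp add: plus_l2.abs_eq l2eq_refl)

lemma abs_l2_diff: "f \<in> L2 \<Longrightarrow> g \<in> L2 \<Longrightarrow> abs_l2 (\<lambda>x. f x - g x) = abs_l2 f - abs_l2 g"
  by (simp add: minus_l2.abs_eq l2eq_refl)

lemma abs_l2_uminus: "f \<in> L2 \<Longrightarrow> abs_l2 (\<lambda>x. - f x) = - abs_l2 f"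
  by (simp add: uminus_l2.abs_eq l2eq_refl)

lemma abs_l2_scaleR: "f \<in> L2 \<Longrightarrow> abs_l2 (\<lambda>x. c *\<^sub>R f x) = c *\<^sub>R abs_l2 f"
  by (simp add: scaleR_l2.abs_eq l2eq_refl)

lemma inner_abs_l2: "f \<in> L2 \<Longrightarrow> g \<in> L2 \<Longrightarrow> inner (abs_l2 f) (abs_l2 g) = (\<integral>x. f x \<bullet> g x \<partial>lborel)"
  by (simp add: inner_l2.abs_eq l2eq_refl)

lemma norm_abs_l2: "f \<in> L2 \<Longrightarrow> norm (abs_l2 f) = L2norm f"
  unfolding norm_l2_def L2norm_def by (simp add: inner_abs_l2 power2_norm_eq_inner)

lemma norm_l2_nn:
  "f \<in> L2 \<Longrightarrow> (\<integral>\<^sup>+x. ennreal ((norm (f x))\<^sup>2) \<partial>lborel) = ennreal ((norm (abs_l2 f))\<^sup>2)"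
  by (simp add: norm_abs_l2 L2norm_def nn_integral_eq_integral L2_integrable integral_nonneg_AE)

text \<open>Along a subsequence with \<open>\<parallel>F (n + 1) - F n\<parallel>\<^sup>2 \<le> 4\<^sup>-\<^sup>n\<close> the series
  \<open>\<Sum>2\<^sup>n \<bar>F (n + 1) - F n\<bar>\<^sup>2\<close> has a finite integral, so it converges pointwise almost everywhere,
  which makes the increments summable there.\<close>

lemma l2_fast_Cauchy_convergent:
  fixes F :: "nat \<Rightarrow> l2"
  assumes fast: "\<And>n. norm (F (Suc n) - F n) \<le> (1/2) ^ n"
  shows "\<exists>G. F \<longlonglongrightarrow> G"
proof -
  define f where "f n = rep_l2 (F n)" for n
  have fL: "f n \<in> L2" for n by (simp add: f_def)
  have Ff: "F n = abs_l2 (f n)" for n by (simp add: f_def)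
  have [measurable]: "f n \<in> borel_measurable borel" for n using L2_measurable[OF fL] by simp
  define d where "d n x = norm (f (Suc n) x - f n x)" for n x
  have [measurable]: "d n \<in> borel_measurable borel" for n unfolding d_def by simp
  have nd: "(\<integral>\<^sup>+x. ennreal ((d n x)\<^sup>2) \<partial>lborel) \<le> ennreal ((1/4) ^ n)" for n
  proof -
    have "(\<integral>\<^sup>+x. ennreal ((d n x)\<^sup>2) \<partial>lborel) = ennreal ((norm (F (Suc n) - F n))\<^sup>2)"
      unfolding d_def Ff abs_l2_diff[OF fL fL, symmetric]
      by (rule norm_l2_nn) (intro L2_diff fL)
    also have "\<dots> \<le> ennreal (((1/2) ^ n)\<^sup>2)"
      by (intro ennreal_leI power_mono fast) simp
    also have "((1/2) ^ n)\<^sup>2 = ((1/4::real) ^ n)"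
      by (simp add: power2_eq_square power_mult_distrib[symmetric])
    finally show ?thesis .
  qed
  have "(\<integral>\<^sup>+x. (\<Sum>n. ennreal (2 ^ n * (d n x)\<^sup>2)) \<partial>lborel)
      = (\<Sum>n. \<integral>\<^sup>+x. ennreal (2 ^ n * (d n x)\<^sup>2) \<partial>lborel)"
    by (rule nn_integral_suminf) simp
  also have "\<dots> \<le> (\<Sum>n. ennreal ((1/2) ^ n))"
  proof (rule suminf_le)
    fix n
    have "(\<integral>\<^sup>+x. ennreal (2 ^ n * (d n x)\<^sup>2) \<partial>lborel) = ennreal (2 ^ n) * (\<integral>\<^sup>+x. ennreal ((d n x)\<^sup>2) \<partial>lborel)"
      by (subst nn_integral_cmult[symmetric]) (simp_all add: ennreal_mult)
    also have "\<dots> \<le> ennreal (2 ^ n) * ennreal ((1/4) ^ n)"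
      by (intro mult_left_mono nd) simp
    also have "\<dots> = ennreal ((1/2) ^ n)"
      by (simp add: ennreal_mult[symmetric] power_mult_distrib[symmetric])
    finally show "(\<integral>\<^sup>+x. ennreal (2 ^ n * (d n x)\<^sup>2) \<partial>lborel) \<le> ennreal ((1/2) ^ n)" .
  qed auto
  also have "\<dots> = ennreal (\<Sum>n. (1/2) ^ n)"
    by (rule suminf_ennreal2) (auto simp: summable_geometric)
  finally have "(\<integral>\<^sup>+x. (\<Sum>n. ennreal (2 ^ n * (d n x)\<^sup>2)) \<partial>lborel) \<noteq> \<infinity>"
    using ennreal_less_top by (metis infinity_ennreal_def not_less top.not_eq_extremum)
  then have "AE x in lborel. (\<Sum>n. ennreal (2 ^ n * (d n x)\<^sup>2)) \<noteq> \<infinity>"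
    by (intro nn_integral_PInf_AE) simp_all
  then have conv: "AE x in lborel. convergent (\<lambda>n. f n x)"
  proof (rule AE_mp, intro AE_I2 impI)
    fix x assume fin: "(\<Sum>n. ennreal (2 ^ n * (d n x)\<^sup>2)) \<noteq> \<infinity>"
    have "summable (\<lambda>n. 2 ^ n * (d n x)\<^sup>2)"
      using fin by (intro summable_suminf_not_top) auto
    from summable_add[OF this summable_geometric[of "1/2::real"]]
    have sm: "summable (\<lambda>n. 2 ^ n * (d n x)\<^sup>2 + (1/2) ^ n)" by simp
    \<comment> \<open>Arithmetic-geometric mean inequality for \<open>sqrt (2 ^ n) * d n x\<close>
      and \<open>sqrt ((1/2) ^ n)\<close>, whose product is \<open>d n x\<close>.\<close>
    have le: "d n x \<le> 2 ^ n * (d n x)\<^sup>2 + (1/2) ^ n" for n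
    proof -
      have s: "sqrt (2 ^ n) * sqrt ((1/2) ^ n) = 1"
        by (simp add: real_sqrt_mult[symmetric] power_mult_distrib[symmetric])
      have "2 * (sqrt (2 ^ n) * d n x) * sqrt ((1/2) ^ n) \<le> (sqrt (2 ^ n) * d n x)\<^sup>2 + (sqrt ((1/2) ^ n))\<^sup>2"
        by (rule sum_squares_bound)
      also have "\<dots> = 2 ^ n * (d n x)\<^sup>2 + (1/2) ^ n"
        by (simp add: power_mult_distrib)
      also have "2 * (sqrt (2 ^ n) * d n x) * sqrt ((1/2) ^ n) = 2 * d n x"
        using s by (simp add: mult.assoc mult.left_commute)
      finally have "2 * d n x \<le> 2 ^ n * (d n x)\<^sup>2 + (1/2) ^ n" .
      then show ?thesis using norm_ge_zero[of "f (Suc n) x - f n x"] unfolding d_def by linarith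
    qed
    have "summable (\<lambda>n. f (Suc n) x - f n x)"
      by (rule summable_norm_cancel, rule summable_comparison_test'[OF sm, of 0])
        (use le in \<open>simp add: d_def\<close>)
    then have "convergent (\<lambda>n. \<Sum>k<n. f (Suc k) x - f k x)"
      by (simp add: summable_iff_convergent)
    then have "convergent (\<lambda>n. f n x - f 0 x)"
      unfolding sum_lessThan_telescope[of "\<lambda>k. f k x"] .
    from convergent_add[OF this convergent_const[of "f 0 x"]]
    show "convergent (\<lambda>n. f n x)" by simp
  qed
  define g where "g x = lim (\<lambda>n. f n x)" for x
  have "(\<lambda>n. f n x) \<longlonglongrightarrow> g x" if "convergent (\<lambda>n. f n x)" for x
    using that by (simp add: g_def convergent_LIMSEQ_iff)
  with conv have lim: "AE x in lborel. (\<lambda>n. f n x) \<longlonglongrightarrow> g x" by (auto elim!: AE_mp)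
  have [measurable]: "g \<in> borel_measurable borel"
    unfolding g_def[abs_def]
    by (rule borel_measurable_lim_metric) simp
  have tail': "norm (F n - F k) \<le> 2 * (1/2) ^ k - 2 * (1/2) ^ n" if "k \<le> n" for n k
    using that
  proof (induction n rule: dec_induct)
    case (step n)
    have "norm (F (Suc n) - F k) \<le> norm (F (Suc n) - F n) + norm (F n - F k)"
      using norm_triangle_ineq[of "F (Suc n) - F n" "F n - F k"] by simp
    with step fast[of n] show ?case by simp
  qed simp
  have tail: "norm (F n - F k) \<le> 2 * (1/2) ^ k" if "k \<le> n" for n k
    by (rule order_trans[OF tail'[OF that]]) simp
  \<comment> \<open>Fatou's lemma transfers the tail bound to the pointwise limit; this yields both
    that \<open>g\<close> is square integrable and that \<open>F\<close> converges to its class in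
    norm.\<close>
  have fatou: "(\<integral>\<^sup>+x. ennreal ((norm (g x - f k x))\<^sup>2) \<partial>lborel) \<le> ennreal ((2 * (1/2) ^ k)\<^sup>2)" for k
  proof -
    have "(\<integral>\<^sup>+x. ennreal ((norm (g x - f k x))\<^sup>2) \<partial>lborel)
        = (\<integral>\<^sup>+x. liminf (\<lambda>n. ennreal ((norm (f n x - f k x))\<^sup>2)) \<partial>lborel)"
    proof (rule nn_integral_cong_AE, use lim in \<open>rule AE_mp\<close>, intro AE_I2 impI)
      fix x assume "(\<lambda>n. f n x) \<longlonglongrightarrow> g x"
      then have "(\<lambda>n. ennreal ((norm (f n x - f k x))\<^sup>2)) \<longlonglongrightarrow> ennreal ((norm (g x - f k x))\<^sup>2)"
        by (intro tendsto_intros)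
      then show "ennreal ((norm (g x - f k x))\<^sup>2) = liminf (\<lambda>n. ennreal ((norm (f n x - f k x))\<^sup>2))"
        by (rule lim_imp_Liminf[OF trivial_limit_sequentially, symmetric])
    qed
    also have "\<dots> \<le> liminf (\<lambda>n. \<integral>\<^sup>+x. ennreal ((norm (f n x - f k x))\<^sup>2) \<partial>lborel)"
      by (rule nn_integral_liminf) simp
    also have "\<dots> \<le> ennreal ((2 * (1/2) ^ k)\<^sup>2)"
    proof (rule Liminf_le)
      have "(\<integral>\<^sup>+x. ennreal ((norm (f n x - f k x))\<^sup>2) \<partial>lborel) \<le> ennreal ((2 * (1/2) ^ k)\<^sup>2)" if "n \<ge> k" for n
      proof -
        have "(\<integral>\<^sup>+x. ennreal ((norm (f n x - f k x))\<^sup>2) \<partial>lborel) = ennreal ((norm (F n - F k))\<^sup>2)"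
          unfolding Ff abs_l2_diff[OF fL fL, symmetric] by (rule norm_l2_nn) (intro L2_diff fL)
        also have "\<dots> \<le> ennreal ((2 * (1/2) ^ k)\<^sup>2)"
          by (intro ennreal_leI power_mono tail that) simp
        finally show ?thesis .
      qed
      then show "\<forall>\<^sub>F n in sequentially.
          (\<integral>\<^sup>+x. ennreal ((norm (f n x - f k x))\<^sup>2) \<partial>lborel) \<le> ennreal ((2 * (1/2) ^ k)\<^sup>2)"
        by (auto simp: eventually_sequentially)
    qed simp
    finally show ?thesis .
  qed
  have diffL: "(\<lambda>x. g x - f k x) \<in> L2" for k
    using fatou[of k] unfolding L2_def integrable_iff_bounded
    by (auto intro: le_less_trans)
  have gL: "g \<in> L2" using L2_add[OF diffL[of 0] fL[of 0]] by simp
  have "norm (F k - abs_l2 g) \<le> 2 * (1/2) ^ k" for k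
  proof -
    have "ennreal ((norm (abs_l2 g - F k))\<^sup>2) \<le> ennreal ((2 * (1/2) ^ k)\<^sup>2)"
      using fatou[of k] unfolding Ff abs_l2_diff[OF gL fL, symmetric] norm_l2_nn[OF diffL] .
    then have "(norm (abs_l2 g - F k))\<^sup>2 \<le> (2 * (1/2) ^ k)\<^sup>2" by (simp add: ennreal_le_iff)
    then show ?thesis by (subst norm_minus_commute) (rule power2_le_imp_le; simp)
  qed
  then have "\<forall>\<^sub>F k in sequentially. norm (F k - abs_l2 g) \<le> 2 * (1/2) ^ k"
    by (intro always_eventually allI)
  moreover have "(\<lambda>k. 2 * (1/2::real) ^ k) \<longlonglongrightarrow> 0"
    by (rule tendsto_mult_right_zero, rule LIMSEQ_power_zero) simp
  ultimately have "(\<lambda>k. F k - abs_l2 g) \<longlonglongrightarrow> 0"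
    by (rule Lim_null_comparison)
  then have "F \<longlonglongrightarrow> abs_l2 g" by (rule LIM_zero_cancel)
  then show ?thesis by blast
qed

instance l2 :: banach
proof
  fix X :: "nat \<Rightarrow> l2" assume X: "Cauchy X"
  have "\<exists>M. \<forall>m\<ge>M. \<forall>n\<ge>M. norm (X m - X n) < (1/2) ^ k" for k :: nat
    using CauchyD[OF X, of "(1/2) ^ k"] by simp
  then obtain M where M: "\<And>k m n. m \<ge> M k \<Longrightarrow> n \<ge> M k \<Longrightarrow> norm (X m - X n) < (1/2) ^ k"
    by metis
  \<comment> \<open>The sum dominates each \<open>M j\<close> with \<open>j \<le> k\<close>, and the
    added \<open>k\<close> makes the subsequence strictly increasing.\<close>
  define r where "r k = (\<Sum>j\<le>k. M j) + k" for k
  have r: "strict_mono r" unfolding strict_mono_Suc_iff r_def by simp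
  have rM: "M k \<le> r k" "M k \<le> r (Suc k)" for k
    using member_le_sum[of k "{..k}" M] unfolding r_def by auto
  have "norm ((X \<circ> r) (Suc k) - (X \<circ> r) k) \<le> (1/2) ^ k" for k
    using M[OF rM(2) rM(1), of k] by simp
  then obtain G where "(X \<circ> r) \<longlonglongrightarrow> G" using l2_fast_Cauchy_convergent by blast
  with X r show "convergent X"
    by (meson Cauchy_converges_subseq convergentI)
qed

section \<open>The bilinear pairing\<close>

lemma vector_4 [simp]:
  "(vector [x, y, z, w] :: 'a::zero^4) $ 1 = x"
  "(vector [x, y, z, w] :: 'a::zero^4) $ 2 = y"
  "(vector [x, y, z, w] :: 'a::zero^4) $ 3 = z"
  "(vector [x, y, z, w] :: 'a::zero^4) $ 4 = w"
  unfolding vector_def by simp_all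

definition cdot :: "complex^4 \<Rightarrow> complex^4 \<Rightarrow> complex" where
  "cdot a b = (\<Sum>i\<in>UNIV. a $ i * b $ i)"

lemma cdot_bilinear: "bounded_bilinear cdot"
  unfolding bilinear_conv_bounded_bilinear[symmetric] bilinear_def cdot_def
  by (auto intro!: linearI simp: sum.distrib[symmetric] algebra_simps scaleR_sum_right)

lemma pairing_cdot: "pairing f g = (\<integral>x. cdot (f x) (g x) \<partial>lborel)"
  by (simp add: pairing_def cdot_def)

lemma cdot_integrable:
  assumes "f \<in> L2" "g \<in> L2"
  shows "integrable lborel (\<lambda>x. cdot (f x) (g x))"
proof -
  obtain K where K: "\<And>a b. norm (cdot a b) \<le> norm a * norm b * K"
    using bounded_bilinear.bounded[OF cdot_bilinear] by blast
  show ?thesis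
  proof (rule L2_integrable_prod_bound[OF assms])
    have "continuous_on UNIV (\<lambda>z. cdot (fst z) (snd z))"
      by (intro bounded_bilinear.continuous_on[OF cdot_bilinear] continuous_intros)
    then have "(\<lambda>x. cdot (f x) (g x)) \<in> borel_measurable borel"
      using borel_measurable_continuous_Pair assms[THEN L2_measurable] by blast
    then show "(\<lambda>x. cdot (f x) (g x)) \<in> borel_measurable lborel" by simp
    show "norm (cdot (f x) (g x)) \<le> K * (norm (f x) * norm (g x))" for x
      using K[of "f x" "g x"] by (simp add: mult.commute)
  qed
qed

lemma pairing_cong_AE:
  assumes "f \<in> L2" "f' \<in> L2" "g \<in> L2" "g' \<in> L2"
    and "AE x in lborel. f x = f' x" "AE x in lborel. g x = g' x"
  shows "pairing f g = pairing f' g'"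
  unfolding pairing_cdot
proof (rule integral_cong_AE)
  show "(\<lambda>x. cdot (f x) (g x)) \<in> borel_measurable lborel" "(\<lambda>x. cdot (f' x) (g' x)) \<in> borel_measurable lborel"
    using assms cdot_integrable by (blast intro: borel_measurable_integrable)+
  show "AE x in lborel. cdot (f x) (g x) = cdot (f' x) (g' x)"
    using assms(5,6) by (auto elim: AE_mp)
qed

lift_definition pr :: "l2 \<Rightarrow> l2 \<Rightarrow> complex" is pairing
  unfolding l2eq_def using pairing_cong_AE by blast

lemma pr_abs: "f \<in> L2 \<Longrightarrow> g \<in> L2 \<Longrightarrow> pr (abs_l2 f) (abs_l2 g) = pairing f g"
  by (simp add: pr.abs_eq l2eq_refl)

lemma pr_commute: "pr F G = pr G F"
  by transfer (simp add: pairing_def mult.commute)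

lemma pr_add_left: "pr (F + G) H = pr F H + pr G H"
  by transfer
    (simp add: l2eq_def pairing_cdot bounded_bilinear.add_left[OF cdot_bilinear] cdot_integrable)

lemma pr_scaleR_left: "pr (c *\<^sub>R F) H = c *\<^sub>R pr F H"
  by transfer (simp add: l2eq_def pairing_cdot bounded_bilinear.scaleR_left[OF cdot_bilinear])

text \<open>Scaling both arguments to unit length turns an additive bound, which follows pointwise
  under the integral, into the multiplicative one; this replaces the Cauchy-Schwarz inequality for
  integrals.\<close>

lemma bilinear_norm_boundI:
  fixes q :: "'a::real_normed_vector \<Rightarrow> 'b::real_normed_vector \<Rightarrow> 'c::real_normed_vector"
  assumes s: "\<And>r x y. q (r *\<^sub>R x) y = r *\<^sub>R q x y" "\<And>r x y. q x (r *\<^sub>R y) = r *\<^sub>R q x y"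
    and b: "\<And>x y. norm (q x y) \<le> K * ((norm x)\<^sup>2 + (norm y)\<^sup>2)"
  shows "norm (q x y) \<le> norm x * norm y * (2 * K)"
proof (cases "x = 0 \<or> y = 0")
  case True
  then show ?thesis using s(1)[of 0 0 y] s(2)[of x 0 0] by auto
next
  case False
  have "q x y = norm x *\<^sub>R norm y *\<^sub>R q (x /\<^sub>R norm x) (y /\<^sub>R norm y)"
    using False by (simp add: s field_simps)
  then have "norm (q x y) = norm x * norm y * norm (q (x /\<^sub>R norm x) (y /\<^sub>R norm y))"
    by simp
  also have "\<dots> \<le> norm x * norm y * (K * (1 + 1))"
    using b[of "x /\<^sub>R norm x" "y /\<^sub>R norm y"] False by (intro mult_left_mono) auto
  finally show ?thesis by (simp add: mult.commute)
qed

lemma pr_bilinear: "bounded_bilinear pr"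
proof
  show add: "pr (F + G) H = pr F H + pr G H" "pr H (F + G) = pr H F + pr H G" for F G H
    using pr_add_left pr_commute by metis+
  show sc: "pr (c *\<^sub>R F) H = c *\<^sub>R pr F H" "pr H (c *\<^sub>R F) = c *\<^sub>R pr H F" for c F H
    using pr_scaleR_left pr_commute by metis+
  obtain K where K: "K > 0" "\<And>a b. norm (cdot a b) \<le> norm a * norm b * K"
    using bounded_bilinear.pos_bounded[OF cdot_bilinear] by blast
  have "norm (pr F G) \<le> K * ((norm F)\<^sup>2 + (norm G)\<^sup>2)" for F G
  proof -
    obtain f g where fg: "F = abs_l2 f" "G = abs_l2 g" "f \<in> L2" "g \<in> L2"
      by (metis abs_l2_rep rep_l2_L2)
    have n: "(norm F)\<^sup>2 = (\<integral>x. (norm (f x))\<^sup>2 \<partial>lborel)" "(norm G)\<^sup>2 = (\<integral>x. (norm (g x))\<^sup>2 \<partial>lborel)"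
      using fg by (simp_all add: norm_abs_l2 L2norm_def integral_nonneg_AE)
    have "norm (pr F G) = norm (\<integral>x. cdot (f x) (g x) \<partial>lborel)"
      using fg by (simp add: pr_abs pairing_cdot)
    also have "\<dots> \<le> (\<integral>x. norm (cdot (f x) (g x)) \<partial>lborel)" by simp
    also have "\<dots> \<le> (\<integral>x. K * ((norm (f x))\<^sup>2 + (norm (g x))\<^sup>2) \<partial>lborel)"
    proof (rule integral_mono)
      show "integrable lborel (\<lambda>x. norm (cdot (f x) (g x)))"
        by (rule integrable_norm[OF cdot_integrable[OF fg(3,4)]])
      show "integrable lborel (\<lambda>x. K * ((norm (f x))\<^sup>2 + (norm (g x))\<^sup>2))"
        using fg(3,4)[THEN L2_integrable] by simp
      fix x
      have "norm (f x) * norm (g x) \<le> (norm (f x))\<^sup>2 + (norm (g x))\<^sup>2"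
        using sum_squares_bound[of "norm (f x)" "norm (g x)"]
          mult_nonneg_nonneg[OF norm_ge_zero[of "f x"] norm_ge_zero[of "g x"]] by linarith
      then have "K * (norm (f x) * norm (g x)) \<le> K * ((norm (f x))\<^sup>2 + (norm (g x))\<^sup>2)"
        using K(1) by (intro mult_left_mono) auto
      with K(2)[of "f x" "g x"] show "norm (cdot (f x) (g x)) \<le> K * ((norm (f x))\<^sup>2 + (norm (g x))\<^sup>2)"
        by (simp add: mult.commute)
    qed
    also have "\<dots> = K * ((norm F)\<^sup>2 + (norm G)\<^sup>2)"
      using fg(3,4)[THEN L2_integrable] by (simp add: n)
    finally show ?thesis .
  qed
  from bilinear_norm_boundI[of pr, OF sc(1) sc(2) this]
  show "\<exists>K. \<forall>F G. norm (pr F G) \<le> norm F * norm G * K" by blast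
qed

interpretation pr: bounded_bilinear pr by (rule pr_bilinear)

section \<open>Multiplication operators\<close>

definition cmv :: "real^4^4 \<Rightarrow> complex^4 \<Rightarrow> complex^4" where
  "cmv A v = (\<chi> i j. complex_of_real (A $ i $ j)) *v v"

lemma app_cmv: "app M f x = cmv (M x) (f x)"
  by (simp add: app_def cmv_def)

lemma cmv_nth: "cmv A v $ i = (\<Sum>j\<in>UNIV. A $ i $ j *\<^sub>R v $ j)"
  by (simp add: cmv_def matrix_vector_mult_def scaleR_conv_of_real)

lemma cmv_bilinear: "bounded_bilinear cmv"
  unfolding bilinear_conv_bounded_bilinear[symmetric] bilinear_def
  by (auto intro!: linearI simp: vec_eq_iff cmv_nth sum.distrib[symmetric] algebra_simps scaleR_sum_right)

lemma cdot_cmv: "cdot (cmv A v) w = cdot v (cmv (transpose A) w)"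
  by (simp add: cdot_def cmv_nth sum_4 transpose_def algebra_simps)

definition bdd :: "(real^2 \<Rightarrow> real^4^4) \<Rightarrow> bool" where
  "bdd M \<longleftrightarrow> M \<in> borel_measurable borel \<and> bounded (range M)"

lemma app_L2:
  assumes "bdd M" "f \<in> L2"
  shows "app M f \<in> L2"
proof -
  obtain K where K: "K > 0" "\<And>a b. norm (cmv a b) \<le> norm a * norm b * K"
    using bounded_bilinear.pos_bounded[OF cmv_bilinear] by blast
  obtain C where C: "\<And>x. norm (M x) \<le> C" using assms(1) unfolding bdd_def bounded_iff by blast
  show ?thesis
  proof (rule L2_bounded_linear_image[OF assms(2)])
    have "continuous_on UNIV (\<lambda>z. cmv (fst z) (snd z))"
      by (intro bounded_bilinear.continuous_on[OF cmv_bilinear] continuous_intros)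
    moreover have "M \<in> borel_measurable borel" using assms(1) by (simp add: bdd_def)
    ultimately have "(\<lambda>x. cmv (M x) (f x)) \<in> borel_measurable borel"
      using borel_measurable_continuous_Pair L2_measurable[OF assms(2)] by blast
    then show "app M f \<in> borel_measurable lborel" by (simp add: app_cmv[abs_def])
    show "norm (app M f x) \<le> (C * K) * norm (f x)" for x
    proof -
      have "norm (cmv (M x) (f x)) \<le> norm (M x) * norm (f x) * K" by (rule K)
      also have "\<dots> \<le> C * norm (f x) * K" using K(1) C by (intro mult_right_mono) auto
      finally show ?thesis by (simp add: app_cmv mult_ac)
    qed
  qed
qed

text \<open>The default 0 for unbounded multipliers keeps the lifting total and makes
  \<open>mulop M\<close> bounded linear for every \<open>M\<close>.\<close>

lift_definition mulop :: "(real^2 \<Rightarrow> real^4^4) \<Rightarrow> l2 \<Rightarrow> l2" is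
  "\<lambda>M f. if bdd M then app M f else (\<lambda>x. 0)"
  unfolding l2eq_def by (auto simp: app_L2 L2_zero app_cmv elim!: AE_mp)

lemma mulop_abs: "bdd M \<Longrightarrow> f \<in> L2 \<Longrightarrow> mulop M (abs_l2 f) = abs_l2 (app M f)"
  by (simp add: mulop.abs_eq l2eq_refl)

lemma l2_cases: obtains f where "f \<in> L2" "F = abs_l2 f"
  using abs_l2_rep rep_l2_L2 by metis

lemma pr_mulop: "bdd M \<Longrightarrow> bdd (\<lambda>x. transpose (M x)) \<Longrightarrow> pr (mulop M F) G = pr F (mulop (\<lambda>x. transpose (M x)) G)"
  by (rule l2_cases[of F], rule l2_cases[of G])
    (simp add: mulop_abs pr_abs app_L2 pairing_cdot app_cmv cdot_cmv)

lemma mulop_bounded_linear: "bounded_linear (mulop M)"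
proof (cases "bdd M")
  case False
  have "mulop M = (\<lambda>F. 0)"
  proof
    fix F
    show "mulop M F = 0"
      by (rule l2_cases[of F]) (simp add: False mulop.abs_eq l2eq_refl abs_l2_0)
  qed
  then show ?thesis by simp
next
  case True
  obtain K where K: "K > 0" "\<And>a b. norm (cmv a b) \<le> norm a * norm b * K"
    using bounded_bilinear.pos_bounded[OF cmv_bilinear] by blast
  obtain C where C: "\<And>x. norm (M x) \<le> C" using True unfolding bdd_def bounded_iff by blast
  have C0: "C \<ge> 0" using order_trans[OF norm_ge_zero C] .
  show ?thesis
  proof (rule bounded_linear_intro[where K="C * K"])
    fix F G :: l2 and c :: real
    obtain f where f: "f \<in> L2" "F = abs_l2 f" by (rule l2_cases)
    obtain g where g: "g \<in> L2" "G = abs_l2 g" by (rule l2_cases)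
    show "mulop M (F + G) = mulop M F + mulop M G"
      using True f g by (simp add: mulop_abs abs_l2_add[symmetric] L2_add app_L2)
        (simp add: app_cmv[abs_def] bounded_bilinear.add_right[OF cmv_bilinear])
    show "mulop M (c *\<^sub>R F) = c *\<^sub>R mulop M F"
      using True f by (simp add: mulop_abs abs_l2_scaleR[symmetric] L2_scaleR app_L2)
        (simp add: app_cmv[abs_def] bounded_bilinear.scaleR_right[OF cmv_bilinear])
    have "(norm (mulop M F))\<^sup>2 = (\<integral>x. (norm (app M f x))\<^sup>2 \<partial>lborel)"
      using f True by (simp add: mulop_abs norm_abs_l2 L2norm_def app_L2 integral_nonneg_AE)
    also have "\<dots> \<le> (\<integral>x. (C * K)\<^sup>2 * (norm (f x))\<^sup>2 \<partial>lborel)"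
    proof (rule integral_mono)
      show "integrable lborel (\<lambda>x. (norm (app M f x))\<^sup>2)"
        by (rule L2_integrable[OF app_L2[OF True f(1)]])
      show "integrable lborel (\<lambda>x. (C * K)\<^sup>2 * (norm (f x))\<^sup>2)"
        by (rule integrable_mult_right) (rule L2_integrable[OF f(1)])
      fix x
      have "norm (cmv (M x) (f x)) \<le> norm (M x) * norm (f x) * K" by (rule K)
      also have "\<dots> \<le> C * norm (f x) * K" using K(1) C by (intro mult_right_mono) auto
      finally have "norm (app M f x) \<le> (C * K) * norm (f x)" by (simp add: app_cmv mult_ac)
      from power_mono[OF this, of 2] show "(norm (app M f x))\<^sup>2 \<le> (C * K)\<^sup>2 * (norm (f x))\<^sup>2"
        by (simp add: power_mult_distrib)
    qed
    also have "\<dots> = (norm F * (C * K))\<^sup>2"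
      using f by (simp add: norm_abs_l2 L2norm_def integral_nonneg_AE power_mult_distrib mult.commute)
    finally show "norm (mulop M F) \<le> norm F * (C * K)"
      by (rule power2_le_imp_le) (use C0 K(1) in simp)
  qed
qed

lemmas mulop_add = linear_add[OF bounded_linear.linear[OF mulop_bounded_linear]]
lemmas mulop_scaleR = linear_scale[OF bounded_linear.linear[OF mulop_bounded_linear]]
lemmas mulop_continuous_on = bounded_linear.continuous_on[OF mulop_bounded_linear]

lemma bdd_if_entries:
  assumes "\<And>i j. coefficient (\<lambda>x. M x $ i $ j)"
  shows "bdd M"
  unfolding bdd_def
proof
  have "continuous_on UNIV (\<lambda>x. \<chi> i. \<chi> j. M x $ i $ j)"
    by (intro continuous_on_vec_lambda Cinf_continuous_on coefficient_Cinf assms)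
  then show "M \<in> borel_measurable borel"
    by (intro borel_measurable_continuous_onI) simp
  have "\<exists>C. \<forall>x. norm (M x $ i $ j) \<le> C" for i j
    using coefficient_bounded[OF assms, of i j] by (auto simp: bounded_iff)
  then obtain C where C: "\<And>i j x. norm (M x $ i $ j) \<le> C i j" by metis
  have "norm (M x) \<le> (\<Sum>i\<in>UNIV. \<Sum>j\<in>UNIV. C i j)" for x
  proof -
    have "norm (M x) \<le> (\<Sum>i\<in>UNIV. norm (M x $ i))"
      unfolding norm_vec_def by (rule L2_set_le_sum) simp
    also have "\<dots> \<le> (\<Sum>i\<in>UNIV. \<Sum>j\<in>UNIV. norm (M x $ i $ j))"
      by (intro sum_mono) (subst norm_vec_def, rule L2_set_le_sum, simp)
    also have "\<dots> \<le> (\<Sum>i\<in>UNIV. \<Sum>j\<in>UNIV. C i j)"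
      by (intro sum_mono C)
    finally show ?thesis .
  qed
  then show "bounded (range M)" by (auto simp: bounded_iff)
qed

section \<open>The operator \<open>\<Lambda>\<close> on the Hilbert space\<close>

definition test :: "field \<Rightarrow> bool" where
  "test \<Phi> \<longleftrightarrow> Cinf \<Phi> \<and> bounded {x. \<Phi> x \<noteq> 0}"

lemma axis_bounded_linear: "bounded_linear (axis i :: complex \<Rightarrow> complex^4)"
  unfolding linear_conv_bounded_linear[symmetric] by (rule linearI) (auto simp: axis_def vec_eq_iff)

lemma Cinf_vecI:
  fixes f :: "'a::euclidean_space \<Rightarrow> complex^4"
  assumes "\<And>i. Cinf (\<lambda>x. f x $ i)"
  shows "Cinf f"
proof -
  have "Cinf (\<lambda>x. (axis 1 (f x $ 1) :: complex^4) + axis 2 (f x $ 2) + axis 3 (f x $ 3) + axis 4 (f x $ 4))"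
    by (intro Cinf_add Cinf_linear[OF axis_bounded_linear] assms)
  moreover have "(\<lambda>x. (axis 1 (f x $ 1) :: complex^4) + axis 2 (f x $ 2) + axis 3 (f x $ 3) + axis 4 (f x $ 4)) = f"
    by (rule ext) (simp add: vec_eq_iff forall_4 axis_def)
  ultimately show ?thesis by simp
qed

lemma Cinf_nth: "Cinf f \<Longrightarrow> Cinf (\<lambda>x. f x $ i)"
  by (rule Cinf_linear[OF bounded_linear_vec_nth])

lemma axis_Basis_2: "axis (1::2) (1::real) \<in> Basis" "axis (2::2) (1::real) \<in> Basis"
  by (simp_all add: axis_in_Basis_iff)

lemma test_L2: "test \<Phi> \<Longrightarrow> \<Phi> \<in> L2"
proof -
  assume t: "test \<Phi>"
  then have c: "continuous_on UNIV \<Phi>" by (simp add: test_def Cinf_continuous_on)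
  show ?thesis
  proof (rule L2I)
    show "\<Phi> \<in> borel_measurable lborel" using borel_measurable_continuous_onI[OF c] by simp
    show "integrable lborel (\<lambda>x. (norm (\<Phi> x))\<^sup>2)"
      using t by (intro compact_support_integrable continuous_intros c) (simp add: test_def)
  qed simp
qed

lemma test_Lam: "test \<Phi> \<Longrightarrow> test (Lam \<Phi>)"
proof -
  assume t: "test \<Phi>"
  note C = t[unfolded test_def, THEN conjunct1]
  obtain R where R: "\<And>x. norm x > R \<Longrightarrow> \<Phi> x = 0"
    using bounded_supportE t[unfolded test_def, THEN conjunct2] by blast
  have z: "pd b (\<lambda>y. \<Phi> y $ i) x = 0" if "norm x > R" for b i x
    by (rule pd_eq_0_outside[of R _ 0]) (use R that in auto)
  have neg: "Cinf (\<lambda>x. - f x)" if "Cinf f" for f :: "real^2 \<Rightarrow> complex"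
    by (rule Cinf_linear[OF bounded_linear_minus[OF bounded_linear_ident] that])
  have diff: "Cinf (\<lambda>x. f x - g x)" if "Cinf f" "Cinf g" for f g :: "real^2 \<Rightarrow> complex"
    using Cinf_add[OF that(1) neg[OF that(2)]] by simp
  have "Cinf (\<lambda>x. Lam \<Phi> x $ i)" for i
    using exhaust_4[of i] Cinf_pd[OF Cinf_nth[OF C] axis_Basis_2(1)] Cinf_pd[OF Cinf_nth[OF C] axis_Basis_2(2)]
    by (auto simp: Lam_def intro!: neg diff)
  then have "Cinf (Lam \<Phi>)" by (rule Cinf_vecI)
  moreover have "Lam \<Phi> x = 0" if "norm x > R" for x
    using z[OF that] by (simp add: Lam_def vec_eq_iff forall_4)
  ultimately show ?thesis unfolding test_def using bounded_supportI by blast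
qed

lemma pd_mult:
  fixes f g :: "'a::euclidean_space \<Rightarrow> 'b::real_normed_algebra"
  assumes "Cinf f" "Cinf g"
  shows "pd b (\<lambda>x. f x * g x) x = f x * pd b g x + pd b f x * g x"
  using pd_eq[OF has_derivative_mult[OF Cinf_has_derivative[OF assms(1)] Cinf_has_derivative[OF assms(2)]]]
  by (simp add: pd_def)

lemma pd_add:
  assumes "Cinf f" "Cinf g"
  shows "pd b (\<lambda>x. f x + g x) x = pd b f x + pd b g x"
  using pd_eq[OF has_derivative_add[OF Cinf_has_derivative[OF assms(1)] Cinf_has_derivative[OF assms(2)]]]
  by (simp add: pd_def)

lemma pd_of_real:
  assumes "Cinf p"
  shows "pd b (\<lambda>x. complex_of_real (p x)) x = complex_of_real (pd b p x)"
  using pd_eq[OF bounded_linear.has_derivative[OF bounded_linear_of_real Cinf_has_derivative[OF assms]]]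
  by (simp add: pd_def)

lemma Cinf_of_real: "Cinf p \<Longrightarrow> Cinf (\<lambda>x. complex_of_real (p x))"
  by (rule Cinf_linear[OF bounded_linear_of_real])

text \<open>The two integrands add up to \<open>D2 u - D1 v\<close>, where \<open>u\<close> and
  \<open>v\<close> are sums of products of a magnetic and an electric component; the integral of
  such derivatives vanishes.\<close>

lemma pairing_Lam_test:
  assumes "test \<Phi>" "test \<Psi>"
  shows "pairing \<Phi> (Lam \<Psi>) = - pairing (Lam \<Phi>) \<Psi>"
proof -
  have C: "Cinf (\<lambda>x. \<Phi> x $ i)" "Cinf (\<lambda>x. \<Psi> x $ i)" for i
    using assms by (simp_all add: test_def Cinf_nth)
  obtain R where R: "\<And>x. norm x > R \<Longrightarrow> \<Phi> x = 0"
    using bounded_supportE assms(1)[unfolded test_def, THEN conjunct2] by blast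
  define u where "u x = \<Phi> x $ 1 * \<Psi> x $ 3 + \<Phi> x $ 3 * \<Psi> x $ 1" for x
  define v where "v x = \<Phi> x $ 2 * \<Psi> x $ 3 + \<Phi> x $ 3 * \<Psi> x $ 2" for x
  have Cuv: "Cinf u" "Cinf v"
    unfolding u_def[abs_def] v_def[abs_def] by (intro Cinf_add Cinf_mult C)+
  have buv: "bounded {x. u x \<noteq> 0}" "bounded {x. v x \<noteq> 0}"
    by (intro bounded_supportI[of R]; simp add: u_def v_def R)+
  have Duv: "integrable lborel (D2 u)" "integrable lborel (D1 v)"
    using pd_eq_0_outside[of R u 0] pd_eq_0_outside[of R v 0]
    by (intro compact_support_integrable Cinf_continuous_on Cinf_pd Cuv axis_Basis_2 bounded_supportI[of R];
        simp add: u_def v_def R)+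
  have "pairing \<Phi> (Lam \<Psi>) + pairing (Lam \<Phi>) \<Psi> = (\<integral>x. cdot (\<Phi> x) (Lam \<Psi> x) + cdot (Lam \<Phi> x) (\<Psi> x) \<partial>lborel)"
    unfolding pairing_cdot using assms
    by (intro Bochner_Integration.integral_add[symmetric] cdot_integrable test_L2 test_Lam)
  also have "\<dots> = (\<integral>x. D2 u x - D1 v x \<partial>lborel)"
    unfolding u_def v_def
    by (simp add: cdot_def sum_4 Lam_def pd_add pd_mult Cinf_mult C algebra_simps)
  also have "\<dots> = 0"
    using Duv integral_pd_eq_0[OF Cuv(1) buv(1) axis_Basis_2(2)] integral_pd_eq_0[OF Cuv(2) buv(2) axis_Basis_2(1)]
    by simp
  finally show ?thesis by (simp add: eq_neg_iff_add_eq_0)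
qed

lemma AE_eq_0_if_test_pairing_eq_0:
  assumes f: "f \<in> L2" and z: "\<And>\<Phi>. test \<Phi> \<Longrightarrow> pairing f \<Phi> = 0"
  shows "AE x in lborel. f x = 0"
proof -
  have "AE x in lborel. f x $ i = 0" for i
  proof (rule AE_eq_0_if_test_integrals_eq_0)
    fix \<phi> :: "real^2 \<Rightarrow> real" assume \<phi>: "Cinf \<phi>" "bounded {x. \<phi> x \<noteq> 0}"
    have "test (\<lambda>x. axis i (complex_of_real (\<phi> x)))"
      unfolding test_def using \<phi>
      by (auto intro!: Cinf_linear[OF axis_bounded_linear] Cinf_of_real)
    from z[OF this] show "(\<integral>x. \<phi> x *\<^sub>R f x $ i \<partial>lborel) = 0"
      by (simp add: pairing_def axis_def if_distrib scaleR_conv_of_real mult.commute cong: if_cong)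
  next
    fix a b :: "real^2"
    show "integrable lborel (\<lambda>x. indicat_real (box a b) x *\<^sub>R f x $ i)"
    proof (rule Bochner_Integration.integrable_bound)
      show "integrable lborel (\<lambda>x. indicat_real (box a b) x + (norm (f x))\<^sup>2)"
        by (intro Bochner_Integration.integrable_add integrable_real_indicator L2_integrable[OF f])
          (use emeasure_lborel_box_finite[of a b] in simp_all)
      have "continuous_on UNIV (\<lambda>v :: complex^4. v $ i)" by (intro continuous_intros)
      from borel_measurable_continuous_on[OF this L2_measurable[OF f]]
      have "(\<lambda>x. f x $ i) \<in> borel_measurable borel" .
      then show "(\<lambda>x. indicat_real (box a b) x *\<^sub>R f x $ i) \<in> borel_measurable lborel"
        by simp
      \<comment> \<open>On sets of finite measure this turns square integrability into
        integrability.\<close>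
      have "norm (f x $ i) \<le> 1 + (norm (f x))\<^sup>2" for x
        using sum_squares_bound[of 1 "norm (f x)"] Finite_Cartesian_Product.norm_nth_le[of "f x" i]
          norm_ge_zero[of "f x"] unfolding power_one by linarith
      then show "AE x in lborel. norm (indicat_real (box a b) x *\<^sub>R f x $ i)
          \<le> norm (indicat_real (box a b) x + (norm (f x))\<^sup>2)"
        by (intro AE_I2) (auto simp: indicator_def)
    qed
  qed
  then have "AE x in lborel. \<forall>i\<in>UNIV. f x $ i = 0" by (intro AE_finite_allI) auto
  then show ?thesis by (rule AE_mp) (auto simp: vec_eq_iff)
qed

text \<open>The graph of the distributional \<Lambda> on classes. A relation expresses membership in
  the domain and the value at once, without the choice made in \<open>Lam_dom\<close>.\<close>

definition lamr :: "l2 \<Rightarrow> l2 \<Rightarrow> bool" where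
  "lamr F G \<longleftrightarrow> (\<forall>\<Phi>. test \<Phi> \<longrightarrow> pr F (abs_l2 (Lam \<Phi>)) = - pr G (abs_l2 \<Phi>))"

lemma weak_Lam_iff_lamr:
  "f \<in> L2 \<Longrightarrow> g \<in> L2 \<Longrightarrow> weak_Lam f g \<longleftrightarrow> lamr (abs_l2 f) (abs_l2 g)"
  unfolding weak_Lam_def lamr_def test_def[symmetric] by (auto simp: pr_abs test_L2 test_Lam)

lemma pr_test_eq_0: "(\<And>\<Phi>. test \<Phi> \<Longrightarrow> pr F (abs_l2 \<Phi>) = 0) \<Longrightarrow> F = 0"
  by (rule l2_cases[of F])
    (use AE_eq_0_if_test_pairing_eq_0 in \<open>force simp: pr_abs test_L2 abs_l2_0[symmetric] abs_l2_eq_iff L2_zero\<close>)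

lemma pr_nondegenerate: "(\<And>F. pr F G = pr F H) \<Longrightarrow> G = H"
  using pr_test_eq_0[of "G - H"] by (simp add: pr.diff_left pr_commute[of G] pr_commute[of H])

lemma lamr_unique: "lamr F G \<Longrightarrow> lamr F H \<Longrightarrow> G = H"
  using pr_test_eq_0[of "G - H"] by (simp add: pr.diff_left lamr_def)

lemma lamr_add: "lamr F G \<Longrightarrow> lamr F' G' \<Longrightarrow> lamr (F + F') (G + G')"
  by (simp add: lamr_def pr.add_left)

lemma lamr_scaleR: "lamr F G \<Longrightarrow> lamr (c *\<^sub>R F) (c *\<^sub>R G)"
  by (simp add: lamr_def pr.scaleR_left)

lemma lamr_test: "test \<Phi> \<Longrightarrow> lamr (abs_l2 \<Phi>) (abs_l2 (Lam \<Phi>))"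
  by (simp add: lamr_def pr_abs test_L2 test_Lam pairing_Lam_test)

lemma dom_Lam_L2: "\<phi> \<in> dom_Lam \<Longrightarrow> \<phi> \<in> L2"
  by (auto simp: dom_Lam_def weak_Lam_def)

lemma dom_Lam_iff: "\<phi> \<in> L2 \<Longrightarrow> \<phi> \<in> dom_Lam \<longleftrightarrow> (\<exists>G. lamr (abs_l2 \<phi>) G)"
proof -
  assume \<phi>: "\<phi> \<in> L2"
  have "\<phi> \<in> dom_Lam \<longleftrightarrow> (\<exists>g\<in>L2. weak_Lam \<phi> g)"
    unfolding dom_Lam_def weak_Lam_def by blast
  also have "\<dots> \<longleftrightarrow> (\<exists>g\<in>L2. lamr (abs_l2 \<phi>) (abs_l2 g))"
    using weak_Lam_iff_lamr[OF \<phi>] by blast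
  also have "\<dots> \<longleftrightarrow> (\<exists>G. lamr (abs_l2 \<phi>) G)"
    using l2_cases by metis
  finally show ?thesis .
qed

lemma Lam_dom_lamr:
  assumes "\<phi> \<in> dom_Lam"
  shows "Lam_dom \<phi> \<in> L2" "lamr (abs_l2 \<phi>) (abs_l2 (Lam_dom \<phi>))"
proof -
  obtain g where "weak_Lam \<phi> g" using assms unfolding dom_Lam_def by blast
  then have w: "weak_Lam \<phi> (Lam_dom \<phi>)" unfolding Lam_dom_def by (rule someI[of "weak_Lam \<phi>"])
  then show "Lam_dom \<phi> \<in> L2" by (simp add: weak_Lam_def)
  with w weak_Lam_iff_lamr show "lamr (abs_l2 \<phi>) (abs_l2 (Lam_dom \<phi>))"
    by (auto simp: weak_Lam_def)
qed

text \<open>The two magnetic entries must coincide: only then can \<Lambda> pass such a multiplier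
  at the cost of a zeroth order term. \<open>A0\<close>, \<open>A_mod\<close>, \<Gamma> and
  multiplication by \<open>m\<close> all have this form.\<close>

definition dg :: "(real^2 \<Rightarrow> real) \<Rightarrow> (real^2 \<Rightarrow> real) \<Rightarrow> (real^2 \<Rightarrow> real) \<Rightarrow> real^2 \<Rightarrow> real^4^4" where
  "dg p q r x = diag (vector [p x, p x, q x, r x])"

text \<open>The zeroth order term in the commutator of \<open>\<Lambda>\<close> with \<open>dg p q r\<close>.\<close>

definition cm :: "(real^2 \<Rightarrow> real) \<Rightarrow> (real^2 \<Rightarrow> real) \<Rightarrow> real^2 \<Rightarrow> real^4^4" where
  "cm p q x = vector
     [vector [0, 0, D2 q x, 0],
      vector [0, 0, - D1 q x, 0],
      vector [D2 p x, - D1 p x, 0, 0],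
      vector [0, 0, 0, 0]]"

lemma coefficient_uminus: "coefficient f \<Longrightarrow> coefficient (\<lambda>x. - f x)"
  using coefficient_mult[OF coefficient_const[of "-1"]] by simp

lemma bdd_dg: "coefficient p \<Longrightarrow> coefficient q \<Longrightarrow> coefficient r \<Longrightarrow> bdd (dg p q r)"
proof (rule bdd_if_entries)
  fix i j :: 4
  assume "coefficient p" "coefficient q" "coefficient r"
  then show "coefficient (\<lambda>x. dg p q r x $ i $ j)"
    using exhaust_4[of i] exhaust_4[of j] by (auto simp: dg_def diag_def coefficient_const)
qed

lemma bdd_cm: "coefficient p \<Longrightarrow> coefficient q \<Longrightarrow> bdd (cm p q)"
proof (rule bdd_if_entries)
  fix i j :: 4
  assume "coefficient p" "coefficient q"
  then show "coefficient (\<lambda>x. cm p q x $ i $ j)"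
    using exhaust_4[of i] exhaust_4[of j]
    by (auto simp: cm_def coefficient_const intro!: coefficient_uminus coefficient_pd axis_Basis_2)
qed

lemma cmv_dg: "cmv (dg p q r x) v = vector [p x *\<^sub>R v $ 1, p x *\<^sub>R v $ 2, q x *\<^sub>R v $ 3, r x *\<^sub>R v $ 4]"
  by (simp add: vec_eq_iff forall_4 cmv_nth sum_4 dg_def diag_def)

lemma cmv_cm: "cmv (cm p q x) v =
    vector [D2 q x *\<^sub>R v $ 3, - (D1 q x *\<^sub>R v $ 3), D2 p x *\<^sub>R v $ 1 - D1 p x *\<^sub>R v $ 2, 0]"
  by (simp add: vec_eq_iff forall_4 cmv_nth sum_4 cm_def)

text \<open>The multiplier is moved to the test function.\<close>

lemma lamr_mulop:
  assumes c: "coefficient p" "coefficient q" "coefficient r" and l: "lamr F G"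
  shows "lamr (mulop (dg p q r) F) (mulop (dg q p (\<lambda>x. 0)) G + mulop (cm p q) F)"
  unfolding lamr_def
proof (intro allI impI)
  fix \<Phi> assume t: "test \<Phi>"
  note C = Cinf_nth[OF t[unfolded test_def, THEN conjunct1]] c[THEN coefficient_Cinf] Cinf_of_real
  obtain f where f: "f \<in> L2" "F = abs_l2 f" by (rule l2_cases)
  obtain g where g: "g \<in> L2" "G = abs_l2 g" by (rule l2_cases)
  \<comment> \<open>\<Lambda> exchanges magnetic and electric components, so \<open>p\<close> and
    \<open>q\<close> trade places; it ignores the fourth component, which allows the entry
    0.\<close>
  define \<Psi> where "\<Psi> x = cmv (dg q p (\<lambda>x. 0) x) (\<Phi> x)" for x
  have "Cinf (\<lambda>x. \<Psi> x $ i)" for i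
    using exhaust_4[of i] by (auto simp: \<Psi>_def cmv_dg scaleR_conv_of_real intro!: Cinf_mult C)
  then have "test \<Psi>"
    unfolding test_def
  proof (intro conjI Cinf_vecI)
    have "{x. \<Psi> x \<noteq> 0} \<subseteq> {x. \<Phi> x \<noteq> 0}"
      by (auto simp: \<Psi>_def bounded_bilinear.zero_right[OF cmv_bilinear])
    then show "bounded {x. \<Psi> x \<noteq> 0}" using t bounded_subset unfolding test_def by blast
  qed
  note t' = this
  note L = test_L2[OF t] test_L2[OF t'] test_L2[OF test_Lam[OF t]] test_L2[OF test_Lam[OF t']] f(1) g(1)
    app_L2[OF bdd_dg[OF c]] app_L2[OF bdd_dg[OF c(2,1) coefficient_const]] app_L2[OF bdd_cm[OF c(1,2)]]
  have Lpsi: "Lam \<Psi> x = cmv (dg p q r x) (Lam \<Phi> x) + cmv (cm q p x) (\<Phi> x)" for x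
    unfolding Lam_def \<Psi>_def cmv_dg cmv_cm
    by (simp add: vec_eq_iff forall_4 scaleR_conv_of_real pd_mult pd_of_real C algebra_simps)
  have pw: "cdot (app (dg p q r) f x) (Lam \<Phi> x) = cdot (f x) (Lam \<Psi> x) - cdot (app (cm p q) f x) (\<Phi> x)" for x
    unfolding app_cmv Lpsi cmv_dg cmv_cm by (simp add: cdot_def sum_4 scaleR_conv_of_real algebra_simps)
  have "pairing (app (dg p q r) f) (Lam \<Phi>) = pairing f (Lam \<Psi>) - pairing (app (cm p q) f) \<Phi>"
    unfolding pairing_cdot pw by (intro Bochner_Integration.integral_diff cdot_integrable L)
  also have "pairing f (Lam \<Psi>) = - pairing g \<Psi>"
    using l t' L by (auto simp: lamr_def f g pr_abs)
  also have "pairing g \<Psi> = pairing (app (dg q p (\<lambda>x. 0)) g) \<Phi>"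
    unfolding pairing_cdot app_cmv \<Psi>_def cmv_dg by (simp add: cdot_def sum_4 scaleR_conv_of_real algebra_simps)
  finally show "pr (mulop (dg p q r) F) (abs_l2 (Lam \<Phi>)) = - pr (mulop (dg q p (\<lambda>x. 0)) G + mulop (cm p q) F) (abs_l2 \<Phi>)"
    using L bdd_dg[OF c] bdd_dg[OF c(2,1) coefficient_const] bdd_cm[OF c(1,2)]
    by (simp add: f g mulop_abs pr.add_left pr_abs)
qed

section \<open>Duality for evolution families\<close>

lemma (in bounded_bilinear) weak_strong_product:
  assumes u: "((\<lambda>s. prod (u s) (v a)) has_vector_derivative d) (at a within S)"
    and v: "(v has_vector_derivative v') (at a within S)"
    and c: "(u \<longlongrightarrow> u a) (at a within S)"
  shows "((\<lambda>s. prod (u s) (v s)) has_vector_derivative d + prod (u a) v') (at a within S)"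
  unfolding has_vector_derivative_iff_quotient
proof -
  have "((\<lambda>t. (prod (u t) (v a) - prod (u a) (v a)) /\<^sub>R (t - a) + prod (u t) ((v t - v a) /\<^sub>R (t - a)))
      \<longlongrightarrow> d + prod (u a) v') (at a within S)"
    using u v by (intro tendsto_add tendsto c) (simp_all add: has_vector_derivative_iff_quotient)
  then show "((\<lambda>t. (prod (u t) (v t) - prod (u a) (v a)) /\<^sub>R (t - a)) \<longlongrightarrow> d + prod (u a) v') (at a within S)"
    by (simp add: scaleR_right diff_right scaleR_right_diff_distrib)
qed

lemma has_vector_derivative_reverse:
  assumes "(f has_vector_derivative d) (at (t - a) within X)" "a \<in> {0..t}" "{0..t} \<subseteq> X"
  shows "((\<lambda>s. f (t - s)) has_vector_derivative - d) (at a within {0..t})"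
proof -
  have "((\<lambda>s. t - s) has_vector_derivative - 1) (at a within {0..t})"
    by (auto intro!: derivative_eq_intros)
  moreover have "(f has_vector_derivative d) (at (t - a) within (\<lambda>s. t - s) ` {0..t})"
    by (rule has_vector_derivative_within_subset[OF assms(1)]) (use assms(3) in auto)
  ultimately show ?thesis using vector_diff_chain_within by (fastforce simp: o_def)
qed

text \<open>\<open>U s f\<close> is the orbit starting at \<open>U 0 f\<close>, \<open>H\<close> the graph of the transpose of its generator, and
  \<open>J\<close> conjugates the generator into \<open>H\<close>.\<close>

locale dual_evolution =
  fixes pr :: "'a::banach \<Rightarrow> 'a \<Rightarrow> 'c::banach"
    and H :: "'a \<Rightarrow> 'a \<Rightarrow> bool" and J Ji :: "'a \<Rightarrow> 'a"
    and U :: "real \<Rightarrow> 'f \<Rightarrow> 'a" and Y :: "'f set" and rep :: "'a \<Rightarrow> 'f"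
  assumes bilinear: "bounded_bilinear pr"
    and nondegenerate: "\<And>G G'. (\<And>F. pr F G = pr F G') \<Longrightarrow> G = G'"
    and H_add: "\<And>\<phi> \<phi>' \<eta> \<eta>'. H \<phi> \<eta> \<Longrightarrow> H \<phi>' \<eta>' \<Longrightarrow> H (\<phi> + \<phi>') (\<eta> + \<eta>')"
    and J: "bounded_linear J" "\<And>x. J (Ji x) = x"
    and H_closed: "\<And>F K. (\<And>\<phi> \<eta>. H \<phi> \<eta> \<Longrightarrow> pr F \<eta> = pr K \<phi>) \<Longrightarrow> H (J F) (J K)"
    and rep: "\<And>g. rep g \<in> Y" "\<And>g. U 0 (rep g) = g"
    and U_continuous: "\<And>f. f \<in> Y \<Longrightarrow> continuous_on {0..} (\<lambda>s. U s f)"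
    and U_derivative: "\<And>f \<phi> \<eta> s. f \<in> Y \<Longrightarrow> H \<phi> \<eta> \<Longrightarrow> s \<ge> 0 \<Longrightarrow>
      ((\<lambda>s. pr (U s f) \<phi>) has_vector_derivative pr (U s f) \<eta>) (at s within {0..})"
begin

interpretation pr: bounded_bilinear pr by (rule bilinear)

text \<open>The candidate for the transposed evolution: the orbit \<open>U\<close> with initial
  value \<open>Ji g\<close>, conjugated back by \<open>J\<close>.\<close>

definition S :: "real \<Rightarrow> 'a \<Rightarrow> 'a" where
  "S t g = J (U t (rep (Ji g)))"

lemma S_0: "S 0 g = g"
  by (simp add: S_def rep J)

lemma S_continuous: "continuous_on {0..} (\<lambda>s. S s g)"
  unfolding S_def by (intro bounded_linear.continuous_on[OF J(1)] U_continuous rep)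

text \<open>Integrating the weak equation over \<open>{a..b}\<close> shows that the averaged orbit
  satisfies the dual description of the domain of the generator, and \<open>H_closed\<close> carries
  it into \<open>H\<close>. Single orbit points need not have this property.\<close>

lemma integral_S_domain:
  assumes "0 \<le> a" "a \<le> b"
  shows "H (integral {a..b} (\<lambda>s. S s g)) (S b g - S a g)"
proof -
  let ?u = "\<lambda>s. U s (rep (Ji g))"
  have int: "?u integrable_on {a..b}"
    using assms by (intro integrable_continuous_real continuous_on_subset[OF U_continuous[OF rep(1)]]) auto
  have "H (J (integral {a..b} ?u)) (J (?u b - ?u a))"
  proof (rule H_closed)
    fix \<phi> \<eta> assume \<phi>: "H \<phi> \<eta>"
    have "((\<lambda>s. pr (?u s) \<eta>) has_integral (pr (?u b) \<phi> - pr (?u a) \<phi>)) {a..b}"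
      using assms
      by (intro fundamental_theorem_of_calculus
          has_vector_derivative_within_subset[OF U_derivative[OF rep(1) \<phi>]]) auto
    moreover have "integral {a..b} (\<lambda>s. pr (?u s) \<eta>) = pr (integral {a..b} ?u) \<eta>"
      using integral_linear[OF int pr.bounded_linear_left] by (simp add: o_def)
    ultimately show "pr (integral {a..b} ?u) \<eta> = pr (?u b - ?u a) \<phi>"
      by (simp add: integral_unique pr.diff_left)
  qed
  moreover have "J (integral {a..b} ?u) = integral {a..b} (\<lambda>s. S s g)"
    using integral_linear[OF int J(1)] by (simp add: o_def S_def)
  ultimately show ?thesis by (simp add: linear_diff[OF bounded_linear.linear[OF J(1)]] S_def)
qed

text \<open>Differentiating \<open>\<langle>U (t - s) f, \<integral>\<^sub>s\<^sup>s\<^sup>+\<^sup>\<epsilon> S g\<rangle>\<close> in \<open>s\<close> gives 0, because averages of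
  orbits of \<open>S\<close> lie in the domain of \<open>H\<close>; then let \<open>\<epsilon>\<close> tend to 0.\<close>

lemma U_dual:
  assumes f: "f \<in> Y" and t: "t \<ge> 0"
  shows "pr (U t f) g = pr (U 0 f) (S t g)"
proof -
  define P where "P s = integral {0..s} (\<lambda>r. S r g)" for s
  have P0: "P 0 = 0" by (simp add: P_def)
  have Pd: "(P has_vector_derivative S s g) (at s within {0..b})" if "s \<in> {0..b}" for s b
    unfolding P_def
    by (intro integral_has_vector_derivative continuous_on_subset[OF S_continuous] that) auto
  have Psh: "((\<lambda>s. P (s + e)) has_vector_derivative S (s + e) g) (at s within {0..b})"
    if "s \<in> {0..b}" "e \<ge> 0" for s b e
  proof -
    have "((\<lambda>s. s + e) has_vector_derivative 1) (at s within {0..b})"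
      by (auto intro!: derivative_eq_intros)
    moreover have "(P has_vector_derivative S (s + e) g) (at (s + e) within (\<lambda>s. s + e) ` {0..b})"
      by (rule has_vector_derivative_within_subset[OF Pd[of _ "b + e"]]) (use that in auto)
    ultimately show ?thesis using vector_diff_chain_within by (fastforce simp: o_def)
  qed
  have eq: "pr (U t f) (P e) = pr (U 0 f) (P (t + e) - P t)" if e: "e \<ge> 0" for e
  proof -
    define \<Phi> where "\<Phi> s = P (s + e) - P s" for s
    have dom: "H (\<Phi> s) (S (s + e) g - S s g)" if "s \<ge> 0" for s
    proof -
      have "\<Phi> s = integral {s..s + e} (\<lambda>r. S r g)"
        unfolding \<Phi>_def P_def using that e
          Henstock_Kurzweil_Integration.integral_combine[of 0 s "s + e" "\<lambda>r. S r g"]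
          integrable_continuous_real[OF continuous_on_subset[OF S_continuous, of "{0..s + e}"]]
        by (simp add: algebra_simps)
      with integral_S_domain[of s "s + e" g] that e show ?thesis by simp
    qed
    \<comment> \<open>By \<open>dom\<close> the image of \<open>\<Phi> a\<close> under
      \<open>H\<close> is also its strong derivative, so the two contributions cancel.\<close>
    have der: "((\<lambda>s. pr (U (t - s) f) (\<Phi> s)) has_vector_derivative 0) (at a within {0..t})" if a: "a \<in> {0..t}" for a
    proof -
      have "((\<lambda>s. pr (U (t - s) f) (\<Phi> s)) has_vector_derivative
          - pr (U (t - a) f) (S (a + e) g - S a g) + pr (U (t - a) f) (S (a + e) g - S a g)) (at a within {0..t})"
      proof (rule pr.weak_strong_product)
        show "((\<lambda>s. pr (U (t - s) f) (\<Phi> a)) has_vector_derivative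
            - pr (U (t - a) f) (S (a + e) g - S a g)) (at a within {0..t})"
          by (rule has_vector_derivative_reverse[OF U_derivative[OF f dom]]) (use a in auto)
        show "(\<Phi> has_vector_derivative S (a + e) g - S a g) (at a within {0..t})"
          unfolding \<Phi>_def by (intro has_vector_derivative_diff Psh Pd a e)
        have "continuous_on {0..t} (\<lambda>s. U (t - s) f)"
          by (rule continuous_on_compose2[OF U_continuous[OF f]]) (auto intro!: continuous_intros)
        with a show "((\<lambda>s. U (t - s) f) \<longlongrightarrow> U (t - a) f) (at a within {0..t})"
          by (simp add: continuous_on_def)
      qed
      then show ?thesis by simp
    qed
    have "pr (U (t - 0) f) (\<Phi> 0) = pr (U (t - t) f) (\<Phi> t)"
    proof (rule has_vector_derivative_zero_constant[OF convex_real_interval(5) der])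
      fix c assume "\<And>s. s \<in> {0..t} \<Longrightarrow> pr (U (t - s) f) (\<Phi> s) = c"
      from this[of 0] this[of t] t show ?thesis by simp
    qed
    then show ?thesis by (simp add: \<Phi>_def P0)
  qed
  \<comment> \<open>The limit of small averages is taken by differentiating both sides of
    \<open>eq\<close> at \<open>e = 0\<close>, where \<open>S 0 g = g\<close>.\<close>
  have "((\<lambda>e. pr (U t f) (P e)) has_vector_derivative pr (U t f) (S 0 g)) (at 0 within {0..1})"
    by (intro bounded_linear.has_vector_derivative[OF pr.bounded_linear_right] Pd) simp
  moreover have "((\<lambda>e. pr (U 0 f) (P (e + t) - P t)) has_vector_derivative pr (U 0 f) (S (0 + t) g - 0)) (at 0 within {0..1})"
    by (intro bounded_linear.has_vector_derivative[OF pr.bounded_linear_right] has_vector_derivative_diff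
        has_vector_derivative_const Psh t) simp
  then have "((\<lambda>e. pr (U t f) (P e)) has_vector_derivative pr (U 0 f) (S (0 + t) g - 0)) (at 0 within {0..1})"
    by (rule has_vector_derivative_transform[rotated 2]) (auto simp: eq add.commute)
  ultimately have "pr (U t f) (S 0 g) = pr (U 0 f) (S (0 + t) g - 0)"
    by (rule vector_derivative_unique_within[rotated]) (simp add: trivial_limit_within)
  then show ?thesis by (simp add: S_0)
qed

text \<open>Duality moves the integrated weak equation of \<open>U\<close> onto \<open>S\<close>.
  The integral of the continuous orbit exists in norm, so nondegeneracy upgrades the weak identity
  to an equation in the space; strong differentiability follows from it.\<close>

lemma S_eq_integral:
  assumes \<phi>: "H \<phi> \<eta>" and t: "t \<ge> 0"
  shows "S t \<phi> = \<phi> + integral {0..t} (\<lambda>s. S s \<eta>)"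
proof (rule nondegenerate)
  fix F
  have int: "(\<lambda>s. S s \<eta>) integrable_on {0..t}"
    by (intro integrable_continuous_real continuous_on_subset[OF S_continuous]) auto
  have "((\<lambda>s. pr (U s (rep F)) \<eta>) has_integral (pr (U t (rep F)) \<phi> - pr (U 0 (rep F)) \<phi>)) {0..t}"
    using t by (intro fundamental_theorem_of_calculus
          has_vector_derivative_within_subset[OF U_derivative[OF rep(1) \<phi>]]) auto
  moreover have dual: "pr (U s (rep F)) G = pr F (S s G)" if "s \<ge> 0" for s G
    using U_dual[OF rep(1) that, of F G] by (simp add: rep(2))
  ultimately have "((\<lambda>s. pr (U s (rep F)) \<eta>) has_integral (pr F (S t \<phi>) - pr F \<phi>)) {0..t}"
    using t by (simp add: S_0)
  then have "((\<lambda>s. pr F (S s \<eta>)) has_integral (pr F (S t \<phi>) - pr F \<phi>)) {0..t}"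
    by (rule has_integral_eq[rotated]) (simp add: dual)
  moreover have "integral {0..t} (\<lambda>s. pr F (S s \<eta>)) = pr F (integral {0..t} (\<lambda>s. S s \<eta>))"
    using integral_linear[OF int pr.bounded_linear_right] by (simp add: o_def)
  ultimately have "pr F (S t \<phi>) - pr F \<phi> = pr F (integral {0..t} (\<lambda>s. S s \<eta>))"
    by (simp add: integral_unique)
  then show "pr F (S t \<phi>) = pr F (\<phi> + integral {0..t} (\<lambda>s. S s \<eta>))"
    by (simp add: pr.add_right diff_eq_eq add.commute)
qed

text \<open>By \<open>S_eq_integral\<close> the point \<open>S t \<phi>\<close> is
  \<open>\<phi>\<close> plus an averaged orbit of \<open>\<eta>\<close>, and \<open>H\<close> maps
  the latter to \<open>S t \<eta> - \<eta>\<close>.\<close>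

lemma S_domain:
  assumes "H \<phi> \<eta>" "t \<ge> 0"
  shows "H (S t \<phi>) (S t \<eta>)"
  using H_add[OF assms(1) integral_S_domain[of 0 t \<eta>]] assms by (simp add: S_eq_integral[OF assms] S_0)

lemma S_derivative:
  assumes "H \<phi> \<eta>" "t \<in> {0..b}"
  shows "((\<lambda>s. S s \<phi>) has_vector_derivative S t \<eta>) (at t within {0..b})"
proof -
  have "((\<lambda>s. \<phi> + integral {0..s} (\<lambda>s. S s \<eta>)) has_vector_derivative 0 + S t \<eta>) (at t within {0..b})"
    by (intro has_vector_derivative_add has_vector_derivative_const integral_has_vector_derivative
        continuous_on_subset[OF S_continuous] assms(2)) auto
  then have der: "((\<lambda>s. \<phi> + integral {0..s} (\<lambda>s. S s \<eta>)) has_vector_derivative S t \<eta>) (at t within {0..b})"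
    by simp
  have "S s \<phi> = \<phi> + integral {0..s} (\<lambda>s. S s \<eta>)" if "s \<in> {0..b}" for s
    using S_eq_integral[OF assms(1)] that by simp
  from has_vector_derivative_transform[OF assms(2) this der] show ?thesis .
qed

end

section \<open>Time derivatives\<close>

lemma at_within_atLeast_nontrivial: "t \<ge> 0 \<Longrightarrow> at t within {0..} \<noteq> (bot :: real filter)"
proof -
  assume "t \<ge> (0::real)"
  then have "at t within {t..t + 1} \<le> at t within {0..}" by (intro at_le) auto
  moreover have "at t within {t..t + 1} \<noteq> bot" by (simp add: trivial_limit_within)
  ultimately show ?thesis by (metis le_bot)
qed

lemma dt_eqI:
  assumes "((\<lambda>s. pairing (X s) \<phi>) has_vector_derivative d) (at t within {0..})" "t \<ge> 0"
  shows "dt X t \<phi> = d"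
  unfolding dt_def
  by (rule vector_derivative_within[OF at_within_atLeast_nontrivial[OF assms(2)] assms(1)])

lemma pairing_derivative_iff:
  assumes "\<And>s. s \<ge> 0 \<Longrightarrow> X s \<in> L2" "\<phi> \<in> L2" "t \<ge> 0"
  shows "((\<lambda>s. pairing (X s) \<phi>) has_vector_derivative d) (at t within {0..})
    \<longleftrightarrow> ((\<lambda>s. pr (abs_l2 (X s)) (abs_l2 \<phi>)) has_vector_derivative d) (at t within {0..})"
proof -
  have e: "pr (abs_l2 (X s)) (abs_l2 \<phi>) = pairing (X s) \<phi>" if "s \<in> {0..}" for s
    using assms that by (simp add: pr_abs)
  show ?thesis
    using has_vector_derivative_transform[of t "{0..}" "\<lambda>s. pr (abs_l2 (X s)) (abs_l2 \<phi>)" "\<lambda>s. pairing (X s) \<phi>" d]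
      has_vector_derivative_transform[of t "{0..}" "\<lambda>s. pairing (X s) \<phi>" "\<lambda>s. pr (abs_l2 (X s)) (abs_l2 \<phi>)" d]
      e assms(3) by (auto simp: e)
qed

lemma dt_exists_derivative:
  assumes "dt_exists X t" "\<phi> \<in> dom_Lam" "\<And>s. s \<ge> 0 \<Longrightarrow> X s \<in> L2" "t \<ge> 0"
  shows "((\<lambda>s. pr (abs_l2 (X s)) (abs_l2 \<phi>)) has_vector_derivative dt X t \<phi>) (at t within {0..})"
  using assms unfolding dt_exists_def dt_def
  by (subst pairing_derivative_iff[symmetric]) (auto simp: vector_derivative_works dom_Lam_L2)

lemma solution_L2: "solution A B w W \<Longrightarrow> t \<ge> 0 \<Longrightarrow> W t \<in> L2"
  by (simp add: solution_def)

lemma solution_0: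
  assumes "solution A B w W" "w \<in> L2"
  shows "abs_l2 (W 0) = abs_l2 w"
  using assms abs_l2_eq_iff[OF solution_L2[OF assms(1), of 0] assms(2)] by (simp add: solution_def)

lemma solution_continuous:
  assumes "solution A B w W"
  shows "continuous_on {0..} (\<lambda>s. abs_l2 (W s))"
  unfolding continuous_on_def
proof
  fix t :: real assume t: "t \<in> {0..}"
  have L: "W s \<in> L2" if "s \<ge> 0" for s using solution_L2[OF assms that] .
  have "((\<lambda>s. L2norm (\<lambda>x. W s x - W t x)) \<longlongrightarrow> 0) (at t within {0..})"
    using assms t by (simp add: solution_def)
  then have "((\<lambda>s. norm (abs_l2 (W s) - abs_l2 (W t))) \<longlongrightarrow> 0) (at t within {0..})"
  proof (rule Lim_transform_eventually)
    show "\<forall>\<^sub>F s in at t within {0..}. L2norm (\<lambda>x. W s x - W t x) = norm (abs_l2 (W s) - abs_l2 (W t))"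
      using t L by (auto simp: eventually_at_filter abs_l2_diff[symmetric] norm_abs_l2 L2_diff intro!: always_eventually)
  qed
  then show "((\<lambda>s. abs_l2 (W s)) \<longlongrightarrow> abs_l2 (W t)) (at t within {0..})"
    by (simp add: tendsto_norm_zero_iff LIM_zero_iff)
qed

text \<open>The coefficient is frozen at time \<open>t\<close> and moved to the test element. Weak
  derivatives are available only against the domain of \<Lambda>, so both \<open>\<theta>\<close>
  and its image must lie there.\<close>

lemma solution_derivative:
  assumes s: "solution A B w W" and t: "t \<ge> 0"
    and \<theta>: "lamr \<theta> G" and A: "bdd (\<lambda>x. transpose (A t x))" "lamr (mulop (\<lambda>x. transpose (A t x)) \<theta>) G'"
    and B: "bdd (B t)" "bdd (\<lambda>x. transpose (B t x))"
  shows "((\<lambda>s. pr (abs_l2 (W s)) (mulop (\<lambda>x. transpose (A t x)) \<theta>))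
    has_vector_derivative pr (abs_l2 (W t)) (G - mulop (\<lambda>x. transpose (B t x)) \<theta>)) (at t within {0..})"
proof -
  obtain \<phi> where \<phi>: "\<phi> \<in> L2" "\<theta> = abs_l2 \<phi>" by (rule l2_cases)
  have dom: "\<phi> \<in> dom_Lam" using \<theta> \<phi> dom_Lam_iff by blast
  let ?A = "app (\<lambda>x. transpose (A t x)) \<phi>"
  have AL: "?A \<in> L2" and Ae: "mulop (\<lambda>x. transpose (A t x)) \<theta> = abs_l2 ?A"
    using A(1) \<phi> by (simp_all add: app_L2 mulop_abs)
  have Adom: "?A \<in> dom_Lam" using A(2) AL dom_Lam_iff by (auto simp: Ae)
  have L: "W s \<in> L2" if "s \<ge> 0" for s using solution_L2[OF assms(1) that] .
  have "dt_exists W t" and eq: "app_fun (A t) (dt W t) \<phi> + Lam_ext (W t) \<phi> + pairing (app (B t) (W t)) \<phi> = 0"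
    using s t dom by (simp_all add: solution_def)
  from dt_exists_derivative[OF this(1) Adom L t]
  have "((\<lambda>s. pr (abs_l2 (W s)) (abs_l2 ?A)) has_vector_derivative dt W t ?A) (at t within {0..})"
    by simp
  note der = this
  have "G = abs_l2 (Lam_dom \<phi>)"
    using lamr_unique \<theta> Lam_dom_lamr(2)[OF dom] \<phi>(2) by blast
  then have "Lam_ext (W t) \<phi> = - pr (abs_l2 (W t)) G"
    using L[OF t] Lam_dom_lamr(1)[OF dom] by (simp add: Lam_ext_def pr_abs)
  moreover have "pairing (app (B t) (W t)) \<phi> = pr (abs_l2 (W t)) (mulop (\<lambda>x. transpose (B t x)) \<theta>)"
    using B L[OF t] \<phi> by (simp add: pr_abs[symmetric] app_L2 mulop_abs[symmetric] pr_mulop)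
  ultimately have "dt W t ?A + (- pr (abs_l2 (W t)) G) + pr (abs_l2 (W t)) (mulop (\<lambda>x. transpose (B t x)) \<theta>) = 0"
    using eq by (simp only: app_fun_def)
  moreover have "d = p - q" if "d + (- p) + q = 0" for d p q :: complex
    using that by algebra
  ultimately have "dt W t ?A = pr (abs_l2 (W t)) (G - mulop (\<lambda>x. transpose (B t x)) \<theta>)"
    by (simp only: pr.diff_right)
  with der show ?thesis by (simp add: Ae)
qed

section \<open>The medium\<close>

lemma cmv_id: "cmv (dg (\<lambda>x. 1) (\<lambda>x. 1) (\<lambda>x. 1) x) v = v"
  by (simp add: cmv_dg vec_eq_iff forall_4)

lemma mulop_id: "mulop (dg (\<lambda>x. 1) (\<lambda>x. 1) (\<lambda>x. 1)) F = F"
  by (rule l2_cases[of F]) (simp add: mulop_abs bdd_dg coefficient_const app_cmv[abs_def] cmv_id)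

lemma mulop_comp_commute:
  assumes "bdd M" "bdd N" "bdd M'" "bdd N'" "\<And>x v. cmv (M x) (cmv (N x) v) = cmv (M' x) (cmv (N' x) v)"
  shows "mulop M (mulop N F) = mulop M' (mulop N' F)"
proof -
  obtain f where f: "f \<in> L2" "F = abs_l2 f" by (rule l2_cases)
  have "app M (app N f) = app M' (app N' f)" by (rule ext) (simp add: app_cmv assms(5))
  then show ?thesis using assms f by (simp add: mulop_abs app_L2)
qed

lemma mulop_comp_eqI:
  assumes "bdd M" "bdd N" "bdd K" "\<And>x v. cmv (M x) (cmv (N x) v) = cmv (K x) v"
  shows "mulop M (mulop N F) = mulop K F"
proof -
  obtain f where f: "f \<in> L2" "F = abs_l2 f" by (rule l2_cases)
  have "app M (app N f) = app K f" by (rule ext) (simp add: app_cmv assms(4))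
  then show ?thesis using assms f by (simp add: mulop_abs app_L2)
qed

lemma mulop_eq_0:
  assumes "bdd M" "\<And>x v. cmv (M x) v = 0"
  shows "mulop M F = 0"
  using assms by (rule_tac l2_cases[of F]) (simp add: mulop_abs app_cmv[abs_def] abs_l2_0)

lemma mulop_neg_id: "mulop (dg (\<lambda>x. - 1) (\<lambda>x. - 1) (\<lambda>x. - 1)) F = - F"
proof -
  have "cmv (dg (\<lambda>x. - 1) (\<lambda>x. - 1) (\<lambda>x. - 1) x) v = - v" for x v
    by (simp add: cmv_dg vec_eq_iff forall_4)
  then show ?thesis
    by (rule_tac l2_cases[of F])
      (simp add: mulop_abs bdd_dg coefficient_const app_cmv[abs_def] abs_l2_uminus)
qed

lemma pd_const [simp]: "pd b (\<lambda>x. c) x = 0"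
  by (rule pd_eq) simp

lemma mulop_cm_const: "mulop (cm (\<lambda>x. c) (\<lambda>x. d)) F = 0"
  by (rule mulop_eq_0) (auto intro!: bdd_cm coefficient_const simp: cmv_cm vec_eq_iff forall_4)

text \<open>An image under \<Lambda> has vanishing fourth component: multiplying by the identity and
  comparing values gives \<open>G = mulop ?i G\<close>. Hence the fourth entry \<open>r'\<close> is
  free and can be chosen to make matrices match.\<close>

lemma lamr_mulop':
  assumes c: "coefficient p" "coefficient q" "coefficient r" "coefficient r'" and l: "lamr F G"
  shows "lamr (mulop (dg p q r) F) (mulop (dg q p r') G + mulop (cm p q) F)"
proof -
  let ?i = "dg (\<lambda>x. 1) (\<lambda>x. 1) (\<lambda>x. 0)"
  note k = coefficient_const
  have "lamr F (mulop ?i G)"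
    using lamr_mulop[OF k[of 1] k[of 1] k[of 1] l] by (simp only: mulop_id mulop_cm_const add_0_right)
  then have "G = mulop ?i G" by (rule lamr_unique[OF l])
  moreover have "mulop (dg q p r') (mulop ?i G) = mulop (dg q p (\<lambda>x. 0)) G"
    by (rule mulop_comp_eqI) (auto intro!: bdd_dg c k simp: cmv_dg)
  ultimately have "mulop (dg q p r') G = mulop (dg q p (\<lambda>x. 0)) G" by simp
  with lamr_mulop[OF c(1-3) l] show ?thesis by simp
qed

lemma matrix_inv_eqI:
  fixes A B :: "real^'n^'n"
  assumes "A ** B = mat 1" "B ** A = mat 1"
  shows "matrix_inv A = B"
proof -
  have "A ** matrix_inv A = mat 1 \<and> matrix_inv A ** A = mat 1"
    unfolding matrix_inv_def by (rule someI[of _ B]) (use assms in simp)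
  then have "matrix_inv A ** (A ** B) = B" by (simp add: matrix_mul_assoc)
  with assms show ?thesis by simp
qed

lemma dg_mult: "dg p q r x ** dg p' q' r' x = dg (\<lambda>x. p x * p' x) (\<lambda>x. q x * q' x) (\<lambda>x. r x * r' x) x"
  by (simp add: vec_eq_iff forall_4 matrix_matrix_mult_def sum_4 dg_def diag_def)

lemma dg_1: "dg (\<lambda>x. 1) (\<lambda>x. 1) (\<lambda>x. 1) x = mat 1"
  by (simp add: vec_eq_iff forall_4 dg_def diag_def mat_def)

lemma transpose_dg [simp]: "transpose (dg p q r x) = dg p q r x"
  by (simp add: vec_eq_iff forall_4 transpose_def dg_def diag_def)

locale background =
  fixes M :: medium and U0 :: "real \<Rightarrow> field \<Rightarrow> field"
  assumes medium: "admissible_medium M" and group: "background_group M U0"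
begin

text \<open>\<open>a3\<close> and \<open>a4\<close> are the last diagonal entries of
  \<open>A0\<close>, and \<open>b3\<close> is the third diagonal entry of \<open>B0\<close>; the
  quotient \<open>b3 / a3\<close> is \<open>q0\<close>.\<close>

definition a3 :: "real^2 \<Rightarrow> real" where "a3 x = eps0 M * eps_inf M x"
definition a4 :: "real^2 \<Rightarrow> real" where "a4 x = inverse (eps0 M * d_eps M x)"
definition b3 :: "real^2 \<Rightarrow> real" where "b3 x = sigma M x + eps0 M * d_eps M x / tau_D M x"

lemma pos: "mu M > 0" "eps0 M > 0" "eps_inf M x > 0" "d_eps M x > 0" "tau_D M x > 0"
  using medium unfolding admissible_medium_def by (force intro: less_le_trans)+

lemma nz: "mu M \<noteq> 0" "eps0 M \<noteq> 0" "eps_inf M x \<noteq> 0" "d_eps M x \<noteq> 0" "tau_D M x \<noteq> 0" "a3 x \<noteq> 0" "a4 x \<noteq> 0"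
  using pos(1,2) pos(3,4,5)[of x] by (auto simp: a3_def a4_def)

lemma coeffs: "coefficient (eps_inf M)" "coefficient (d_eps M)" "coefficient (tau_D M)" "coefficient (sigma M)"
  using medium unfolding admissible_medium_def by auto

lemma a_coeffs: "coefficient a3" "coefficient a4" "coefficient b3" "coefficient (\<lambda>x. inverse (tau_D M x))"
  unfolding a3_def[abs_def] a4_def[abs_def] b3_def[abs_def] divide_inverse
  by (intro coefficient_inverse coefficient_mult coefficient_add coefficient_const coeffs;
      use nz in simp)+

lemma A0_dg: "A0 M = dg (\<lambda>x. mu M) a3 a4"
  by (rule ext) (simp add: A0_def A_mod_def eps_D_def dg_def a3_def a4_def divide_inverse)

lemma A0_inv_dg: "A0_inv M = dg (\<lambda>x. inverse (mu M)) (\<lambda>x. inverse (a3 x)) (\<lambda>x. inverse (a4 x))"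
  unfolding A0_inv_def A0_dg
  by (rule ext, rule matrix_inv_eqI) (simp_all add: dg_mult nz dg_1)

lemma transpose_A0 [simp]: "transpose (A0 M x) = A0 M x" "transpose (A0_inv M x) = A0_inv M x"
  by (simp_all add: A0_dg A0_inv_dg)

lemma cmv_B0: "cmv (B0 M x) v = vector [0, 0, b3 x *\<^sub>R v $ 3 - inverse (tau_D M x) *\<^sub>R v $ 4,
    - (inverse (tau_D M x) *\<^sub>R v $ 3) + (a4 x * inverse (tau_D M x)) *\<^sub>R v $ 4]"
  by (simp add: vec_eq_iff forall_4 cmv_nth sum_4 B0_def B_mod_def eps_D_def a4_def b3_def divide_inverse)

lemma transpose_B0 [simp]: "transpose (B0 M x) = B0 M x"
  by (simp add: vec_eq_iff forall_4 transpose_def B0_def B_mod_def)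

lemma bdd_B0: "bdd (B0 M)"
proof (rule bdd_if_entries)
  fix i j :: 4
  have "coefficient (\<lambda>x. sigma M x + eps0 M * d_eps M x / tau_D M x)"
    "coefficient (\<lambda>x. inverse (eps0 M * d_eps M x * tau_D M x))" "coefficient (\<lambda>x. inverse (tau_D M x))"
    unfolding divide_inverse
    by (intro coefficient_inverse coefficient_mult coefficient_add coefficient_const coeffs; use nz in simp)+
  note c = this
  show "coefficient (\<lambda>x. B0 M x $ i $ j)"
    using exhaust_4[of i] exhaust_4[of j] c coefficient_uminus[OF c(3)]
    by (auto simp: B0_def B_mod_def eps_D_def coefficient_const divide_inverse simp del: inverse_mult_distrib)
qed

lemma bdd_A0: "bdd (A0 M)" "bdd (A0_inv M)"
  unfolding A0_dg A0_inv_dg by (intro bdd_dg coefficient_inverse coefficient_const a_coeffs nz)+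

lemma A0_A0_inv: "mulop (A0 M) (mulop (A0_inv M) F) = F" "mulop (A0_inv M) (mulop (A0 M) F) = F"
proof -
  have "mulop (A0 M) (mulop (A0_inv M) F) = mulop (dg (\<lambda>x. 1) (\<lambda>x. 1) (\<lambda>x. 1)) F"
    "mulop (A0_inv M) (mulop (A0 M) F) = mulop (dg (\<lambda>x. 1) (\<lambda>x. 1) (\<lambda>x. 1)) F"
    by (intro mulop_comp_eqI bdd_A0 bdd_dg coefficient_const;
        simp add: A0_dg A0_inv_dg cmv_dg vec_eq_iff forall_4 nz)+
  then show "mulop (A0 M) (mulop (A0_inv M) F) = F" "mulop (A0_inv M) (mulop (A0 M) F) = F"
    by (simp_all add: mulop_id)
qed

lemma lamr_A0: "lamr F G \<Longrightarrow> \<exists>G'. lamr (mulop (A0 M) F) G'" "lamr F G \<Longrightarrow> \<exists>G'. lamr (mulop (A0_inv M) F) G'"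
  unfolding A0_dg A0_inv_dg
  using lamr_mulop[OF coefficient_const a_coeffs(1,2)]
    lamr_mulop[OF coefficient_const coefficient_inverse[OF a_coeffs(1) nz(6)] coefficient_inverse[OF a_coeffs(2) nz(7)]]
  by blast+

text \<open>The graph of the transpose of the background generator.\<close>

definition H :: "l2 \<Rightarrow> l2 \<Rightarrow> bool" where
  "H \<phi> \<eta> \<longleftrightarrow> (\<exists>G. lamr (mulop (A0_inv M) \<phi>) G \<and> \<eta> = G - mulop (B0 M) (mulop (A0_inv M) \<phi>))"

lemma H_A0: "lamr \<theta> G \<Longrightarrow> H (mulop (A0 M) \<theta>) (G - mulop (B0 M) \<theta>)"
  by (auto simp: H_def A0_A0_inv)

lemma Gam_dg: "(\<lambda>x. Gam) = dg (\<lambda>x. - 1) (\<lambda>x. 1) (\<lambda>x. 1)"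
  by (rule ext) (simp add: Gam_def dg_def)

text \<open>Testing with smooth compactly supported fields already identifies
  \<open>\<Lambda> F\<close> with \<open>- (A_0 K + B_0 F)\<close>, so \<open>K\<close> is the
  background generator applied to \<open>F\<close>. Conjugation by \<open>\<Gamma>\<close> reverses
  the sign of \<Lambda> and produces the transposed generator.\<close>

lemma H_closed:
  assumes "\<And>\<phi> \<eta>. H \<phi> \<eta> \<Longrightarrow> pr F \<eta> = pr K \<phi>"
  shows "H (mulop (A0 M) (mulop (\<lambda>x. Gam) F)) (mulop (A0 M) (mulop (\<lambda>x. Gam) K))"
proof -
  let ?R = "mulop (A0 M) K + mulop (B0 M) F"
  note k = coefficient_const
  have "lamr F (- ?R)"
    unfolding lamr_def
  proof (intro allI impI)
    fix \<Phi> assume "test \<Phi>"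
    from assms[OF H_A0[OF lamr_test[OF this]]]
    have "pr F (abs_l2 (Lam \<Phi>)) - pr F (mulop (B0 M) (abs_l2 \<Phi>)) = pr K (mulop (A0 M) (abs_l2 \<Phi>))"
      by (simp add: pr.diff_right)
    moreover have "pr F (mulop (B0 M) (abs_l2 \<Phi>)) = pr (mulop (B0 M) F) (abs_l2 \<Phi>)"
      using pr_mulop[of "B0 M"] bdd_B0 by simp
    moreover have "pr K (mulop (A0 M) (abs_l2 \<Phi>)) = pr (mulop (A0 M) K) (abs_l2 \<Phi>)"
      using pr_mulop[of "A0 M"] bdd_A0 by (simp add: A0_dg)
    ultimately show "pr F (abs_l2 (Lam \<Phi>)) = - pr (- ?R) (abs_l2 \<Phi>)"
      by (simp add: pr.minus_left pr.add_left pr.diff_left diff_eq_eq)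
  qed
  \<comment> \<open>\<open>\<Gamma>\<close> is \<open>dg (-1) 1 1\<close>; passing \<Lambda>
    interchanges its entries, and the free fourth entry -1 makes the result
    \<open>- \<Gamma>\<close>.\<close>
  from lamr_mulop'[OF k k k k this, of "-1" 1 1 "-1"]
  have "lamr (mulop (\<lambda>x. Gam) F) (mulop (dg (\<lambda>x. 1) (\<lambda>x. - 1) (\<lambda>x. - 1)) (- ?R) + mulop (cm (\<lambda>x. - 1) (\<lambda>x. 1)) F)"
    by (simp add: Gam_dg)
  moreover have "mulop (dg (\<lambda>x. 1) (\<lambda>x. - 1) (\<lambda>x. - 1)) (- ?R) = mulop (\<lambda>x. Gam) ?R"
    unfolding Gam_dg mulop_neg_id[symmetric]
    by (rule mulop_comp_eqI) (auto intro!: bdd_dg k simp: cmv_dg)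
  ultimately have "lamr (mulop (\<lambda>x. Gam) F) (mulop (\<lambda>x. Gam) ?R)"
    by (simp only: mulop_cm_const add_0_right)
  from H_A0[OF this] have "H (mulop (A0 M) (mulop (\<lambda>x. Gam) F))
      (mulop (\<lambda>x. Gam) ?R - mulop (B0 M) (mulop (\<lambda>x. Gam) F))" .
  moreover have "mulop (\<lambda>x. Gam) (mulop (A0 M) K) = mulop (A0 M) (mulop (\<lambda>x. Gam) K)"
    unfolding Gam_dg A0_dg by (rule mulop_comp_commute) (auto intro!: bdd_dg k a_coeffs simp: cmv_dg)
  moreover have "mulop (\<lambda>x. Gam) (mulop (B0 M) F) = mulop (B0 M) (mulop (\<lambda>x. Gam) F)"
    unfolding Gam_dg by (rule mulop_comp_commute) (auto intro!: bdd_dg k bdd_B0 simp: cmv_dg cmv_B0)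
  ultimately show ?thesis by (simp add: mulop_add)
qed

lemma H_add: "H \<phi> \<eta> \<Longrightarrow> H \<phi>' \<eta>' \<Longrightarrow> H (\<phi> + \<phi>') (\<eta> + \<eta>')"
  unfolding H_def mulop_add
proof (elim exE conjE)
  fix G G'
  assume "lamr (mulop (A0_inv M) \<phi>) G" "lamr (mulop (A0_inv M) \<phi>') G'"
    "\<eta> = G - mulop (B0 M) (mulop (A0_inv M) \<phi>)" "\<eta>' = G' - mulop (B0 M) (mulop (A0_inv M) \<phi>')"
  then show "\<exists>G. lamr (mulop (A0_inv M) \<phi> + mulop (A0_inv M) \<phi>') G \<and>
      \<eta> + \<eta>' = G - (mulop (B0 M) (mulop (A0_inv M) \<phi>) + mulop (B0 M) (mulop (A0_inv M) \<phi>'))"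
    by (intro exI[of _ "G + G'"]) (simp add: lamr_add)
qed

lemma U0_solution: "f \<in> L2 \<Longrightarrow> solution (\<lambda>t. A0 M) (\<lambda>t. B0 M) f (\<lambda>t. U0 t f)"
  using group by (simp add: background_group_def)

lemma U0_derivative:
  assumes "f \<in> L2" "H \<phi> \<eta>" "s \<ge> 0"
  shows "((\<lambda>s. pr (abs_l2 (U0 s f)) \<phi>) has_vector_derivative pr (abs_l2 (U0 s f)) \<eta>) (at s within {0..})"
proof -
  obtain G where G: "lamr (mulop (A0_inv M) \<phi>) G" "\<eta> = G - mulop (B0 M) (mulop (A0_inv M) \<phi>)"
    using assms(2) by (auto simp: H_def)
  have "\<exists>G'. lamr \<phi> G'" using lamr_A0(1)[OF G(1)] by (simp add: A0_A0_inv)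
  then obtain G' where "lamr \<phi> G'" ..
  with solution_derivative[OF U0_solution[OF assms(1)] assms(3) G(1), of G'] show ?thesis
    by (simp add: G(2) bdd_A0 bdd_B0 A0_A0_inv)
qed

sublocale dual: dual_evolution pr H "\<lambda>F. mulop (A0 M) (mulop (\<lambda>x. Gam) F)"
  "\<lambda>F. mulop (\<lambda>x. Gam) (mulop (A0_inv M) F)" "\<lambda>t f. abs_l2 (U0 t f)" L2 rep_l2
proof (rule dual_evolution.intro)
  show "bounded_bilinear pr" by (rule pr_bilinear)
  show "G = G'" if "\<And>F. pr F G = pr F G'" for G G' by (rule pr_nondegenerate[OF that])
  show "bounded_linear (\<lambda>F. mulop (A0 M) (mulop (\<lambda>x. Gam) F))"
    by (intro bounded_linear_compose[OF mulop_bounded_linear mulop_bounded_linear])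
  show "mulop (A0 M) (mulop (\<lambda>x. Gam) (mulop (\<lambda>x. Gam) (mulop (A0_inv M) F))) = F" for F
  proof -
    have "mulop (\<lambda>x. Gam) (mulop (\<lambda>x. Gam) (mulop (A0_inv M) F)) = mulop (dg (\<lambda>x. 1) (\<lambda>x. 1) (\<lambda>x. 1)) (mulop (A0_inv M) F)"
      unfolding Gam_dg by (rule mulop_comp_eqI) (auto intro!: bdd_dg coefficient_const simp: cmv_dg)
    then show ?thesis by (simp add: mulop_id A0_A0_inv)
  qed
  show "abs_l2 (U0 0 (rep_l2 F)) = F" for F
    using solution_0[OF U0_solution[OF rep_l2_L2] rep_l2_L2] by simp
  show "H (\<phi> + \<phi>') (\<eta> + \<eta>')" if "H \<phi> \<eta>" "H \<phi>' \<eta>'" for \<phi> \<phi>' \<eta> \<eta>'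
    using that by (rule H_add)
  show "H (mulop (A0 M) (mulop (\<lambda>x. Gam) F)) (mulop (A0 M) (mulop (\<lambda>x. Gam) K))"
    if "\<And>\<phi> \<eta>. H \<phi> \<eta> \<Longrightarrow> pr F \<eta> = pr K \<phi>" for F K by (rule H_closed[OF that])
  show "continuous_on {0..} (\<lambda>s. abs_l2 (U0 s f))" if "f \<in> L2" for f
    by (rule solution_continuous[OF U0_solution[OF that]])
  show "((\<lambda>s. pr (abs_l2 (U0 s f)) \<phi>) has_vector_derivative pr (abs_l2 (U0 s f)) \<eta>) (at s within {0..})"
    if "f \<in> L2" "H \<phi> \<eta>" "0 \<le> s" for f \<phi> \<eta> s by (rule U0_derivative[OF that])
qed simp

end

section \<open>The modulated medium\<close>

text \<open>Counterpart of \<open>dt\<close> on classes, independent of the representative of the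
  test element.\<close>

definition dv :: "(real \<Rightarrow> l2) \<Rightarrow> real \<Rightarrow> l2 \<Rightarrow> complex" where
  "dv x t \<xi> = vector_derivative (\<lambda>s. pr (x s) \<xi>) (at t within {0..})"

lemma dv_eqI:
  "((\<lambda>s. pr (x s) \<xi>) has_vector_derivative d) (at t within {0..}) \<Longrightarrow> t \<ge> 0 \<Longrightarrow> dv x t \<xi> = d"
  unfolding dv_def by (rule vector_derivative_within[OF at_within_atLeast_nontrivial])

text \<open>Transfers pointwise matrix identities to operators. Four terms cover the longest
  identity needed; shorter ones are padded with coefficient 0.\<close>

lemma mulop_comb:
  assumes "bdd M" "bdd N" "bdd K0" "bdd K1" "bdd K2" "bdd K3"
    and "\<And>x v. cmv (M x) (cmv (N x) v) = cmv (K0 x) v + a1 *\<^sub>R cmv (K1 x) v + a2 *\<^sub>R cmv (K2 x) v + a3 *\<^sub>R cmv (K3 x) v"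
  shows "mulop M (mulop N F) = mulop K0 F + a1 *\<^sub>R mulop K1 F + a2 *\<^sub>R mulop K2 F + a3 *\<^sub>R mulop K3 F"
proof -
  obtain f where f: "f \<in> L2" "F = abs_l2 f" by (rule l2_cases)
  have "app M (app N f) = (\<lambda>x. app K0 f x + a1 *\<^sub>R app K1 f x + a2 *\<^sub>R app K2 f x + a3 *\<^sub>R app K3 f x)"
    by (rule ext) (simp add: app_cmv assms(7))
  then show ?thesis
    using assms f by (simp add: mulop_abs app_L2 abs_l2_add[symmetric] abs_l2_scaleR[symmetric] L2_add L2_scaleR)
qed

section \<open>The transposed background group on test elements\<close>

context background
begin

text \<open>A choice operator says nothing until a transpose exists: \<open>dual.S\<close> provides
  the witness, and nondegeneracy of the pairing makes its class unique.\<close>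

lemma transp_U0:
  assumes \<phi>: "\<phi> \<in> L2" and t: "t \<ge> 0"
  shows "Defs.transp (U0 t) \<phi> \<in> L2" "abs_l2 (Defs.transp (U0 t) \<phi>) = dual.S t (abs_l2 \<phi>)"
proof -
  let ?P = "\<lambda>\<psi>. \<psi> \<in> L2 \<and> (\<forall>f\<in>L2. pairing (U0 t f) \<phi> = pairing f \<psi>)"
  have UL: "U0 t f \<in> L2" if "f \<in> L2" for f using solution_L2[OF U0_solution[OF that] t] .
  have U0: "abs_l2 (U0 0 f) = abs_l2 f" if "f \<in> L2" for f using solution_0[OF U0_solution[OF that] that] .
  have "?P (rep_l2 (dual.S t (abs_l2 \<phi>)))"
  proof (intro conjI ballI rep_l2_L2)
    fix f assume f: "f \<in> L2"
    show "pairing (U0 t f) \<phi> = pairing f (rep_l2 (dual.S t (abs_l2 \<phi>)))"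
      using dual.U_dual[OF f t, of "abs_l2 \<phi>"] f \<phi> by (simp add: pr_abs[symmetric] UL U0)
  qed
  then have P: "?P (Defs.transp (U0 t) \<phi>)" unfolding Defs.transp_def by (rule someI[of ?P])
  then show L: "Defs.transp (U0 t) \<phi> \<in> L2" by blast
  show "abs_l2 (Defs.transp (U0 t) \<phi>) = dual.S t (abs_l2 \<phi>)"
  proof (rule pr_nondegenerate)
    fix F
    have "pr F (abs_l2 (Defs.transp (U0 t) \<phi>)) = pairing (rep_l2 F) (Defs.transp (U0 t) \<phi>)"
      by (subst pr_abs[symmetric]) (simp_all add: L)
    also have "\<dots> = pr (abs_l2 (U0 t (rep_l2 F))) (abs_l2 \<phi>)"
      using P \<phi> by (simp add: pr_abs UL)
    also have "\<dots> = pr F (dual.S t (abs_l2 \<phi>))"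
      using dual.U_dual[OF rep_l2_L2 t] by (simp add: U0)
    finally show "pr F (abs_l2 (Defs.transp (U0 t) \<phi>)) = pr F (dual.S t (abs_l2 \<phi>))" .
  qed
qed

lemma lamr_H: "lamr \<xi> G \<Longrightarrow> \<exists>\<eta>. H \<xi> \<eta>"
  using lamr_A0(2) unfolding H_def by blast

lemma H_lamr: "H \<xi> \<eta> \<Longrightarrow> \<exists>G. lamr \<xi> G"
  unfolding H_def using lamr_A0(1) A0_A0_inv(1) by metis

lemma dom_Lam_H: "\<phi> \<in> dom_Lam \<Longrightarrow> \<exists>\<eta>. H (abs_l2 \<phi>) \<eta>"
  using Lam_dom_lamr(2) lamr_H by blast

text \<open>Diagonal multipliers commute with \<open>A0\<close>, so they act on
  \<open>\<theta> = A_0^{-1} \<psi>\<close>; the sum \<open>\<eta> + B_0 \<theta>\<close> is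
  \<open>\<Lambda> \<theta>\<close>, and the \<open>cm\<close> term is the commutator.\<close>

lemma H_multiply:
  assumes c: "coefficient p" "coefficient q" "coefficient r"
    and \<psi>: "H \<psi> \<eta>"
  shows "H (mulop (dg p q r) \<psi>)
    (mulop (dg q p (\<lambda>x. 0)) (\<eta> + mulop (B0 M) (mulop (A0_inv M) \<psi>)) + mulop (cm p q) (mulop (A0_inv M) \<psi>)
      - mulop (B0 M) (mulop (dg p q r) (mulop (A0_inv M) \<psi>)))"
proof -
  have l: "lamr (mulop (A0_inv M) \<psi>) (\<eta> + mulop (B0 M) (mulop (A0_inv M) \<psi>))"
    using \<psi> unfolding H_def by auto
  have "mulop (A0 M) (mulop (dg p q r) (mulop (A0_inv M) \<psi>)) = mulop (dg p q r) (mulop (A0 M) (mulop (A0_inv M) \<psi>))"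
    unfolding A0_dg by (rule mulop_comp_commute) (auto intro!: bdd_dg c coefficient_const a_coeffs simp: cmv_dg mult_ac)
  then show ?thesis using H_A0[OF lamr_mulop[OF c l]] by (simp add: A0_A0_inv)
qed

end

section \<open>The modulated equation and its source in weak form\<close>

locale modulated = background M U0
  for M :: medium and U0 :: "real \<Rightarrow> field \<Rightarrow> field" +
  fixes \<eta> :: "real \<Rightarrow> real" and \<tau> T \<kappa> :: real and m :: "real^2 \<Rightarrow> real" and w0 :: field and W :: "real \<Rightarrow> field"
  assumes eta: "Cinf \<eta>" "closure {t. \<eta> t \<noteq> 0} \<subseteq> {-1/2<..<1/2}"
    and tau: "\<tau> > 0" "T > \<tau> / 2"
    and m: "Cinf m" "bounded {x. m x \<noteq> 0}"
    and kappa: "\<kappa> > 0" "\<And>t x. 1 + V_mod \<eta> \<tau> T m t x \<ge> \<kappa>"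
    and w0: "w0 \<in> L2"
    and W: "solution (A_mod M (V_mod \<eta> \<tau> T m)) (B_mod M (V_mod \<eta> \<tau> T m)) w0 W"
begin

abbreviation V :: modulation where "V \<equiv> V_mod \<eta> \<tau> T m"

definition e :: "real \<Rightarrow> real" where "e s = eta_sc \<eta> \<tau> (s - T)"
definition e' :: "real \<Rightarrow> real" where "e' s = deriv e s"

lemma V_eq: "V t x = e t * m x"
  by (simp add: V_mod_def e_def)

lemma e_derivative: "(e has_real_derivative e' s) (at s within X)"
proof -
  have "e differentiable (at s)"
    unfolding e_def[abs_def] eta_sc_def
    by (intro differentiable_divide differentiable_compose[of \<eta>, OF Cinf_differentiable[OF eta(1)]]
        differentiable_diff differentiable_ident differentiable_const) (use tau in auto)
  then have "(e has_real_derivative e' s) (at s)"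
    by (simp add: e'_def DERIV_deriv_iff_real_differentiable)
  then show ?thesis by (rule has_field_derivative_at_within)
qed

lemma e_continuous: "continuous_on X e"
  using e_derivative DERIV_continuous_on by blast

lemma e_eq_0: "\<bar>s - T\<bar> \<ge> \<tau> / 2 \<Longrightarrow> e s = 0"
proof -
  assume "\<bar>s - T\<bar> \<ge> \<tau> / 2"
  then have "\<bar>(s - T) / \<tau>\<bar> \<ge> 1 / 2" using tau(1) by (simp add: abs_divide pos_le_divide_eq)
  moreover have "y \<notin> {-1/2<..<1/2}" if "\<bar>y\<bar> \<ge> 1 / 2" for y :: real using that by auto
  ultimately have "(s - T) / \<tau> \<notin> {-1/2<..<1/2}" by blast
  then have "\<eta> ((s - T) / \<tau>) = 0" using eta(2) closure_subset[of "{t. \<eta> t \<noteq> 0}"] by blast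
  then show ?thesis by (simp add: e_def eta_sc_def)
qed

lemma m_coeff: "coefficient m"
  using m bounded_supportE[OF m(2)] unfolding coefficient_alt by metis

lemma c_coeff: "coefficient (\<lambda>x. 1 + e t * m x)"
  by (intro coefficient_add coefficient_mult coefficient_const m_coeff)

lemma c_nz: "1 + e t * m x \<noteq> 0"
  using kappa(1) kappa(2)[of t x] by (simp add: V_eq)

lemma W_L2: "t \<ge> 0 \<Longrightarrow> W t \<in> L2"
  using solution_L2[OF W] .

lemma W0_L2: "t \<ge> 0 \<Longrightarrow> U0 t w0 \<in> L2"
  using solution_L2[OF U0_solution[OF w0]] .

text \<open>What remains of the modulated coefficients after removing the background, up to the
  factors \<open>e\<close> and \<open>e'\<close>. In transposed form the three matrices are also the
  time derivative, \<open>q0\<close> and coupling terms of the source.\<close>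

definition P3 :: "real^2 \<Rightarrow> real^4^4" where "P3 = dg (\<lambda>x. 0) (\<lambda>x. m x * a3 x) (\<lambda>x. 0)"
definition Pb :: "real^2 \<Rightarrow> real^4^4" where "Pb = dg (\<lambda>x. 0) (\<lambda>x. m x * b3 x) (\<lambda>x. 0)"
definition N34 :: "real^2 \<Rightarrow> real^4^4" where
  "N34 x = vector [0, 0, vector [0, 0, 0, m x * inverse (tau_D M x)], 0]"

lemma cmv_N34: "cmv (N34 x) v = vector [0, 0, (m x * inverse (tau_D M x)) *\<^sub>R v $ 4, 0]"
  by (simp add: vec_eq_iff forall_4 cmv_nth sum_4 N34_def)

lemma bdd_P: "bdd P3" "bdd Pb" "bdd N34"
proof -
  show "bdd P3" "bdd Pb"
    unfolding P3_def Pb_def by (intro bdd_dg coefficient_const coefficient_mult[OF m_coeff] a_coeffs)+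
  show "bdd N34"
  proof (rule bdd_if_entries)
    fix i j :: 4
    show "coefficient (\<lambda>x. N34 x $ i $ j)"
      using exhaust_4[of i] exhaust_4[of j] coefficient_mult[OF m_coeff a_coeffs(4)]
      by (auto simp: N34_def coefficient_const)
  qed
qed

lemma A_mod_dg: "A_mod M V t = dg (\<lambda>x. mu M) (\<lambda>x. a3 x * (1 + e t * m x)) (\<lambda>x. a4 x * inverse (1 + e t * m x))"
  by (rule ext) (simp add: A_mod_def eps_D_def dg_def a3_def a4_def V_eq divide_inverse)

lemma deriv_V: "deriv (\<lambda>s. V s x) t = e' t * m x"
  unfolding V_eq by (rule DERIV_imp_deriv) (auto intro!: derivative_eq_intros e_derivative)

lemma transpose_B_mod: "transpose (B_mod M V t x) = B_mod M V t x"
  by (simp add: vec_eq_iff forall_4 transpose_def B_mod_def)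

lemma cmv_B_mod: "cmv (B_mod M V t x) v = vector [0, 0,
    (b3 x * (1 + e t * m x) + a3 x * (e' t * m x)) *\<^sub>R v $ 3 - inverse (tau_D M x) *\<^sub>R v $ 4,
    - (inverse (tau_D M x) *\<^sub>R v $ 3) + (a4 x * inverse (tau_D M x) * inverse (1 + e t * m x)) *\<^sub>R v $ 4]"
proof -
  have 1: "sigma M x * (1 + V t x) + eps0 M * eps_inf M x * (e' t * m x) + eps_D M V t x / tau_D M x
      = b3 x * (1 + e t * m x) + a3 x * (e' t * m x)"
    by (simp add: eps_D_def b3_def a3_def V_eq divide_inverse algebra_simps)
  have 2: "1 / (eps_D M V t x * tau_D M x) = a4 x * inverse (tau_D M x) * inverse (1 + e t * m x)"
    by (simp add: eps_D_def a4_def V_eq divide_inverse)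
  show ?thesis
    unfolding B_mod_def deriv_V 1 2 by (simp add: vec_eq_iff forall_4 cmv_nth sum_4 divide_inverse)
qed

lemma bdd_B_mod: "bdd (B_mod M V t)"
proof (rule bdd_if_entries)
  fix i j :: 4
  note C = coefficient_mult coefficient_add coefficient_const
  have c: "coefficient (\<lambda>x. sigma M x * (1 + e t * m x) + eps0 M * eps_inf M x * (e' t * m x)
      + eps0 M * d_eps M x * (1 + e t * m x) * inverse (tau_D M x))"
    by (intro C coeffs m_coeff a_coeffs)
  have d: "coefficient (\<lambda>x. inverse (eps0 M * d_eps M x * (1 + e t * m x) * tau_D M x))"
    by (rule coefficient_inverse) (intro C coeffs m_coeff, use nz c_nz in simp)
  show "coefficient (\<lambda>x. B_mod M V t x $ i $ j)"
    using exhaust_4[of i] exhaust_4[of j] c d a_coeffs(4) coefficient_uminus[OF a_coeffs(4)]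
    by (auto simp: B_mod_def eps_D_def V_eq deriv_V[unfolded V_eq] coefficient_const divide_inverse
        simp del: inverse_mult_distrib)
qed

text \<open>The modulated equation tested with \<open>diag(1, 1, 1, 1 + V\<^sub>m) \<theta>\<close> has the fourth component of
  the background equation.\<close>

lemma W_derivative:
  assumes \<theta>: "lamr \<theta> G" and t: "t \<ge> 0"
  shows "((\<lambda>s. pr (abs_l2 (W s)) (mulop (A0 M) \<theta> + e t *\<^sub>R mulop P3 \<theta>)) has_vector_derivative
    pr (abs_l2 (W t)) (G - mulop (B0 M) \<theta> - e' t *\<^sub>R mulop P3 \<theta> + e t *\<^sub>R (mulop N34 \<theta> - mulop Pb \<theta>)))
    (at t within {0..})"
proof -
  let ?C = "dg (\<lambda>x. 1) (\<lambda>x. 1) (\<lambda>x. 1 + e t * m x)"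
  note k = coefficient_const
  have bC: "bdd ?C" by (intro bdd_dg k c_coeff)
  have bA: "bdd (A_mod M V t)"
    unfolding A_mod_dg by (intro bdd_dg k coefficient_mult[OF a_coeffs(1) c_coeff]
        coefficient_mult[OF a_coeffs(2) coefficient_inverse[OF c_coeff c_nz]])
  \<comment> \<open>\<Lambda> does not see the fourth component, so rescaling it keeps the same
    image \<open>G\<close>.\<close>
  have l: "lamr (mulop ?C \<theta>) G"
    using lamr_mulop'[OF k[of 1] k[of 1] c_coeff k[of 1] \<theta>] by (simp only: mulop_id mulop_cm_const add_0_right)
  have "mulop (A_mod M V t) (mulop ?C \<theta>) = mulop (A0 M) \<theta> + e t *\<^sub>R mulop P3 \<theta> + 0 *\<^sub>R mulop P3 \<theta> + 0 *\<^sub>R mulop P3 \<theta>"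
    by (intro mulop_comb bC bA bdd_A0 bdd_P)
      (simp add: A_mod_dg A0_dg P3_def cmv_dg vec_eq_iff forall_4 c_nz mult.assoc, simp add: algebra_simps)
  then have A: "mulop (A_mod M V t) (mulop ?C \<theta>) = mulop (A0 M) \<theta> + e t *\<^sub>R mulop P3 \<theta>" by simp
  have B: "mulop (B_mod M V t) (mulop ?C \<theta>)
      = mulop (B0 M) \<theta> + e' t *\<^sub>R mulop P3 \<theta> + e t *\<^sub>R mulop Pb \<theta> + (- e t) *\<^sub>R mulop N34 \<theta>"
    by (intro mulop_comb bC bdd_B_mod bdd_B0 bdd_P)
      (simp add: cmv_B_mod cmv_B0 P3_def Pb_def cmv_N34 cmv_dg vec_eq_iff forall_4 c_nz mult.assoc, simp add: algebra_simps)
  obtain G' where G': "lamr (mulop (A_mod M V t) (mulop ?C \<theta>)) G'"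
    unfolding A_mod_dg
    using lamr_mulop[OF k coefficient_mult[OF a_coeffs(1) c_coeff]
        coefficient_mult[OF a_coeffs(2) coefficient_inverse[OF c_coeff c_nz]] l] by blast
  have tA: "(\<lambda>x. transpose (A_mod M V t x)) = A_mod M V t" by (simp add: A_mod_dg)
  have tB: "(\<lambda>x. transpose (B_mod M V t x)) = B_mod M V t" by (simp add: transpose_B_mod)
  from solution_derivative[OF W t l, unfolded tA tB, OF bA G' bdd_B_mod bdd_B_mod]
  moreover have "G - mulop (B_mod M V t) (mulop ?C \<theta>)
      = G - mulop (B0 M) \<theta> - e' t *\<^sub>R mulop P3 \<theta> + e t *\<^sub>R (mulop N34 \<theta> - mulop Pb \<theta>)"
    unfolding B by (simp add: algebra_simps)
  ultimately show ?thesis by (simp only: A)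
qed

lemma W_dv:
  assumes "lamr \<xi> G" "t \<ge> 0"
  shows "((\<lambda>s. pr (abs_l2 (W s)) \<xi>) has_vector_derivative dv (\<lambda>s. abs_l2 (W s)) t \<xi>) (at t within {0..})"
proof -
  obtain \<phi> where \<phi>: "\<phi> \<in> L2" "\<xi> = abs_l2 \<phi>" by (rule l2_cases)
  have "\<phi> \<in> dom_Lam" using assms(1) \<phi> dom_Lam_iff by blast
  moreover have "dt_exists W t" using W assms(2) by (simp add: solution_def)
  ultimately have d: "((\<lambda>s. pr (abs_l2 (W s)) \<xi>) has_vector_derivative dt W t \<phi>) (at t within {0..})"
    using dt_exists_derivative W_L2 assms(2) \<phi>(2) by blast
  with dv_eqI[OF d assms(2)] show ?thesis by simp
qed

lemma W0_dv:
  assumes "H \<xi> \<eta>'" "t \<ge> 0"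
  shows "((\<lambda>s. pr (abs_l2 (U0 s w0)) \<xi>) has_vector_derivative pr (abs_l2 (U0 t w0)) \<eta>') (at t within {0..})"
  by (rule U0_derivative[OF w0 assms])

text \<open>The left side is the residual of the solution in the background equation. On the right,
  the \<open>e'\<close> term from the time derivative of \<open>V\<close> in \<open>B_mod\<close>
  and the \<open>e\<close> term from \<open>A_mod\<close> form a product rule, as in
  \<open>F_mod_eq\<close>.\<close>

lemma dW_eq:
  assumes \<theta>: "lamr \<theta> G" and t: "t \<ge> 0"
  shows "dv (\<lambda>s. abs_l2 (W s)) t (mulop (A0 M) \<theta>) - pr (abs_l2 (W t)) (G - mulop (B0 M) \<theta>)
    = - (e' t *\<^sub>R pr (abs_l2 (W t)) (mulop P3 \<theta>) + e t *\<^sub>R dv (\<lambda>s. abs_l2 (W s)) t (mulop P3 \<theta>))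
      + e t *\<^sub>R pr (abs_l2 (W t)) (mulop N34 \<theta> - mulop Pb \<theta>)"
proof -
  obtain G1 where G1: "lamr (mulop (A0 M) \<theta>) G1" using lamr_A0(1)[OF \<theta>] by blast
  obtain G2 where G2: "lamr (mulop P3 \<theta>) G2"
    unfolding P3_def using lamr_mulop[OF coefficient_const coefficient_mult[OF m_coeff a_coeffs(1)] coefficient_const \<theta>] by blast
  have "((\<lambda>s. pr (abs_l2 (W s)) (mulop (A0 M) \<theta> + e t *\<^sub>R mulop P3 \<theta>)) has_vector_derivative
      dv (\<lambda>s. abs_l2 (W s)) t (mulop (A0 M) \<theta>) + e t *\<^sub>R dv (\<lambda>s. abs_l2 (W s)) t (mulop P3 \<theta>)) (at t within {0..})"
    unfolding pr.add_right pr.scaleR_right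
    by (intro has_vector_derivative_add bounded_linear.has_vector_derivative[OF bounded_linear_scaleR_right]
        W_dv[OF G1 t] W_dv[OF G2 t])
  from dv_eqI[OF this t] dv_eqI[OF W_derivative[OF \<theta> t] t]
  have "dv (\<lambda>s. abs_l2 (W s)) t (mulop (A0 M) \<theta>) + e t *\<^sub>R dv (\<lambda>s. abs_l2 (W s)) t (mulop P3 \<theta>)
      = pr (abs_l2 (W t)) (G - mulop (B0 M) \<theta> - e' t *\<^sub>R mulop P3 \<theta> + e t *\<^sub>R (mulop N34 \<theta> - mulop Pb \<theta>))"
    by simp
  then show ?thesis by (simp add: pr.add_right pr.diff_right pr.scaleR_right algebra_simps)
qed

lemma Vu_e3_pairing:
  assumes "Z \<in> L2" "f \<in> L2"
  shows "pairing (\<lambda>x. axis 3 (complex_of_real (V s x) * Z x $ 3)) f = e s *\<^sub>R pr (abs_l2 Z) (mulop (dg (\<lambda>x. 0) m (\<lambda>x. 0)) (abs_l2 f))"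
proof -
  let ?P = "dg (\<lambda>x. 0) m (\<lambda>x. 0)"
  have b: "bdd ?P" by (intro bdd_dg coefficient_const m_coeff)
  have "cdot (axis 3 (complex_of_real (V s x) * Z x $ 3)) (f x) = e s *\<^sub>R cdot (Z x) (app ?P f x)" for x
    by (simp add: cdot_def sum_4 axis_def app_cmv cmv_dg V_eq scaleR_conv_of_real mult_ac)
  then show ?thesis
    using assms b by (simp add: pairing_cdot[of "\<lambda>x. axis 3 (complex_of_real (V s x) * Z x $ 3)"] mulop_abs pr_abs app_L2)
      (simp add: pairing_cdot cdot_integrable app_L2)
qed

text \<open>Only the derivative of \<open>Z\<close> against \<open>P3 \<theta>\<close> enters, so
  one formula serves the solution, the background and their difference. The matrix \<open>Pb\<close>
  arises from \<open>q0 * a3 = b3\<close>.\<close>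

lemma F_mod_eq:
  assumes Z: "\<And>s. s \<ge> 0 \<Longrightarrow> Z s \<in> L2" and t: "t \<ge> 0" and \<theta>: "\<theta> \<in> L2"
    and d: "((\<lambda>s. pr (abs_l2 (Z s)) (mulop P3 (abs_l2 \<theta>))) has_vector_derivative d) (at t within {0..})"
  shows "F_mod M V (\<lambda>s x. Z s x $ 3) t \<theta> =
    - (e' t *\<^sub>R pr (abs_l2 (Z t)) (mulop P3 (abs_l2 \<theta>)) + e t *\<^sub>R d)
    + e t *\<^sub>R pr (abs_l2 (Z t)) (mulop N34 (abs_l2 \<theta>) - mulop Pb (abs_l2 \<theta>))"
proof -
  define \<psi> where "\<psi> = app (\<lambda>x. transpose (mat (eps0 M * eps_inf M x))) \<theta>"
  have "(\<lambda>x. transpose (mat (eps0 M * eps_inf M x))) = dg a3 a3 a3"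
    by (rule ext) (simp add: dg_def diag_def mat_def transpose_def vec_eq_iff forall_4 a3_def)
  then have \<psi>_app: "\<psi> = app (dg a3 a3 a3) \<theta>" by (simp add: \<psi>_def)
  have b: "bdd (dg a3 a3 a3)" "bdd (dg (\<lambda>x. 0) m (\<lambda>x. 0))"
    by (intro bdd_dg a_coeffs coefficient_const m_coeff)+
  have \<psi>: "\<psi> \<in> L2" unfolding \<psi>_app using b \<theta> by (simp add: app_L2)
  have P: "mulop (dg (\<lambda>x. 0) m (\<lambda>x. 0)) (abs_l2 \<psi>) = mulop P3 (abs_l2 \<theta>)"
    unfolding \<psi>_app mulop_abs[OF b(1) \<theta>, symmetric]
    by (rule mulop_comp_eqI[OF b(2) b(1) bdd_P(1)]) (simp add: P3_def cmv_dg)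
  have X: "pairing (Vu_e3 V (\<lambda>s x. Z s x $ 3) s) \<psi> = e s *\<^sub>R pr (abs_l2 (Z s)) (mulop P3 (abs_l2 \<theta>))" if "s \<in> {0..}" for s
    using Vu_e3_pairing[OF Z \<psi>] that P unfolding Vu_e3_def by simp
  have "((\<lambda>s. e s *\<^sub>R pr (abs_l2 (Z s)) (mulop P3 (abs_l2 \<theta>))) has_vector_derivative
      e t *\<^sub>R d + e' t *\<^sub>R pr (abs_l2 (Z t)) (mulop P3 (abs_l2 \<theta>))) (at t within {0..})"
    by (rule has_vector_derivative_scaleR[OF e_derivative d])
  from has_vector_derivative_transform[OF _ X this] t
  have dt: "dt (Vu_e3 V (\<lambda>s x. Z s x $ 3)) t \<psi> = e t *\<^sub>R d + e' t *\<^sub>R pr (abs_l2 (Z t)) (mulop P3 (abs_l2 \<theta>))"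
    by (intro dt_eqI) auto
  have "cdot (complex_of_real (q0 M x) *s Vu_e3 V (\<lambda>s x. Z s x $ 3) t x) (\<psi> x) = e t *\<^sub>R cdot (Z t x) (app Pb \<theta> x)" for x
  proof -
    have "q0 M x * a3 x = b3 x"
      using nz(2) nz(3,5)[of x] by (simp add: q0_def a3_def b3_def field_simps)
    then have "complex_of_real (q0 M x) * complex_of_real (a3 x) = complex_of_real (b3 x)"
      by (metis of_real_mult)
    then show ?thesis
      by (simp add: cdot_def sum_4 axis_def app_cmv cmv_dg V_eq scaleR_conv_of_real Vu_e3_def \<psi>_app Pb_def)
  qed
  then have q: "pairing (\<lambda>x. complex_of_real (q0 M x) *s Vu_e3 V (\<lambda>s x. Z s x $ 3) t x) \<psi>
      = e t *\<^sub>R pr (abs_l2 (Z t)) (mulop Pb (abs_l2 \<theta>))"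
    using Z[OF t] \<theta> bdd_P by (simp add: pairing_cdot mulop_abs pr_abs app_L2 cdot_integrable)
  have "cdot (axis 4 (complex_of_real (V t x / tau_D M x) * Z t x $ 3)) (\<theta> x) = e t *\<^sub>R cdot (Z t x) (app N34 \<theta> x)" for x
    by (simp add: cdot_def sum_4 axis_def app_cmv cmv_N34 V_eq scaleR_conv_of_real divide_inverse mult_ac)
  then have n: "pairing (\<lambda>x. axis 4 (complex_of_real (V t x / tau_D M x) * Z t x $ 3)) \<theta>
      = e t *\<^sub>R pr (abs_l2 (Z t)) (mulop N34 (abs_l2 \<theta>))"
    using Z[OF t] \<theta> bdd_P by (simp add: pairing_cdot mulop_abs pr_abs app_L2 cdot_integrable)
  show ?thesis
    unfolding F_mod_def app_fun_def \<psi>_def[symmetric] dt q n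
    by (simp add: pr.diff_right algebra_simps)
qed

end

section \<open>Paths paired with backward transported test elements\<close>

context background
begin

lemma S_reverse_continuous: "continuous_on {0..t} (\<lambda>s. dual.S (t - s) g)"
  by (rule continuous_on_compose2[OF dual.S_continuous]) (auto intro!: continuous_intros)

text \<open>\<open>d\<close> is the derivative with the test element frozen at time
  \<open>r\<close>; the motion of the test element, which is strong, contributes the second
  term.\<close>

lemma path_product:
  assumes x: "continuous_on {0..t} x" and \<phi>: "H \<phi> \<eta>" and r: "r \<in> {0..t}"
    and d: "((\<lambda>s. pr (x s) (dual.S (t - r) \<phi>)) has_vector_derivative d) (at r within {0..})"
  shows "((\<lambda>s. pr (x s) (dual.S (t - s) \<phi>)) has_vector_derivative d - pr (x r) (dual.S (t - r) \<eta>))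
    (at r within {0..t})"
proof -
  have "((\<lambda>s. pr (x s) (dual.S (t - s) \<phi>)) has_vector_derivative d + pr (x r) (- dual.S (t - r) \<eta>))
      (at r within {0..t})"
  proof (rule bounded_bilinear.weak_strong_product[OF pr_bilinear])
    show "((\<lambda>s. pr (x s) (dual.S (t - r) \<phi>)) has_vector_derivative d) (at r within {0..t})"
      by (rule has_vector_derivative_within_subset[OF d]) auto
    show "((\<lambda>s. dual.S (t - s) \<phi>) has_vector_derivative - dual.S (t - r) \<eta>) (at r within {0..t})"
      by (rule has_vector_derivative_reverse[OF dual.S_derivative[OF \<phi>, of _ t]]) (use r in auto)
    show "(x \<longlongrightarrow> x r) (at r within {0..t})" using x r by (simp add: continuous_on_def)
  qed
  then show ?thesis by (simp add: pr.minus_right)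
qed

lemma H_scaleR: "H \<xi> \<eta> \<Longrightarrow> H (c *\<^sub>R \<xi>) (c *\<^sub>R \<eta>)"
  unfolding H_def mulop_scaleR using lamr_scaleR by (metis scaleR_right_diff_distrib)

lemma dt_U0:
  assumes "w \<in> L2" "\<xi> \<in> L2" "H (abs_l2 \<xi>) \<eta>" "r \<ge> 0"
  shows "dt (\<lambda>t. U0 t w) r \<xi> = pr (abs_l2 (U0 r w)) \<eta>"
proof (rule dt_eqI[OF _ assms(4)])
  show "((\<lambda>s. pairing (U0 s w) \<xi>) has_vector_derivative pr (abs_l2 (U0 r w)) \<eta>) (at r within {0..})"
    by (subst pairing_derivative_iff)
      (use assms solution_L2[OF U0_solution] U0_derivative in auto)
qed

end

lemma pd_uminus:
  assumes "Cinf f"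
  shows "pd b (\<lambda>x. - f x) x = - pd b f x"
  using pd_eq[OF has_derivative_minus[OF Cinf_has_derivative[OF assms]]] by (simp add: pd_def)

context modulated
begin

abbreviation w where "w t \<equiv> abs_l2 (W t)"
abbreviation v where "v t \<equiv> abs_l2 (U0 t w0)"
abbreviation Dm where "Dm \<equiv> dg (\<lambda>x. 0) m (\<lambda>x. 0)"

lemma bdd_m: "bdd Dm" "bdd (cm m (\<lambda>x. 0))" "bdd (cm (\<lambda>x. - m x) m)" "bdd (cm m m)" "bdd (cm (\<lambda>x. 0) m)"
    "bdd (dg m (\<lambda>x. - m x) (\<lambda>x. 0))" "bdd (dg m m (\<lambda>x. 0))" "bdd (dg (\<lambda>x. - m x) m m)" "bdd (dg m m m)"
  by (intro bdd_cm bdd_dg m_coeff coefficient_uminus coefficient_const)+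

lemma v_continuous: "continuous_on {0..t} v"
  by (rule continuous_on_subset[OF solution_continuous[OF U0_solution[OF w0]]]) auto

lemma w_continuous: "continuous_on {0..t} w"
  by (rule continuous_on_subset[OF solution_continuous[OF W]]) auto

text \<open>\<open>F_mod\<close> acts on fields rather than classes, so a concrete representative of
  the test element \<open>\<theta> r\<close> is needed.\<close>

definition \<theta>f :: "real \<Rightarrow> field \<Rightarrow> real \<Rightarrow> field" where
  "\<theta>f t \<phi> r = app (\<lambda>x. transpose (A0_inv M x)) (Defs.transp (U0 (t - r)) \<phi>)"

lemma N_integrand3_F_mod: "N_integrand3 M U0 V u t r \<phi> = F_mod M V u r (\<theta>f t \<phi> r)"
  by (simp add: N_integrand3_def ext_def app_fun_def \<theta>f_def)

lemma lamr_P3: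
  assumes "lamr \<theta> G"
  shows "\<exists>G'. lamr (mulop P3 \<theta>) G'"
  unfolding P3_def using lamr_mulop[OF coefficient_const coefficient_mult[OF m_coeff a_coeffs(1)] coefficient_const assms] by blast

lemma P3_A0_inv: "mulop P3 (mulop (A0_inv M) \<psi>) = mulop Dm \<psi>"
  by (rule mulop_comp_eqI[OF bdd_P(1) bdd_A0(2) bdd_m(1)])
    (simp add: P3_def A0_inv_dg cmv_dg nz mult.assoc)

text \<open>The zeroth order terms of the source are those of \<open>B0\<close> applied to
  \<open>m E_z e_3\<close>, transposed here; this makes them cancel when the source of the
  background field is integrated.\<close>

lemma Dm_B0: "mulop Dm (mulop (B0 M) \<theta>) = mulop Pb \<theta> - mulop N34 \<theta>"
proof -
  have "mulop Dm (mulop (B0 M) \<theta>) = mulop Pb \<theta> + (-1) *\<^sub>R mulop N34 \<theta> + 0 *\<^sub>R mulop Pb \<theta> + 0 *\<^sub>R mulop Pb \<theta>"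
    by (intro mulop_comb bdd_m bdd_B0 bdd_P)
      (simp add: cmv_dg cmv_B0 Pb_def cmv_N34 vec_eq_iff forall_4 scaleR_right_diff_distrib)
  then show ?thesis by simp
qed

section \<open>Duhamel formulas and integrands against one fixed test element\<close>

context
  fixes \<phi> :: field and \<eta>0 :: l2 and t :: real
  assumes \<phi>: "\<phi> \<in> dom_Lam" and \<eta>0: "H (abs_l2 \<phi>) \<eta>0"
begin

definition \<psi> where "\<psi> r = dual.S (t - r) (abs_l2 \<phi>)"
definition \<theta> where "\<theta> r = mulop (A0_inv M) (\<psi> r)"
text \<open>This is \<open>\<Lambda> \<theta>\<close>, written through the orbit of
  \<open>\<eta>0\<close> so that its continuity in \<open>r\<close> is visible.\<close>

definition G where "G r = dual.S (t - r) \<eta>0 + mulop (B0 M) (\<theta> r)"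

lemma \<psi>_transp:
  assumes "r \<in> {0..t}"
  shows "Defs.transp (U0 (t - r)) \<phi> \<in> L2" "abs_l2 (Defs.transp (U0 (t - r)) \<phi>) = \<psi> r"
  using transp_U0[OF dom_Lam_L2[OF \<phi>], of "t - r"] assms by (auto simp: \<psi>_def)

lemma H_\<psi>: "r \<in> {0..t} \<Longrightarrow> H (\<psi> r) (dual.S (t - r) \<eta>0)"
  unfolding \<psi>_def by (rule dual.S_domain[OF \<eta>0]) auto

lemma \<theta>f_\<theta>:
  assumes "r \<in> {0..t}"
  shows "\<theta>f t \<phi> r \<in> L2" "abs_l2 (\<theta>f t \<phi> r) = \<theta> r"
  unfolding \<theta>f_def \<theta>_def transpose_A0 using \<psi>_transp[OF assms] bdd_A0
  by (auto simp: app_L2 mulop_abs[symmetric])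

lemma lamr_\<theta>: "r \<in> {0..t} \<Longrightarrow> lamr (\<theta> r) (G r)"
  using H_\<psi>[of r] unfolding H_def G_def \<theta>_def by auto

lemma continuous:
  "continuous_on {0..t} \<psi>" "continuous_on {0..t} \<theta>" "continuous_on {0..t} G"
proof -
  show p: "continuous_on {0..t} \<psi>" unfolding \<psi>_def by (rule S_reverse_continuous)
  show q: "continuous_on {0..t} \<theta>" unfolding \<theta>_def by (rule mulop_continuous_on[OF p])
  show "continuous_on {0..t} G"
    unfolding G_def by (intro continuous_on_add S_reverse_continuous mulop_continuous_on[OF q])
qed

lemma A0_\<theta>: "mulop (A0 M) (\<theta> r) = \<psi> r"
  by (simp add: \<theta>_def A0_A0_inv)

text \<open>The source evaluated by \<open>F_mod_eq\<close> and the residual evaluated by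
  \<open>dW_eq\<close> have the same right side.\<close>

lemma N3_W:
  assumes r: "r \<in> {0..t}"
  shows "N_integrand3 M U0 V (\<lambda>s x. W s x $ 3) t r \<phi> = dv w r (\<psi> r) - pr (w r) (dual.S (t - r) \<eta>0)"
proof -
  have r0: "r \<ge> 0" using r by simp
  obtain G' where "lamr (mulop P3 (\<theta> r)) G'" using lamr_P3[OF lamr_\<theta>[OF r]] by blast
  from F_mod_eq[OF W_L2 r0 \<theta>f_\<theta>(1)[OF r], unfolded \<theta>f_\<theta>(2)[OF r], OF _ W_dv[OF this r0]]
    dW_eq[OF lamr_\<theta>[OF r] r0]
  show ?thesis by (simp add: N_integrand3_F_mod A0_\<theta> G_def)
qed

lemma N3_U0:
  assumes r: "r \<in> {0..t}" and \<zeta>: "H (mulop Dm (\<psi> r)) \<zeta>"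
  shows "N_integrand3 M U0 V (\<lambda>s x. U0 s w0 x $ 3) t r \<phi> =
    - (e' r *\<^sub>R pr (v r) (mulop Dm (\<psi> r)) + e r *\<^sub>R pr (v r) \<zeta>)
    + e r *\<^sub>R pr (v r) (mulop N34 (\<theta> r) - mulop Pb (\<theta> r))"
proof -
  have r0: "r \<ge> 0" using r by simp
  have P: "mulop P3 (\<theta> r) = mulop Dm (\<psi> r)" by (simp add: \<theta>_def P3_A0_inv)
  from F_mod_eq[OF W0_L2 r0 \<theta>f_\<theta>(1)[OF r], unfolded \<theta>f_\<theta>(2)[OF r] P, OF _ W0_dv[OF \<zeta> r0]]
  show ?thesis by (simp add: N_integrand3_F_mod)
qed

text \<open>The source contains a time derivative, defined by choice, which is additive only where
  the derivatives exist; hence the three separate evaluations.\<close>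

lemma N3_diff:
  assumes r: "r \<in> {0..t}"
  shows "N_integrand3 M U0 V (\<lambda>s x. W s x $ 3 - U0 s w0 x $ 3) t r \<phi> =
    N_integrand3 M U0 V (\<lambda>s x. W s x $ 3) t r \<phi> - N_integrand3 M U0 V (\<lambda>s x. U0 s w0 x $ 3) t r \<phi>"
proof -
  have r0: "r \<ge> 0" using r by simp
  obtain G' where G': "lamr (mulop P3 (\<theta> r)) G'" using lamr_P3[OF lamr_\<theta>[OF r]] by blast
  then obtain \<zeta> where \<zeta>: "H (mulop P3 (\<theta> r)) \<zeta>" using lamr_H by blast
  have ZL: "(\<lambda>x. W s x - U0 s w0 x) \<in> L2" if "s \<ge> 0" for s
    by (intro L2_diff W_L2 W0_L2 that)
  have Za: "abs_l2 (\<lambda>x. W s x - U0 s w0 x) = w s - v s" if "s \<in> {0..}" for s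
    using that by (simp add: abs_l2_diff W_L2 W0_L2)
  have "((\<lambda>s. pr (w s - v s) (mulop P3 (\<theta> r))) has_vector_derivative
      dv w r (mulop P3 (\<theta> r)) - pr (v r) \<zeta>) (at r within {0..})"
    unfolding pr.diff_left by (intro has_vector_derivative_diff W_dv[OF G' r0] W0_dv[OF \<zeta> r0])
  from has_vector_derivative_transform[OF _ _ this, of "\<lambda>s. pr (abs_l2 (\<lambda>x. W s x - U0 s w0 x)) (mulop P3 (\<theta> r))"]
  have "((\<lambda>s. pr (abs_l2 (\<lambda>x. W s x - U0 s w0 x)) (mulop P3 (\<theta> r))) has_vector_derivative
      dv w r (mulop P3 (\<theta> r)) - pr (v r) \<zeta>) (at r within {0..})"
    using r0 Za by simp
  note 1 = F_mod_eq[OF ZL r0 \<theta>f_\<theta>(1)[OF r], unfolded \<theta>f_\<theta>(2)[OF r], OF _ this]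
  note 2 = F_mod_eq[OF W_L2 r0 \<theta>f_\<theta>(1)[OF r], unfolded \<theta>f_\<theta>(2)[OF r], OF _ W_dv[OF G' r0]]
  note 3 = F_mod_eq[OF W0_L2 r0 \<theta>f_\<theta>(1)[OF r], unfolded \<theta>f_\<theta>(2)[OF r], OF _ W0_dv[OF \<zeta> r0]]
  from 1 r0 have 1: "F_mod M V (\<lambda>s x. W s x $ 3 - U0 s w0 x $ 3) r (\<theta>f t \<phi> r) =
      - (e' r *\<^sub>R pr (w r - v r) (mulop P3 (\<theta> r)) + e r *\<^sub>R (dv w r (mulop P3 (\<theta> r)) - pr (v r) \<zeta>))
      + e r *\<^sub>R pr (w r - v r) (mulop N34 (\<theta> r) - mulop Pb (\<theta> r))"
    by (simp only: Za atLeast_iff vector_minus_component)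
  from 2 have 2: "F_mod M V (\<lambda>s x. W s x $ 3) r (\<theta>f t \<phi> r) =
      - (e' r *\<^sub>R pr (w r) (mulop P3 (\<theta> r)) + e r *\<^sub>R dv w r (mulop P3 (\<theta> r)))
      + e r *\<^sub>R pr (w r) (mulop N34 (\<theta> r) - mulop Pb (\<theta> r))" .
  from 3 have 3: "F_mod M V (\<lambda>s x. U0 s w0 x $ 3) r (\<theta>f t \<phi> r) =
      - (e' r *\<^sub>R pr (v r) (mulop P3 (\<theta> r)) + e r *\<^sub>R pr (v r) \<zeta>)
      + e r *\<^sub>R pr (v r) (mulop N34 (\<theta> r) - mulop Pb (\<theta> r))" .
  show ?thesis unfolding N_integrand3_F_mod 1 2 3
    by (simp add: pr.diff_left algebra_simps)
qed

lemma N3_W_integral: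
  assumes t: "t \<ge> 0"
  shows "((\<lambda>r. N_integrand3 M U0 V (\<lambda>s x. W s x $ 3) t r \<phi>) has_integral pr (w t - v t) (abs_l2 \<phi>)) {0..t}"
proof -
  have "((\<lambda>r. N_integrand3 M U0 V (\<lambda>s x. W s x $ 3) t r \<phi>) has_integral
      (pr (w t - v t) (dual.S (t - t) (abs_l2 \<phi>)) - pr (w 0 - v 0) (dual.S (t - 0) (abs_l2 \<phi>)))) {0..t}"
  proof (rule fundamental_theorem_of_calculus[OF t])
    fix r assume r: "r \<in> {0..t}"
    then have r0: "r \<ge> 0" by simp
    obtain G' where G': "lamr (\<psi> r) G'" using H_lamr[OF H_\<psi>[OF r]] by blast
    have "((\<lambda>s. pr (w s - v s) (dual.S (t - r) (abs_l2 \<phi>))) has_vector_derivative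
        dv w r (\<psi> r) - pr (v r) (dual.S (t - r) \<eta>0)) (at r within {0..})"
      unfolding pr.diff_left \<psi>_def[symmetric]
      by (intro has_vector_derivative_diff W_dv[OF G' r0] W0_dv[OF H_\<psi>[OF r] r0])
    from path_product[OF continuous_on_diff[OF w_continuous v_continuous] \<eta>0 r this]
    show "((\<lambda>s. pr (w s - v s) (dual.S (t - s) (abs_l2 \<phi>))) has_vector_derivative
        N_integrand3 M U0 V (\<lambda>s x. W s x $ 3) t r \<phi>) (at r within {0..t})"
      by (simp add: N3_W[OF r] pr.diff_left)
  qed
  moreover have "w 0 = v 0"
    using solution_0[OF W w0] solution_0[OF U0_solution[OF w0] w0] by simp
  ultimately show ?thesis by (simp add: dual.S_0 pr.zero_left)
qed

lemma N3_U0_integral: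
  assumes t: "t \<ge> T + \<tau> / 2"
  shows "((\<lambda>r. N_integrand3 M U0 V (\<lambda>s x. U0 s w0 x $ 3) t r \<phi> + e r *\<^sub>R pr (v r) (mulop Dm (G r))) has_integral 0) {0..t}"
proof -
  define x where "x s = e s *\<^sub>R mulop Dm (v s)" for s
  \<comment> \<open>\<open>T > \<tau> / 2\<close> and \<open>t \<ge> T + \<tau> / 2\<close> keep
    both endpoints clear of the pulse.\<close>
  have t0: "t \<ge> 0" and e0: "e 0 = 0" "e t = 0" using t tau e_eq_0[of 0] e_eq_0[of t] by auto
  have tD: "(\<lambda>x. transpose (Dm x)) = Dm" by simp
  have sw: "pr (mulop Dm F) \<xi> = pr F (mulop Dm \<xi>)" for F \<xi>
    using pr_mulop[of Dm F \<xi>, unfolded tD] bdd_m(1) by simp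
  have "((\<lambda>r. - (N_integrand3 M U0 V (\<lambda>s x. U0 s w0 x $ 3) t r \<phi> + e r *\<^sub>R pr (v r) (mulop Dm (G r)))) has_integral
      (pr (x t) (dual.S (t - t) (abs_l2 \<phi>)) - pr (x 0) (dual.S (t - 0) (abs_l2 \<phi>)))) {0..t}"
  proof (rule fundamental_theorem_of_calculus[OF t0])
    fix r assume r: "r \<in> {0..t}"
    then have r0: "r \<ge> 0" by simp
    obtain \<zeta> where \<zeta>: "H (mulop Dm (\<psi> r)) \<zeta>"
      using H_multiply[OF coefficient_const m_coeff coefficient_const H_\<psi>[OF r]] by blast
    have "((\<lambda>s. e s *\<^sub>R pr (v s) (mulop Dm (\<psi> r))) has_vector_derivative
        e r *\<^sub>R pr (v r) \<zeta> + e' r *\<^sub>R pr (v r) (mulop Dm (\<psi> r))) (at r within {0..})"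
      by (rule has_vector_derivative_scaleR[OF e_derivative W0_dv[OF \<zeta> r0]])
    then have "((\<lambda>s. pr (x s) (dual.S (t - r) (abs_l2 \<phi>))) has_vector_derivative
        e r *\<^sub>R pr (v r) \<zeta> + e' r *\<^sub>R pr (v r) (mulop Dm (\<psi> r))) (at r within {0..})"
      by (simp add: x_def pr.scaleR_left sw \<psi>_def)
    moreover have "continuous_on {0..t} x"
      unfolding x_def by (intro continuous_on_scaleR e_continuous mulop_continuous_on v_continuous)
    ultimately have "((\<lambda>s. pr (x s) (dual.S (t - s) (abs_l2 \<phi>))) has_vector_derivative
        e r *\<^sub>R pr (v r) \<zeta> + e' r *\<^sub>R pr (v r) (mulop Dm (\<psi> r)) - pr (x r) (dual.S (t - r) \<eta>0)) (at r within {0..t})"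
      using path_product[OF _ \<eta>0 r] by blast
    \<comment> \<open>Adding \<open>B_0 \<theta>\<close> to the orbit of \<open>\<eta>0\<close>,
      which yields \<open>G r\<close>, absorbs exactly the \<open>Pb\<close> and \<open>N34\<close>
      terms of the source.\<close>
    moreover have "e r *\<^sub>R pr (v r) \<zeta> + e' r *\<^sub>R pr (v r) (mulop Dm (\<psi> r)) - pr (x r) (dual.S (t - r) \<eta>0)
        = - (N_integrand3 M U0 V (\<lambda>s x. U0 s w0 x $ 3) t r \<phi> + e r *\<^sub>R pr (v r) (mulop Dm (G r)))"
      unfolding N3_U0[OF r \<zeta>] G_def x_def pr.scaleR_left sw mulop_add Dm_B0
      by (simp add: pr.add_right pr.diff_right algebra_simps)
    ultimately show "((\<lambda>s. pr (x s) (dual.S (t - s) (abs_l2 \<phi>))) has_vector_derivative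
        - (N_integrand3 M U0 V (\<lambda>s x. U0 s w0 x $ 3) t r \<phi> + e r *\<^sub>R pr (v r) (mulop Dm (G r)))) (at r within {0..t})"
      by simp
  qed
  from has_integral_neg[OF this] show ?thesis by (simp add: x_def e0 pr.zero_left add.commute)
qed

text \<open>The values given by \<open>H_multiply\<close> for \<open>m \<Gamma> \<psi>\<close> and
  \<open>m \<psi>\<close>. They move the weak time derivative of the background onto the test side,
  where these explicit expressions are continuous in \<open>r\<close>.\<close>

definition \<eta>rev where "\<eta>rev r = mulop (dg m (\<lambda>x. - m x) (\<lambda>x. 0)) (G r) + mulop (cm (\<lambda>x. - m x) m) (\<theta> r)
  - mulop (B0 M) (mulop (dg (\<lambda>x. - m x) m m) (\<theta> r))"
definition \<eta>m where "\<eta>m r = mulop (dg m m (\<lambda>x. 0)) (G r) + mulop (cm m m) (\<theta> r)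
  - mulop (B0 M) (mulop (dg m m m) (\<theta> r))"

lemma rev_integrand_eq:
  assumes r: "r \<in> {0..t}"
  shows "rev_integrand U0 \<eta> \<tau> T m (\<lambda>t. U0 t w0) t r \<phi> = e r * pr (v r) (\<eta>rev r)"
proof -
  have M: "(\<lambda>x. transpose (m x *\<^sub>R Gam)) = dg (\<lambda>x. - m x) m m"
    by (rule ext) (simp add: vec_eq_iff forall_4 transpose_def Gam_def dg_def diag_def)
  have "H (mulop (dg (\<lambda>x. - m x) m m) (\<psi> r)) (\<eta>rev r)"
    using H_multiply[OF coefficient_uminus[OF m_coeff] m_coeff m_coeff H_\<psi>[OF r]]
    by (simp add: \<eta>rev_def G_def \<theta>_def)
  then have "dt (\<lambda>t. U0 t w0) r (app (dg (\<lambda>x. - m x) m m) (Defs.transp (U0 (t - r)) \<phi>)) = pr (v r) (\<eta>rev r)"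
    using \<psi>_transp[OF r] r bdd_m by (intro dt_U0[OF w0]) (auto simp: app_L2 mulop_abs[symmetric])
  then show ?thesis by (simp add: rev_integrand_def ext_def app_fun_def M e_def)
qed

lemma N_integrand1_eq:
  assumes r: "r \<in> {0..t}"
  shows "N_integrand1 U0 V (\<lambda>t. U0 t w0) t r \<phi> = e r * pr (v r) (\<eta>m r)"
proof -
  have M: "app (\<lambda>x. transpose (mat (V r x))) f = (\<lambda>x. e r *\<^sub>R app (dg m m m) f x)" for f
    by (rule ext) (simp add: vec_eq_iff forall_4 app_cmv cmv_nth sum_4 transpose_def mat_def dg_def diag_def V_eq)
  have "H (mulop (dg m m m) (\<psi> r)) (\<eta>m r)"
    using H_multiply[OF m_coeff m_coeff m_coeff H_\<psi>[OF r]]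
    by (simp add: \<eta>m_def G_def \<theta>_def)
  from H_scaleR[OF this, of "e r"]
  have "dt (\<lambda>t. U0 t w0) r (\<lambda>x. e r *\<^sub>R app (dg m m m) (Defs.transp (U0 (t - r)) \<phi>) x) = pr (v r) (e r *\<^sub>R \<eta>m r)"
    using \<psi>_transp[OF r] r bdd_m
    by (intro dt_U0[OF w0]) (auto simp: app_L2 L2_scaleR abs_l2_scaleR mulop_abs[symmetric])
  then show ?thesis
    unfolding N_integrand1_def ext_def app_fun_def M pr.scaleR_right by (simp only: scaleR_conv_of_real)
qed

text \<open>The gradient field is the electric component multiplied by the matrix
  \<open>cm (\<lambda>x. 0) m\<close>, whose transpose is
  \<open>cm m (\<lambda>x. 0)\<close>.\<close>

lemma N_integrand2_eq:
  assumes r: "r \<in> {0..t}"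
  shows "N_integrand2 U0 \<eta> \<tau> T m (\<lambda>r x. U0 r w0 x $ 3) t r \<phi> = e r * pr (v r) (mulop (cm m (\<lambda>x. 0)) (\<psi> r))"
proof -
  have r0: "r \<ge> 0" and tr: "t - r \<ge> 0" using r by auto
  let ?Z = "\<lambda>x. vector [complex_of_real (D2 m x) * U0 r w0 x $ 3, - (complex_of_real (D1 m x) * U0 r w0 x $ 3), 0, 0] :: complex^4"
  have Z: "?Z = app (cm (\<lambda>x. 0) m) (U0 r w0)"
    by (rule ext) (simp add: app_cmv cmv_cm vec_eq_iff forall_4 scaleR_conv_of_real)
  have ZL: "?Z \<in> L2" unfolding Z by (rule app_L2[OF bdd_m(5) W0_L2[OF r0]])
  have tZ: "(\<lambda>x. transpose (cm (\<lambda>x. 0) m x)) = cm m (\<lambda>x. 0)"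
    by (rule ext) (simp add: vec_eq_iff forall_4 transpose_def cm_def)
  have "pairing (U0 (t - r) ?Z) \<phi> = pr (abs_l2 (U0 (t - r) ?Z)) (abs_l2 \<phi>)"
    using solution_L2[OF U0_solution[OF ZL] tr] dom_Lam_L2[OF \<phi>] by (simp add: pr_abs)
  also have "\<dots> = pr (abs_l2 ?Z) (\<psi> r)"
    using dual.U_dual[OF ZL tr] solution_0[OF U0_solution[OF ZL] ZL] by (simp add: \<psi>_def)
  also have "abs_l2 ?Z = mulop (cm (\<lambda>x. 0) m) (v r)"
    unfolding Z by (rule mulop_abs[OF bdd_m(5) W0_L2[OF r0], symmetric])
  also have "pr (mulop (cm (\<lambda>x. 0) m) (v r)) (\<psi> r) = pr (v r) (mulop (cm m (\<lambda>x. 0)) (\<psi> r))"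
    using pr_mulop[of "cm (\<lambda>x. 0) m", unfolded tZ] bdd_m by blast
  finally show ?thesis by (simp add: N_integrand2_def e_def)
qed

lemma integrands_integrable:
  "(\<lambda>r. e r * pr (v r) (\<eta>rev r)) integrable_on {0..t}"
  "(\<lambda>r. e r * pr (v r) (\<eta>m r)) integrable_on {0..t}"
  "(\<lambda>r. e r * pr (v r) (mulop (cm m (\<lambda>x. 0)) (\<psi> r))) integrable_on {0..t}"
proof -
  have e: "continuous_on {0..t} (\<lambda>r. complex_of_real (e r))"
    by (intro continuous_on_of_real e_continuous)
  show "(\<lambda>r. e r * pr (v r) (\<eta>rev r)) integrable_on {0..t}"
    unfolding \<eta>rev_def
    by (intro integrable_continuous_real continuous_on_mult e pr.continuous_on v_continuous
        continuous_on_add continuous_on_diff mulop_continuous_on continuous)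
  show "(\<lambda>r. e r * pr (v r) (\<eta>m r)) integrable_on {0..t}"
    unfolding \<eta>m_def
    by (intro integrable_continuous_real continuous_on_mult e pr.continuous_on v_continuous
        continuous_on_add continuous_on_diff mulop_continuous_on continuous)
  show "(\<lambda>r. e r * pr (v r) (mulop (cm m (\<lambda>x. 0)) (\<psi> r))) integrable_on {0..t}"
    by (intro integrable_continuous_real continuous_on_mult e pr.continuous_on v_continuous
        mulop_continuous_on continuous)
qed

text \<open>The magnetic components of the background equation turn the difference of the first two
  terms into spatial derivatives of \<open>m E\<^sub>z\<close>.\<close>

lemma integrand_identity:
  "1/2 * (e r * pr (v r) (\<eta>rev r)) - 1/2 * (e r * pr (v r) (\<eta>m r))
    + 1 / complex_of_real (mu M) * (e r * pr (v r) (mulop (cm m (\<lambda>x. 0)) (\<psi> r)))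
   = - (e r *\<^sub>R pr (v r) (mulop Dm (G r)))"
proof -
  \<comment> \<open>The multipliers differ only on magnetic components, which \<open>B0\<close>
    annihilates.\<close>
  have 1: "mulop (B0 M) (mulop (dg (\<lambda>x. - m x) m m) (\<theta> r)) = mulop (B0 M) (mulop (dg m m m) (\<theta> r))"
    by (rule mulop_comp_commute) (auto intro!: bdd_B0 bdd_m simp: cmv_B0 cmv_dg)
  \<comment> \<open>\<open>cm m (\<lambda>x. 0)\<close> reads only magnetic components, on which
    \<open>A0\<close> is the constant \<open>mu M\<close>; this cancels the factor
    \<open>1 / mu M\<close>.\<close>
  have 2: "mulop (cm m (\<lambda>x. 0)) (\<psi> r) = mu M *\<^sub>R mulop (cm m (\<lambda>x. 0)) (\<theta> r)"
  proof -
    have "mulop (cm m (\<lambda>x. 0)) (mulop (A0 M) (\<theta> r)) = mulop (dg (\<lambda>x. 0) (\<lambda>x. 0) (\<lambda>x. 0)) (\<theta> r)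
        + mu M *\<^sub>R mulop (cm m (\<lambda>x. 0)) (\<theta> r) + 0 *\<^sub>R mulop (cm m m) (\<theta> r) + 0 *\<^sub>R mulop (cm m m) (\<theta> r)"
      by (intro mulop_comb bdd_m bdd_A0 bdd_dg coefficient_const)
        (simp add: cmv_cm A0_dg cmv_dg vec_eq_iff forall_4 algebra_simps)
    moreover have "mulop (dg (\<lambda>x. 0) (\<lambda>x. 0) (\<lambda>x. 0)) (\<theta> r) = 0"
      by (rule mulop_eq_0) (auto intro!: bdd_dg coefficient_const simp: cmv_dg vec_eq_iff forall_4)
    ultimately show ?thesis by (simp add: A0_\<theta>)
  qed
  have 3: "mulop (dg m (\<lambda>x. - m x) (\<lambda>x. 0)) (G r) = mulop (dg m m (\<lambda>x. 0)) (G r) - 2 *\<^sub>R mulop Dm (G r)"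
  proof -
    have "mulop (dg m (\<lambda>x. - m x) (\<lambda>x. 0)) (mulop (dg (\<lambda>x. 1) (\<lambda>x. 1) (\<lambda>x. 1)) (G r))
        = mulop (dg m m (\<lambda>x. 0)) (G r) + (-2) *\<^sub>R mulop Dm (G r) + 0 *\<^sub>R mulop Dm (G r) + 0 *\<^sub>R mulop Dm (G r)"
      by (intro mulop_comb bdd_m bdd_dg coefficient_const) (simp add: cmv_dg vec_eq_iff forall_4 scaleR_conv_of_real)
    then show ?thesis by (simp add: mulop_id)
  qed
  have 4: "mulop (cm (\<lambda>x. - m x) m) (\<theta> r) = mulop (cm m m) (\<theta> r) - 2 *\<^sub>R mulop (cm m (\<lambda>x. 0)) (\<theta> r)"
  proof -
    have "mulop (cm (\<lambda>x. - m x) m) (mulop (dg (\<lambda>x. 1) (\<lambda>x. 1) (\<lambda>x. 1)) (\<theta> r))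
        = mulop (cm m m) (\<theta> r) + (-2) *\<^sub>R mulop (cm m (\<lambda>x. 0)) (\<theta> r) + 0 *\<^sub>R mulop Dm (\<theta> r) + 0 *\<^sub>R mulop Dm (\<theta> r)"
      by (intro mulop_comb bdd_m bdd_dg coefficient_const)
        (simp add: cmv_dg cmv_cm vec_eq_iff forall_4 pd_uminus[OF m(1)] scaleR_conv_of_real algebra_simps)
    then show ?thesis by (simp add: mulop_id)
  qed
  \<comment> \<open>Both factors 2 come from the sign of \<Gamma> on magnetic components and are
    removed by the 1/2 in the formulas.\<close>
  have "\<eta>rev r = \<eta>m r - 2 *\<^sub>R mulop Dm (G r) - 2 *\<^sub>R mulop (cm m (\<lambda>x. 0)) (\<theta> r)"
    unfolding \<eta>rev_def \<eta>m_def 1 3 4 by (simp add: algebra_simps)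
  then have eq: "pr (v r) (\<eta>rev r) = pr (v r) (\<eta>m r) - 2 * pr (v r) (mulop Dm (G r)) - 2 * pr (v r) (mulop (cm m (\<lambda>x. 0)) (\<theta> r))"
    by (simp add: pr.diff_right pr.scaleR_right scaleR_conv_of_real)
  show ?thesis
    unfolding 2 eq using nz(1) by (simp add: pr.scaleR_right scaleR_conv_of_real algebra_simps)
qed

end

end

lemma (in background) dt_U0_initial:
  assumes w: "w \<in> L2" and \<phi>: "\<phi> \<in> dom_Lam"
  shows "dt (\<lambda>t. U0 t w) 0 \<phi> = - app_fun (A0_inv M) (\<lambda>\<psi>. Lam_ext w \<psi> + pairing (app (B0 M) w) \<psi>) \<phi>"
proof -
  define \<theta> where "\<theta> = app (A0_inv M) \<phi>"
  have \<phi>L: "\<phi> \<in> L2" using \<phi> by (rule dom_Lam_L2)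
  have \<theta>L: "\<theta> \<in> L2" and \<theta>a: "abs_l2 \<theta> = mulop (A0_inv M) (abs_l2 \<phi>)"
    unfolding \<theta>_def using bdd_A0 \<phi>L by (simp_all add: app_L2 mulop_abs)
  have "\<theta> \<in> dom_Lam"
    using lamr_A0(2)[OF Lam_dom_lamr(2)[OF \<phi>]] dom_Lam_iff[OF \<theta>L] by (simp add: \<theta>a)
  note G = Lam_dom_lamr[OF this]
  have "H (abs_l2 \<phi>) (abs_l2 (Lam_dom \<theta>) - mulop (B0 M) (abs_l2 \<theta>))"
    using G(2) by (auto simp: H_def \<theta>a)
  from dt_U0[OF w \<phi>L this order_refl]
  have "dt (\<lambda>t. U0 t w) 0 \<phi> = pr (abs_l2 w) (abs_l2 (Lam_dom \<theta>)) - pr (abs_l2 w) (mulop (B0 M) (abs_l2 \<theta>))"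
    by (simp add: solution_0[OF U0_solution[OF w] w] pr.diff_right)
  moreover have "Lam_ext w \<theta> = - pr (abs_l2 w) (abs_l2 (Lam_dom \<theta>))"
    using w G by (simp add: Lam_ext_def pr_abs)
  moreover have "pairing (app (B0 M) w) \<theta> = pr (abs_l2 w) (mulop (B0 M) (abs_l2 \<theta>))"
    using pr_mulop[of "B0 M" "abs_l2 w" "abs_l2 \<theta>"] bdd_B0 w \<theta>L by (simp add: mulop_abs pr_abs app_L2)
  ultimately show ?thesis by (simp add: app_fun_def \<theta>_def[symmetric])
qed

section \<open>Assembly of the decomposition and the reversed component\<close>

context modulated
begin

lemma dt_exists_Vu_e3:
  assumes t: "t \<ge> 0"
  shows "dt_exists (Vu_e3 V (\<lambda>s x. W s x $ 3 - U0 s w0 x $ 3)) t"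
  unfolding dt_exists_def
proof
  fix \<phi> assume \<phi>: "\<phi> \<in> dom_Lam"
  have X: "pairing (Vu_e3 V (\<lambda>s x. W s x $ 3 - U0 s w0 x $ 3) s) \<phi> = e s *\<^sub>R pr (w s - v s) (mulop Dm (abs_l2 \<phi>))"
    if "s \<in> {0..}" for s
    using Vu_e3_pairing[OF L2_diff[OF W_L2 W0_L2] dom_Lam_L2[OF \<phi>]] that
    by (simp add: Vu_e3_def[abs_def] abs_l2_diff W_L2 W0_L2)
  obtain G where G: "lamr (mulop Dm (abs_l2 \<phi>)) G"
    using lamr_mulop[OF coefficient_const m_coeff coefficient_const Lam_dom_lamr(2)[OF \<phi>]] by blast
  then obtain \<zeta> where \<zeta>: "H (mulop Dm (abs_l2 \<phi>)) \<zeta>" using lamr_H by blast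
  have "((\<lambda>s. pr (w s - v s) (mulop Dm (abs_l2 \<phi>))) has_vector_derivative
      dv w t (mulop Dm (abs_l2 \<phi>)) - pr (v t) \<zeta>) (at t within {0..})"
    unfolding pr.diff_left by (intro has_vector_derivative_diff W_dv[OF G t] W0_dv[OF \<zeta> t])
  from has_vector_derivative_transform[OF _ X has_vector_derivative_scaleR[OF e_derivative this]] t
  show "(\<lambda>s. pairing (Vu_e3 V (\<lambda>s x. W s x $ 3 - U0 s w0 x $ 3) s) \<phi>) differentiable (at t within {0..})"
    by (intro differentiableI_vector) auto
qed

lemma decomposition:
  assumes t: "t \<ge> T + \<tau> / 2" and \<phi>: "\<phi> \<in> dom_Lam"
  shows "(\<lambda>r. rev_integrand U0 \<eta> \<tau> T m (\<lambda>t. U0 t w0) t r \<phi>) integrable_on {0..t}" (is ?i1)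
    and "(\<lambda>r. N_integrand1 U0 V (\<lambda>t. U0 t w0) t r \<phi>) integrable_on {0..t}" (is ?i2)
    and "(\<lambda>r. N_integrand2 U0 \<eta> \<tau> T m (\<lambda>r x. U0 r w0 x $ 3) t r \<phi>) integrable_on {0..t}" (is ?i3)
    and "(\<lambda>r. N_integrand3 M U0 V (\<lambda>r x. W r x $ 3 - U0 r w0 x $ 3) t r \<phi>) integrable_on {0..t}" (is ?i4)
    and "pairing (W t) \<phi> = pairing (U0 t w0) \<phi> + w_rev U0 \<eta> \<tau> T m (\<lambda>t. U0 t w0) t \<phi>
      + N_rem M U0 \<eta> \<tau> T m (\<lambda>t. U0 t w0) W t \<phi>" (is ?eq)
proof -
  obtain \<zeta> where \<zeta>: "H (abs_l2 \<phi>) \<zeta>" using dom_Lam_H[OF \<phi>] by blast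
  have t0: "t \<ge> 0" using t tau by simp
  let ?R = "\<lambda>r. rev_integrand U0 \<eta> \<tau> T m (\<lambda>t. U0 t w0) t r \<phi>"
  let ?N1 = "\<lambda>r. N_integrand1 U0 V (\<lambda>t. U0 t w0) t r \<phi>"
  let ?N2 = "\<lambda>r. N_integrand2 U0 \<eta> \<tau> T m (\<lambda>r x. U0 r w0 x $ 3) t r \<phi>"
  let ?N3 = "\<lambda>r. N_integrand3 M U0 V (\<lambda>r x. W r x $ 3 - U0 r w0 x $ 3) t r \<phi>"
  let ?FW = "\<lambda>r. N_integrand3 M U0 V (\<lambda>r x. W r x $ 3) t r \<phi>"
  let ?F0 = "\<lambda>r. N_integrand3 M U0 V (\<lambda>r x. U0 r w0 x $ 3) t r \<phi>"
  let ?Q = "\<lambda>r. 1/2 * ?R r - 1/2 * ?N1 r + 1 / complex_of_real (mu M) * ?N2 r"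
  show i1: ?i1
    by (rule integrable_eq[OF integrands_integrable(1)[OF \<phi> \<zeta>]]) (simp add: rev_integrand_eq[OF \<phi> \<zeta>])
  show i2: ?i2
    by (rule integrable_eq[OF integrands_integrable(2)[OF \<phi> \<zeta>]]) (simp add: N_integrand1_eq[OF \<phi> \<zeta>])
  show i3: ?i3
    by (rule integrable_eq[OF integrands_integrable(3)[OF \<phi> \<zeta>]]) (simp add: N_integrand2_eq[OF \<phi> \<zeta>])
  have Q: "(?Q has_integral (1/2 * integral {0..t} ?R - 1/2 * integral {0..t} ?N1
      + 1 / complex_of_real (mu M) * integral {0..t} ?N2)) {0..t}"
    by (intro has_integral_add has_integral_diff has_integral_mult_right integrable_integral i1 i2 i3)
  have Qe: "?Q r = - (e r *\<^sub>R pr (v r) (mulop Dm (G \<phi> \<zeta> t r)))" if "r \<in> {0..t}" for r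
    using integrand_identity[OF \<phi> \<zeta>, of r t] that
    by (simp only: rev_integrand_eq[OF \<phi> \<zeta>] N_integrand1_eq[OF \<phi> \<zeta>] N_integrand2_eq[OF \<phi> \<zeta>])
  have "((\<lambda>r. ?FW r - (?F0 r + e r *\<^sub>R pr (v r) (mulop Dm (G \<phi> \<zeta> t r)))) has_integral
      pr (w t - v t) (abs_l2 \<phi>) - 0) {0..t}"
    by (intro has_integral_diff N3_W_integral[OF \<phi> \<zeta> t0] N3_U0_integral[OF \<phi> \<zeta> t])
  then have "((\<lambda>r. ?N3 r + ?Q r) has_integral pr (w t - v t) (abs_l2 \<phi>) - 0) {0..t}"
  proof (rule has_integral_eq[rotated])
    fix r assume r: "r \<in> {0..t}"
    show "?FW r - (?F0 r + e r *\<^sub>R pr (v r) (mulop Dm (G \<phi> \<zeta> t r))) = ?N3 r + ?Q r"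
      unfolding Qe[OF r] N3_diff[OF \<phi> \<zeta> r] by simp
  qed
  \<comment> \<open>Integrability of the third integrand is inferred by subtraction: no continuity
    of \<open>dv w r\<close> in \<open>r\<close> is at hand, whereas the Duhamel integral exists by
    the fundamental theorem of calculus.\<close>
  from has_integral_diff[OF this Q]
  have N3: "(?N3 has_integral (pr (w t - v t) (abs_l2 \<phi>) - 0 - (1/2 * integral {0..t} ?R - 1/2 * integral {0..t} ?N1
      + 1 / complex_of_real (mu M) * integral {0..t} ?N2))) {0..t}"
    by simp
  then show ?i4 by blast
  show ?eq
    using integral_unique[OF N3] t0 dom_Lam_L2[OF \<phi>]
    by (simp add: w_rev_def N_rem_def wint_def pr.diff_left pr_abs W_L2 W0_L2)
qed

text \<open>With \<open>r = s + T\<close> the remaining time \<open>2 * T - r\<close> is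
  \<open>T - s\<close>. The transposed group commutes with its generator, so a derivative at time
  \<open>T + s\<close> is the derivative at time 0 with \<open>U0 (T + s)\<close> moved to the test
  element. The range of \<open>s\<close> keeps both times nonnegative.\<close>

lemma rev_integrand_shift:
  assumes \<phi>: "\<phi> \<in> dom_Lam" and s: "s \<in> {- \<tau> / 2..\<tau> / 2}"
  shows "K_integrand U0 \<eta> \<tau> T m (dt (\<lambda>t. U0 t w0) 0) s \<phi> = rev_integrand U0 \<eta> \<tau> T m (\<lambda>t. U0 t w0) (2 * T) (s + T) \<phi>"
proof -
  have s0: "T - s \<ge> 0" "T + s \<ge> 0" using s tau by auto
  define \<xi> where "\<xi> = app (\<lambda>x. transpose (m x *\<^sub>R Gam)) (Defs.transp (U0 (T - s)) \<phi>)"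
  have M: "(\<lambda>x. transpose (m x *\<^sub>R Gam)) = dg (\<lambda>x. - m x) m m"
    by (rule ext) (simp add: vec_eq_iff forall_4 transpose_def Gam_def dg_def diag_def)
  obtain \<zeta> where \<zeta>: "H (abs_l2 \<phi>) \<zeta>" using dom_Lam_H[OF \<phi>] by blast
  note tr = transp_U0[OF dom_Lam_L2[OF \<phi>] s0(1)]
  have \<xi>L: "\<xi> \<in> L2" and \<xi>a: "abs_l2 \<xi> = mulop (dg (\<lambda>x. - m x) m m) (dual.S (T - s) (abs_l2 \<phi>))"
    unfolding \<xi>_def M using bdd_m tr by (auto simp: app_L2 mulop_abs[symmetric])
  obtain \<omega> where \<omega>: "H (abs_l2 \<xi>) \<omega>"
    using H_multiply[OF coefficient_uminus[OF m_coeff] m_coeff m_coeff dual.S_domain[OF \<zeta> s0(1)]] \<xi>a by metis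
  note tr' = transp_U0[OF \<xi>L s0(2)]
  have "dt (\<lambda>t. U0 t w0) 0 (Defs.transp (U0 (T + s)) \<xi>) = pr (v 0) (dual.S (T + s) \<omega>)"
    by (rule dt_U0[OF w0 tr'(1)]) (use dual.S_domain[OF \<omega> s0(2)] tr'(2) in simp_all)
  also have "\<dots> = dt (\<lambda>t. U0 t w0) (T + s) \<xi>"
    using dt_U0[OF w0 \<xi>L \<omega> s0(2)] dual.U_dual[OF w0 s0(2)] by simp
  finally show ?thesis
    by (simp add: K_integrand_def rev_integrand_def ext_def app_fun_def \<xi>_def add.commute)
qed

lemma K_op_eq:
  assumes \<phi>: "\<phi> \<in> dom_Lam"
  shows "(\<lambda>s. K_integrand U0 \<eta> \<tau> T m (dt (\<lambda>t. U0 t w0) 0) s \<phi>) integrable_on {- \<tau> / 2..\<tau> / 2}"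
    and "w_rev U0 \<eta> \<tau> T m (\<lambda>t. U0 t w0) (2 * T) \<phi> = K_op U0 \<eta> \<tau> T m (dt (\<lambda>t. U0 t w0) 0) \<phi>"
proof -
  let ?R = "\<lambda>r. rev_integrand U0 \<eta> \<tau> T m (\<lambda>t. U0 t w0) (2 * T) r \<phi>"
  \<comment> \<open>The pulse cuts the integral over \<open>{0..2 * T}\<close> down to a window
    inside it, which is then translated by \<open>T\<close>.\<close>
  have z: "?R r = 0" if "r \<notin> {T - \<tau> / 2..T + \<tau> / 2}" for r
  proof -
    have "e r = 0" by (rule e_eq_0) (use that in \<open>auto simp: abs_if\<close>)
    then show ?thesis by (simp add: rev_integrand_def e_def)
  qed
  have "(?R has_integral integral {0..2 * T} ?R) {0..2 * T}"
    by (rule integrable_integral, rule decomposition(1)[OF _ \<phi>]) (use tau in simp)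
  then have "((\<lambda>r. if r \<in> {T - \<tau> / 2..T + \<tau> / 2} then ?R r else 0) has_integral integral {0..2 * T} ?R) {0..2 * T}"
    by (rule has_integral_eq[rotated]) (use z in auto)
  then have "(?R has_integral integral {0..2 * T} ?R) {T - \<tau> / 2..T + \<tau> / 2}"
    by (subst (asm) has_integral_restrict) (use tau in auto)
  from has_integral_shift_real_ivl[OF this, of T]
  have "((\<lambda>s. ?R (s + T)) has_integral integral {0..2 * T} ?R) {- \<tau> / 2..\<tau> / 2}" by simp
  then have K: "((\<lambda>s. K_integrand U0 \<eta> \<tau> T m (dt (\<lambda>t. U0 t w0) 0) s \<phi>) has_integral integral {0..2 * T} ?R) {- \<tau> / 2..\<tau> / 2}"
    by (rule has_integral_eq[rotated]) (simp add: rev_integrand_shift[OF \<phi>])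
  then show "(\<lambda>s. K_integrand U0 \<eta> \<tau> T m (dt (\<lambda>t. U0 t w0) 0) s \<phi>) integrable_on {- \<tau> / 2..\<tau> / 2}"
    by blast
  show "w_rev U0 \<eta> \<tau> T m (\<lambda>t. U0 t w0) (2 * T) \<phi> = K_op U0 \<eta> \<tau> T m (dt (\<lambda>t. U0 t w0) 0) \<phi>"
    using integral_unique[OF K] by (simp add: w_rev_def K_op_def wint_def)
qed

end

theorem proposition2p2:
  fixes M :: medium
    and U0 :: "real \<Rightarrow> field \<Rightarrow> field"
    and \<eta> :: "real \<Rightarrow> real"
    and m :: "real^2 \<Rightarrow> real"
    and \<nu> h T \<kappa> :: real
    and w0 :: field
    and W W0 :: "real \<Rightarrow> field"
    and \<tau> :: real
    and V :: modulation
    and E E0 :: "real \<Rightarrow> real^2 \<Rightarrow> complex"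
    and \<Upsilon> :: functional
  defines "\<tau> \<equiv> \<nu> * h"
    and "V \<equiv> V_mod \<eta> \<tau> T m"
    and "W0 \<equiv> \<lambda>t. U0 t w0"
    and "E \<equiv> \<lambda>t x. W t x $ 3"
    and "E0 \<equiv> \<lambda>t x. W0 t x $ 3"
    and "\<Upsilon> \<equiv> dt W0 0"
  assumes medium: "admissible_medium M"
    and group: "background_group M U0"
    and eta: "Cinf \<eta>" "closure {t. \<eta> t \<noteq> 0} \<subseteq> {-1/2<..<1/2}"
    and tau: "\<nu> > 0" "h > 0" "T > \<tau> / 2"
    and m: "Cinf m" "bounded {x. m x \<noteq> 0}"
    and kappa: "\<kappa> > 0" "\<And>t x. 1 + V t x \<ge> \<kappa>"
    and w0: "w0 \<in> L2"
    and W: "solution (A_mod M V) (B_mod M V) w0 W"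
  shows
    "dt_exists W0 0 \<and>
     (\<forall>\<phi>\<in>dom_Lam.
       \<Upsilon> \<phi> = - app_fun (A0_inv M) (\<lambda>\<psi>. Lam_ext w0 \<psi> + pairing (app (B0 M) w0) \<psi>) \<phi>) \<and>
     \<comment> \<open>the derivatives and integrals in the formulas exist\<close>
     (\<forall>r\<ge>0. dt_exists W0 r \<and> dt_exists (Vu_e3 V (\<lambda>t x. E t x - E0 t x)) r) \<and>
     (\<forall>t \<ge> T + \<tau>/2.
       wint_exists 0 t (rev_integrand U0 \<eta> \<tau> T m W0 t) \<and>
       wint_exists 0 t (N_integrand1 U0 V W0 t) \<and>
       wint_exists 0 t (N_integrand2 U0 \<eta> \<tau> T m E0 t) \<and>
       wint_exists 0 t (N_integrand3 M U0 V (\<lambda>r x. E r x - E0 r x) t)) \<and>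
     wint_exists (- \<tau>/2) (\<tau>/2) (K_integrand U0 \<eta> \<tau> T m \<Upsilon>) \<and>
     \<comment> \<open>the exact form of the solution\<close>
     (\<forall>t \<ge> T + \<tau>/2. \<forall>\<phi>\<in>dom_Lam.
       pairing (W t) \<phi> =
         pairing (W0 t) \<phi> + w_rev U0 \<eta> \<tau> T m W0 t \<phi> + N_rem M U0 \<eta> \<tau> T m W0 W t \<phi>) \<and>
     \<comment> \<open>the reversed component at time 2T\<close>
     (\<forall>\<phi>\<in>dom_Lam. w_rev U0 \<eta> \<tau> T m W0 (2 * T) \<phi> = K_op U0 \<eta> \<tau> T m \<Upsilon> \<phi>)"
proof -
  note defs = \<tau>_def V_def W0_def E_def E0_def \<Upsilon>_def
  interpret b: modulated M U0 \<eta> \<tau> T \<kappa> m w0 W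
    using medium group eta tau m kappa w0 W unfolding defs
    by unfold_locales (auto intro: mult_pos_pos)
  have Wd: "dt_exists (\<lambda>t. U0 t w0) r" if "r \<ge> 0" for r
    using b.U0_solution[OF w0] that by (simp add: solution_def)
  show ?thesis
    unfolding V_def W0_def E_def E0_def \<Upsilon>_def wint_exists_def
    using Wd b.dt_U0_initial[OF w0] b.dt_exists_Vu_e3 b.decomposition b.K_op_eq
    by blast
qed

end
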